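(* Let $G$ be a countable discrete sofic group and let $(A^G,\mu)$ be a $G$-process with finite state space $A$. Suppose that for some sofic approximation $\Sigma=(\sigma_n:G\to\mathrm{Sym}(V_n))$ to $G$ there is a uniformly model-mixing sequence $(\mu_n)_{n=1}^\infty$, $\mu_n\in\mathrm{Prob}(A^{V_n})$, which locally and empirically converges to $\mu$ over $\Sigma$. Then $(A^G,\mu)$ has completely positive lower model-measure sofic entropy with respect to $\Sigma$.
   Context: Processes. For a countable group $G$ and a standard Borel space $Y$, $G$ acts on $Y^G$ by the right shift $(g\cdot a)(h)=a(hg)$. A $G$-process over the state space $Y$ is a Borel probability measure $\mu$ on $Y^G$ invariant under this action. For a measurable map $\psi:A^G\to Y$ let $\psi^G:A^G\to Y^G$ be $\psi^G(a)(g)=\psi(g\cdot a)$. For $F\subseteq G$, $\mu_F=\pi_{F*}\mu$ is the marginal of $\mu$ on $A^F$, where $\pi_W:A^S\to A^W$ denotes coordinate projection for $W\subseteq S$. $\mathrm H$ denotes Shannon entropy of a probability measure on a finite set. Sofic approximations. A sofic approximation to $G$ is a sequence $\Sigma=(\sigma_n:G\to\mathrm{Sym}(V_n))_{n\ge1}$ of maps, $V_n$ finite sets with $|V_n|\to\infty$, such that (writing $\sigma^g\cdot v=\sigma(g)(v)$) $|\{v\in V_n:\sigma_n^{g}\sigma_n^{h}\cdot v=\sigma_n^{gh}\cdot v\}|=(1-o(1))|V_n|$ for all $g,h\in G$ and $|\{v\in V_n:\sigma_n^g\cdot v\neq v\}|=(1-o(1))|V_n|$ for all $g\neq 1_G$.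 $G$ is sofic if it has a sofic approximation. Convergence. Let $(Y,d)$ be a compact metric space (a finite set being given the discrete metric). For $\sigma:G\to\mathrm{Sym}(V)$, $v\in V$ and $\overline y\in Y^V$ let $\Pi_v^\sigma(\overline y)\in Y^G$ be $\Pi_v^\sigma(\overline y)(g)=\overline y(\sigma^g\cdot v)$, and let $P^\sigma_{\overline y}=\frac1{|V|}\sum_{v\in V}\delta_{\Pi^\sigma_v(\overline y)}$. Given a $G$-process $(Y^G,\mu)$ and $\mu_n\in\mathrm{Prob}(Y^{V_n})$, $(\mu_n)$ locally and empirically converges to $\mu$ over $\Sigma$ if for every weak-star neighbourhood $\mathcal O$ of $\mu$ in $\mathrm{Prob}(Y^G)$: (1) $|\{v\in V_n:(\Pi_v^{\sigma_n})_*\mu_n\in\mathcal O\}|=(1-o(1))|V_n|$, and (2) $\mu_n(\{\overline y:P^{\sigma_n}_{\overline y}\in\mathcal O\})\to1$. Metrics on sofic approximations. Fix a proper (all balls finite) right-invariant metric $\rho$ on $G$. For a finite set $V$ and $\sigma:G\to\mathrm{Sym}(V)$ let $H_\sigma$ be the graph on $V$ with an edge between $v$ and $w$ iff $\sigma^g\cdot v=w$ or $\sigma^g\cdot w=v$ for some $g\in G$, with edge weights $W(v,w)=\min\{\rho(g,1_G):\sigma^g\cdot v=w\text{ or }\sigma^g\cdot w=v\}$. On each connected component of $H_\sigma$ let $\rho_\sigma$ be the $W$-weighted graph distance, and set $\rho_\sigma(v,w)=M$ for $v,w$ in distinct components, where $M$ is a chosen number much larger than (in particular larger than) the $\rho_\sigma$-distance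 between any two points in a common component. Write $\rho_n=\rho_{\sigma_n}$. A set is $r$-separated if distinct points are at distance at least $r$. Uniform model-mixing. Write $\sigma^F(S)=\{\sigma^g\cdot s:g\in F,s\in S\}$. The sequence $(\mu_n)$, $\mu_n\in\mathrm{Prob}(A^{V_n})$, is uniformly model-mixing if for every finite $F\subseteq G$ and $\epsilon>0$ there are $r<\infty$ and subsets $W_n\subseteq V_n$ with $|W_n|=(1-o(1))|V_n|$ such that if $S\subseteq W_n$ is $r$-separated according to $\rho_n$, then $\mathrm H(\pi_{\sigma_n^F(S)*}\mu_n)\ge|S|\cdot(\mathrm H(\mu_F)-\epsilon)$. Lower model-measure sofic entropy. On $Y^V$ put $d^{(V)}(\overline x,\overline y)=\frac1{|V|}\sum_{v}d(\overline x(v),\overline y(v))$. For $\eta\in\mathrm{Prob}(Y^V)$ let $\mathrm{cov}_{\epsilon,\delta}(\eta,d^{(V)})$ be the minimal cardinality of $F\subseteq Y^V$ such that the $\delta$-neighbourhood of $F$ has $\eta$-measure $>1-\epsilon$. Then $$\underline{\mathrm h}^{\mathrm q}_\Sigma(\mu)=\sup\Big\{\sup_{\epsilon,\delta>0}\liminf_{n\to\infty}\tfrac1{|V_n|}\log\mathrm{cov}_{\epsilon,\delta}(\mu_n,d^{(V_n)})\Big\},$$ the outer supremum being over all sequences $(\mu_n)$, $\mu_n\in\mathrm{Prob}(Y^{V_n})$, which locally and empirically converge to $\mu$ over $\Sigma$ (and $\sup\emptyset=-\infty$). (For finite $Y$, one may equivalently replace $\mathrm{cov}_{\epsilon,\delta}$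 by $\mathrm{cov}_\epsilon(\eta)=\min\{|F|:\eta(F)>1-\epsilon\}$.) $(A^G,\mu)$ has completely positive lower model-measure sofic entropy with respect to $\Sigma$ if every nontrivial factor has positive lower model-measure sofic entropy relative to $\Sigma$; that is, for every compact metric space $(Y,d)$ and measurable $\psi:A^G\to Y$ such that $\psi^G_*\mu$ is not a point mass, $\underline{\mathrm h}^{\mathrm q}_\Sigma(\psi^G_*\mu)>0$. *)

theory Defs
  imports "HOL-Probability.Probability" "HOL-Combinatorics.Permutations"
begin

text \<open>
  The group is a type of class \<^class>\<open>group_add\<close>, which is not assumed commutative: \<open>g + h\<close> is the
  product \<open>gh\<close> and \<open>0\<close> is the identity. The finite sets \<open>V\<^sub>n\<close> are subsets of one common
  type of vertices, and \<open>Y\<^bsup>V\<^esup>\<close> is the space of \<open>PiM V (\<lambda>_. borel)\<close>, that is, the functions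
  that are \<open>undefined\<close> outside \<open>V\<close>.
\<close>

section \<open>Processes\<close>

definition gshift :: "'g::group_add \<Rightarrow> ('g \<Rightarrow> 'y) \<Rightarrow> 'g \<Rightarrow> 'y" where
  "gshift g a = (\<lambda>h. a (h + g))"

definition equivariant_map :: "(('g::group_add \<Rightarrow> 'a) \<Rightarrow> 'y) \<Rightarrow> ('g \<Rightarrow> 'a) \<Rightarrow> 'g \<Rightarrow> 'y" where
  "equivariant_map \<psi> a = (\<lambda>g. \<psi> (gshift g a))"

definition borel_prob :: "'x::topological_space measure set" where
  "borel_prob = {\<nu>. prob_space \<nu> \<and> sets \<nu> = sets borel}"

definition process :: "('g::group_add \<Rightarrow> 'y::topological_space) measure \<Rightarrow> bool" where
  "process \<mu> \<longleftrightarrow> \<mu> \<in> borel_prob \<and> (\<forall>g. distr \<mu> borel (gshift g) = \<mu>)"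

definition prob_on :: "'v set \<Rightarrow> ('v \<Rightarrow> 'y::topological_space) measure set" where
  "prob_on V = {\<nu>. prob_space \<nu> \<and> sets \<nu> = sets (PiM V (\<lambda>_. borel))}"

definition marginal :: "'s set \<Rightarrow> ('s \<Rightarrow> 'y::topological_space) measure \<Rightarrow> ('s \<Rightarrow> 'y) measure" where
  "marginal W \<nu> = distr \<nu> (PiM W (\<lambda>_. borel)) (\<lambda>y. restrict y W)"

text \<open>Only for measures on a finite space; the convention \<open>0 ln 0 = 0\<close> is automatic since \<open>ln 0 = 0\<close>.\<close>

definition shannon_entropy :: "'x measure \<Rightarrow> real" where
  "shannon_entropy \<nu> = - (\<Sum>x\<in>space \<nu>. measure \<nu> {x} * ln (measure \<nu> {x}))"

section \<open>Sofic approximations\<close>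

definition sofic_approximation :: "(nat \<Rightarrow> 'v set) \<Rightarrow> (nat \<Rightarrow> 'g::group_add \<Rightarrow> 'v \<Rightarrow> 'v) \<Rightarrow> bool" where
  "sofic_approximation V \<sigma> \<longleftrightarrow>
     (\<forall>n. finite (V n)) \<and>
     filterlim (\<lambda>n. card (V n)) at_top sequentially \<and>
     (\<forall>n g. \<sigma> n g permutes V n) \<and>
     (\<forall>g h. (\<lambda>n. real (card {v \<in> V n. \<sigma> n g (\<sigma> n h v) = \<sigma> n (g + h) v}) / real (card (V n)))
               \<longlonglongrightarrow> 1) \<and>
     (\<forall>g. g \<noteq> 0 \<longrightarrow>
        (\<lambda>n. real (card {v \<in> V n. \<sigma> n g v \<noteq> v}) / real (card (V n))) \<longlonglongrightarrow> 1)"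

definition sofic_image :: "('g \<Rightarrow> 'v \<Rightarrow> 'v) \<Rightarrow> 'g set \<Rightarrow> 'v set \<Rightarrow> 'v set" where
  "sofic_image \<sigma> F S = {\<sigma> g s | g s. g \<in> F \<and> s \<in> S}"

section \<open>Local and empirical convergence\<close>

definition weak_star_topology :: "'x::topological_space measure topology" where
  "weak_star_topology = topology_generated_by
     {{\<nu> \<in> borel_prob. (\<integral>x. f x \<partial>\<nu>) \<in> U} | f U.
        continuous_on UNIV f \<and> bounded (range f) \<and> open (U :: real set)}"

definition pullback_name :: "('g \<Rightarrow> 'v \<Rightarrow> 'v) \<Rightarrow> 'v \<Rightarrow> ('v \<Rightarrow> 'y) \<Rightarrow> 'g \<Rightarrow> 'y" where
  "pullback_name \<sigma> v y = (\<lambda>g. y (\<sigma> g v))"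

definition empirical :: "'v set \<Rightarrow> ('g \<Rightarrow> 'v \<Rightarrow> 'v) \<Rightarrow> ('v \<Rightarrow> 'y::topological_space) \<Rightarrow> ('g \<Rightarrow> 'y) measure" where
  "empirical V \<sigma> y = distr (uniform_count_measure V) borel (\<lambda>v. pullback_name \<sigma> v y)"

text \<open>
  It suffices to test open neighbourhoods, since every neighbourhood contains an open one and
  both conditions are monotone in \<open>U\<close>.
\<close>

definition local_empirical_convergence ::
  "(nat \<Rightarrow> 'v set) \<Rightarrow> (nat \<Rightarrow> 'g \<Rightarrow> 'v \<Rightarrow> 'v) \<Rightarrow> (nat \<Rightarrow> ('v \<Rightarrow> 'y::topological_space) measure)
     \<Rightarrow> ('g \<Rightarrow> 'y) measure \<Rightarrow> bool" where
  "local_empirical_convergence V \<sigma> \<mu>s \<mu> \<longleftrightarrow>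
     (\<forall>U. openin weak_star_topology U \<and> \<mu> \<in> U \<longrightarrow>
        (\<lambda>n. real (card {v \<in> V n. distr (\<mu>s n) borel (pullback_name (\<sigma> n) v) \<in> U})
                / real (card (V n))) \<longlonglongrightarrow> 1 \<and>
        (\<lambda>n. measure (\<mu>s n) {y \<in> space (\<mu>s n). empirical (V n) (\<sigma> n) y \<in> U}) \<longlonglongrightarrow> 1)"

section \<open>Metrics on sofic approximations\<close>

definition proper_right_invariant_metric :: "('g::group_add \<Rightarrow> 'g \<Rightarrow> real) \<Rightarrow> bool" where
  "proper_right_invariant_metric \<rho> \<longleftrightarrow>
     Metric_space UNIV \<rho> \<and>
     (\<forall>x r. finite (Metric_space.mball UNIV \<rho> x r)) \<and>
     (\<forall>g h k. \<rho> (g + k) (h + k) = \<rho> g h)"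

definition sofic_edge :: "'v set \<Rightarrow> ('g \<Rightarrow> 'v \<Rightarrow> 'v) \<Rightarrow> 'v \<Rightarrow> 'v \<Rightarrow> bool" where
  "sofic_edge V \<sigma> v w \<longleftrightarrow> v \<in> V \<and> w \<in> V \<and> (\<exists>g. \<sigma> g v = w \<or> \<sigma> g w = v)"

text \<open>For a proper metric the infimum over a nonempty set of \<open>g\<close> is a minimum.\<close>

definition edge_weight :: "('g::group_add \<Rightarrow> 'g \<Rightarrow> real) \<Rightarrow> ('g \<Rightarrow> 'v \<Rightarrow> 'v) \<Rightarrow> 'v \<Rightarrow> 'v \<Rightarrow> real" where
  "edge_weight \<rho> \<sigma> v w = Inf {\<rho> g 0 | g. \<sigma> g v = w \<or> \<sigma> g w = v}"

text \<open>\<open>sofic_walk V \<rho> \<sigma> v w l\<close>: some walk from \<open>v\<close> to \<open>w\<close> has total weight \<open>l\<close>.\<close>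

inductive sofic_walk ::
  "'v set \<Rightarrow> ('g::group_add \<Rightarrow> 'g \<Rightarrow> real) \<Rightarrow> ('g \<Rightarrow> 'v \<Rightarrow> 'v) \<Rightarrow> 'v \<Rightarrow> 'v \<Rightarrow> real \<Rightarrow> bool"
  for V \<rho> \<sigma> where
  Nil: "v \<in> V \<Longrightarrow> sofic_walk V \<rho> \<sigma> v v 0"
| Cons: "sofic_edge V \<sigma> u v \<Longrightarrow> sofic_walk V \<rho> \<sigma> v w l
           \<Longrightarrow> sofic_walk V \<rho> \<sigma> u w (edge_weight \<rho> \<sigma> u v + l)"

definition same_component :: "'v set \<Rightarrow> ('g \<Rightarrow> 'v \<Rightarrow> 'v) \<Rightarrow> 'v \<Rightarrow> 'v \<Rightarrow> bool" where
  "same_component V \<sigma> v w \<longleftrightarrow> v \<in> V \<and> w \<in> V \<and> (sofic_edge V \<sigma>)\<^sup>*\<^sup>* v w"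

definition sofic_dist ::
  "real \<Rightarrow> 'v set \<Rightarrow> ('g::group_add \<Rightarrow> 'g \<Rightarrow> real) \<Rightarrow> ('g \<Rightarrow> 'v \<Rightarrow> 'v) \<Rightarrow> 'v \<Rightarrow> 'v \<Rightarrow> real" where
  "sofic_dist M V \<rho> \<sigma> v w =
     (if same_component V \<sigma> v w then Inf {l. sofic_walk V \<rho> \<sigma> v w l} else M)"

definition exceeds_component_distances ::
  "real \<Rightarrow> 'v set \<Rightarrow> ('g::group_add \<Rightarrow> 'g \<Rightarrow> real) \<Rightarrow> ('g \<Rightarrow> 'v \<Rightarrow> 'v) \<Rightarrow> bool" where
  "exceeds_component_distances M V \<rho> \<sigma> \<longleftrightarrow>
     (\<forall>v w. same_component V \<sigma> v w \<longrightarrow> sofic_dist M V \<rho> \<sigma> v w < M)"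

definition separated :: "('v \<Rightarrow> 'v \<Rightarrow> real) \<Rightarrow> real \<Rightarrow> 'v set \<Rightarrow> bool" where
  "separated d r S \<longleftrightarrow> (\<forall>v\<in>S. \<forall>w\<in>S. v \<noteq> w \<longrightarrow> r \<le> d v w)"

section \<open>Uniform model-mixing\<close>

text \<open>The argument \<open>\<rho>n\<close> is the sequence of metrics on the sets \<open>V n\<close>.\<close>

definition uniformly_model_mixing ::
  "(nat \<Rightarrow> 'v set) \<Rightarrow> (nat \<Rightarrow> 'g \<Rightarrow> 'v \<Rightarrow> 'v) \<Rightarrow> (nat \<Rightarrow> 'v \<Rightarrow> 'v \<Rightarrow> real)
     \<Rightarrow> (nat \<Rightarrow> ('v \<Rightarrow> 'a::topological_space) measure) \<Rightarrow> ('g \<Rightarrow> 'a) measure \<Rightarrow> bool" where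
  "uniformly_model_mixing V \<sigma> \<rho>n \<mu>s \<mu> \<longleftrightarrow>
     (\<forall>F \<epsilon>. finite F \<and> \<epsilon> > 0 \<longrightarrow>
        (\<exists>r W. (\<forall>n. W n \<subseteq> V n) \<and>
           (\<lambda>n. real (card (W n)) / real (card (V n))) \<longlonglongrightarrow> 1 \<and>
           (\<forall>n S. S \<subseteq> W n \<and> separated (\<rho>n n) r S \<longrightarrow>
              shannon_entropy (marginal (sofic_image (\<sigma> n) F S) (\<mu>s n))
                \<ge> real (card S) * (shannon_entropy (marginal F \<mu>) - \<epsilon>))))"

section \<open>Lower model-measure sofic entropy\<close>

definition hamming_average :: "'v set \<Rightarrow> ('v \<Rightarrow> 'y::metric_space) \<Rightarrow> ('v \<Rightarrow> 'y) \<Rightarrow> real" where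
  "hamming_average V x y = (\<Sum>v\<in>V. dist (x v) (y v)) / real (card V)"

definition covering_number ::
  "real \<Rightarrow> real \<Rightarrow> 'v set \<Rightarrow> ('v \<Rightarrow> 'y::metric_space) measure \<Rightarrow> nat" where
  "covering_number \<epsilon> \<delta> V \<eta> =
     (LEAST k. \<exists>F. F \<subseteq> space \<eta> \<and> finite F \<and> card F = k \<and>
        measure \<eta> {y \<in> space \<eta>. \<exists>x\<in>F. hamming_average V x y < \<delta>} > 1 - \<epsilon>)"

text \<open>
  The explicit case \<open>log 0 = -\<infinity>\<close> concerns only \<open>\<epsilon> > 1\<close>, where the covering number is \<open>0\<close>; the
  real function \<^term>\<open>ln\<close> has \<open>ln 0 = 0\<close>.
\<close>

definition log_card :: "nat \<Rightarrow> ereal" where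
  "log_card k = (if k = 0 then -\<infinity> else ereal (ln (real k)))"

definition lower_model_measure_entropy ::
  "(nat \<Rightarrow> 'v set) \<Rightarrow> (nat \<Rightarrow> 'g \<Rightarrow> 'v \<Rightarrow> 'v) \<Rightarrow> ('g \<Rightarrow> 'y::metric_space) measure \<Rightarrow> ereal" where
  "lower_model_measure_entropy V \<sigma> \<mu> =
     (SUP \<mu>s \<in> {\<mu>s. (\<forall>n. \<mu>s n \<in> prob_on (V n)) \<and> local_empirical_convergence V \<sigma> \<mu>s \<mu>}.
        SUP (\<epsilon>, \<delta>) \<in> {0<..} \<times> {0<..}.
          liminf (\<lambda>n. log_card (covering_number \<epsilon> \<delta> (V n) (\<mu>s n)) / ereal (real (card (V n)))))"

text \<open>
  A compact metric space is a type \<open>'y\<close> with compact universe. A definition cannot quantify over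
  types, so the type is an argument; a theorem concluding the property for a type variable \<open>'y\<close>
  asserts it for all compact metric spaces. Compact metric spaces are second countable, so the
  class \<^class>\<open>second_countable_topology\<close> excludes none.
\<close>

definition completely_positive_entropy_for ::
  "'y::{metric_space, second_countable_topology} itself \<Rightarrow> (nat \<Rightarrow> 'v set)
     \<Rightarrow> (nat \<Rightarrow> 'g::group_add \<Rightarrow> 'v \<Rightarrow> 'v) \<Rightarrow> ('g \<Rightarrow> 'a::topological_space) measure \<Rightarrow> bool" where
  "completely_positive_entropy_for TYPE('y) V \<sigma> \<mu> \<longleftrightarrow>
     (compact (UNIV :: 'y set) \<longrightarrow>
       (\<forall>\<psi> \<in> (borel :: ('g \<Rightarrow> 'a) measure) \<rightarrow>\<^sub>M (borel :: 'y measure).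
          (\<nexists>y. distr \<mu> borel (equivariant_map \<psi>) = return borel y) \<longrightarrow>
          lower_model_measure_entropy V \<sigma> (distr \<mu> borel (equivariant_map \<psi>)) > 0))"

end

theory Submission
  imports Defs "HOL-Real_Asymp.Real_Asymp"
begin

text \<open>
  Over a factor \<open>\<psi>\<close> of \<open>\<mu>\<close>, models are obtained from the given \<open>\<mu>\<^sub>n\<close> by coding with local maps
  \<open>\<phi>\<^sub>m\<close> that approximate \<open>\<psi>\<close>, where \<open>m = m(n)\<close> tends to infinity slowly. Their covering numbers are
  bounded from below by a single Gibbs inequality. A small covering set \<open>W\<close> of the coded models gives
  a short code for \<open>\<mu>\<^sub>n\<close> restricted to the windows around a separated set \<open>S\<close>: first name a point of
  \<open>W\<close>, which predicts for most \<open>s \<in> S\<close> whether \<open>\<psi>\<close> lies in a fixed closed set of intermediate measure,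
  and then describe the window at \<open>s\<close> conditionally on this bit. The expected length is
  \<open>ln |W| + |S| (H(\<mu>\<^sub>F) - h)\<close> for some constant \<open>h > 0\<close>, whereas uniform mixing forces it to be at
  least \<open>|S| (H(\<mu>\<^sub>F) - \<epsilon>)\<close>.

  If \<open>G\<close> is infinite, the number \<open>M\<close> eventually exceeds the separation radius \<open>r\<close>, and bounded geometry
  provides separated sets of positive density. If \<open>G\<close> is finite, \<open>M\<close> may stay below \<open>r\<close> and the mixing
  hypothesis is then void; in this case the given models are replaced by independent copies of \<open>\<mu>\<close> on
  the free orbits, which mix trivially and converge by Chebyshev's inequality.
\<close>

text \<open>The bit must be decoded from an approximate coded value, and the error budget must be
  fixed before the local maps \<open>\<phi> m\<close> are known. The closed set \<open>B\<close> is
  therefore replaced by a local event \<open>P\<close> on a fixed window \<open>F\<close>, and a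
  value is decoded by its distance from \<open>B\<close>. Outside a small bad event this distance is
  below \<eta> when \<open>P\<close> holds and at least \<open>3 * \<eta>\<close> when it fails, so
  the threshold \<open>2 * \<eta>\<close> tolerates an error of \<eta> in the value. The gain
  \<open>h\<close> comes from conditioning on an event with measure in [\<tau>, 1 - \<tau>]: each of
  its two types has mass at most \<open>exp (- h)\<close>, even after a slight smoothing. A wrong
  bit costs \<open>D\<close>, and all error probabilities are scaled by \<open>h / D\<close>. A
  Hamming error is an average over all vertices but may be concentrated on the separated set, so
  \<delta> has to be small compared with the density \<open>c\<close> of that set. For this reason
  mixing must deliver \<open>c\<close> before the set of good vertices is specified.\<close>

section \<open>Local functions on the full shift\<close>

definition depends_on :: "'g set \<Rightarrow> (('g \<Rightarrow> 'a) \<Rightarrow> 'b) \<Rightarrow> bool" where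
  "depends_on K h \<longleftrightarrow> (\<forall>a a'. (\<forall>g\<in>K. a g = a' g) \<longrightarrow> h a = h a')"

definition cylinder :: "'g set \<Rightarrow> ('g \<Rightarrow> 'a) \<Rightarrow> ('g \<Rightarrow> 'a) set" where
  "cylinder K z = {a. \<forall>g\<in>K. a g = z g}"

abbreviation patterns :: "'g set \<Rightarrow> ('g \<Rightarrow> 'a) set" where
  "patterns K \<equiv> PiE K (\<lambda>_. UNIV)"

lemma depends_onD: "depends_on K h \<Longrightarrow> (\<And>g. g \<in> K \<Longrightarrow> a g = a' g) \<Longrightarrow> h a = h a'"
  by (auto simp: depends_on_def)

lemma depends_on_mono: "depends_on K h \<Longrightarrow> K \<subseteq> K' \<Longrightarrow> depends_on K' h"
  unfolding depends_on_def by blast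

lemma depends_on_compose: "depends_on K h \<Longrightarrow> depends_on K (\<lambda>a. f (h a))"
  unfolding depends_on_def by metis

lemma depends_on_compose2:
  "depends_on K h \<Longrightarrow> depends_on K h' \<Longrightarrow> depends_on K (\<lambda>a. f (h a) (h' a))"
  unfolding depends_on_def by metis

lemma finite_patterns: "finite K \<Longrightarrow> finite (patterns K :: ('g \<Rightarrow> 'a::finite) set)"
  by (intro finite_PiE) auto

lemma patterns_nonempty [simp]: "(patterns K :: ('g \<Rightarrow> 'a) set) \<noteq> {}"
  by (simp add: PiE_eq_empty_iff)

lemma restrict_in_patterns [simp]: "restrict a K \<in> patterns K"
  by simp

lemma in_cylinder_iff: "z \<in> patterns K \<Longrightarrow> a \<in> cylinder K z \<longleftrightarrow> restrict a K = z"
  by (auto simp: cylinder_def restrict_def fun_eq_iff PiE_def extensional_def)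

lemma cylinder_clopen:
  fixes z :: "'g \<Rightarrow> 'a::discrete_topology"
  assumes "finite K"
  shows "open (cylinder K z)" "closed (cylinder K z)"
proof -
  have 1: "open {a::'g \<Rightarrow> 'a. a g \<in> A}" for g A
    using open_vimage[OF discrete_topology_class.open_discrete[of A] continuous_on_product_coordinates[of g]]
    by (simp add: vimage_def)
  have "cylinder K z = (\<Inter>g\<in>K. {a. a g \<in> {z g}})" by (auto simp: cylinder_def)
  then show "open (cylinder K z)" by (simp only:) (intro open_INT ballI assms 1)
  have "- cylinder K z = (\<Union>g\<in>K. {a. a g \<in> - {z g}})" by (auto simp: cylinder_def)
  then show "closed (cylinder K z)" unfolding closed_def by (simp only:) (intro open_UN ballI 1)
qed

lemma cylinder_borel [measurable]:
  "finite K \<Longrightarrow> cylinder K (z :: 'g \<Rightarrow> 'a::discrete_topology) \<in> sets borel"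
  by (intro borel_open cylinder_clopen)

text \<open>Makes cylinder probabilities integrals of continuous functions, hence admissible tests
  for the weak-star topology.\<close>

lemma continuous_on_indicator_clopen:
  assumes "open C" "closed C"
  shows "continuous_on UNIV (indicat_real C)"
proof -
  have "open (indicat_real C -` B)" for B
  proof -
    have "indicat_real C -` B = (if 1 \<in> B then C else {}) \<union> (if 0 \<in> B then - C else {})"
    proof (rule set_eqI)
      fix x
      show "x \<in> indicat_real C -` B \<longleftrightarrow> x \<in> (if 1 \<in> B then C else {}) \<union> (if 0 \<in> B then - C else {})"
        by (cases "x \<in> C") auto
    qed
    then show ?thesis using assms by (auto simp: closed_def)
  qed
  then show ?thesis by (simp add: continuous_on_open_vimage)
qed

lemma depends_on_vimage:
  assumes "depends_on K h"
  shows "h -` B = (\<Union>z\<in>{z\<in>patterns K. h z \<in> B}. cylinder K z)"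
proof (intro equalityI subsetI)
  fix a assume "a \<in> h -` B"
  moreover have "h a = h (restrict a K)" by (rule depends_onD[OF assms]) auto
  ultimately show "a \<in> (\<Union>z\<in>{z\<in>patterns K. h z \<in> B}. cylinder K z)"
    by (auto intro!: exI[of _ "restrict a K"] simp: cylinder_def)
next
  fix a assume "a \<in> (\<Union>z\<in>{z\<in>patterns K. h z \<in> B}. cylinder K z)"
  then obtain z where "z \<in> patterns K" "h z \<in> B" "a \<in> cylinder K z" by blast
  moreover have "h a = h z" by (rule depends_onD[OF assms]) (use calculation in \<open>auto simp: cylinder_def\<close>)
  ultimately show "a \<in> h -` B" by auto
qed

lemma measurable_depends_on:
  fixes h :: "('g \<Rightarrow> 'a::{finite,discrete_topology}) \<Rightarrow> 'b"
  assumes "finite K" "depends_on K h"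
  shows "h \<in> borel \<rightarrow>\<^sub>M count_space UNIV"
proof (rule measurableI)
  fix B
  have "finite {z\<in>patterns K. h z \<in> B}" by (intro finite_Collect_conjI disjI1) (simp add: finite_patterns assms)
  then show "h -` B \<inter> space borel \<in> sets borel"
    unfolding depends_on_vimage[OF assms(2)] by (auto intro!: sets.finite_UN cylinder_borel assms)
qed simp

lemma borel_measurable_depends_on:
  fixes h :: "('g \<Rightarrow> 'a::{finite,discrete_topology}) \<Rightarrow> 'b::topological_space"
  assumes "finite K" "depends_on K h"
  shows "h \<in> borel \<rightarrow>\<^sub>M borel"
  by (rule measurable_compose[OF measurable_depends_on[OF assms]]) simp

lemma sets_depends_on:
  fixes P :: "('g \<Rightarrow> 'a::{finite,discrete_topology}) \<Rightarrow> bool"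
  assumes "finite K" "depends_on K P"
  shows "{a. P a} \<in> sets borel"
  using measurable_sets[OF measurable_depends_on[OF assms], of "{True}"] by (simp add: vimage_def)

lemma depends_on_eq_sum:
  fixes h :: "('g \<Rightarrow> 'a::{finite,discrete_topology}) \<Rightarrow> real"
  assumes "finite K" "depends_on K h"
  shows "h a = (\<Sum>z\<in>patterns K. h z * indicator (cylinder K z) a)"
proof -
  have "(\<Sum>z\<in>patterns K. h z * indicator (cylinder K z) a)
      = (\<Sum>z\<in>patterns K. if restrict a K = z then h z else 0)"
    by (intro sum.cong refl) (simp add: indicator_def in_cylinder_iff)
  also have "\<dots> = h (restrict a K)"
    using finite_patterns[OF assms(1)] by (subst sum.delta') auto
  also have "\<dots> = h a" by (rule depends_onD[OF assms(2)]) auto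
  finally show ?thesis ..
qed

lemma borel_probD: "\<nu> \<in> borel_prob \<Longrightarrow> prob_space \<nu>" "\<nu> \<in> borel_prob \<Longrightarrow> sets \<nu> = sets borel"
  "\<nu> \<in> borel_prob \<Longrightarrow> space \<nu> = UNIV"
  using sets_eq_imp_space_eq[of \<nu> borel] by (auto simp: borel_prob_def)

lemma integral_depends_on:
  fixes h :: "('g \<Rightarrow> 'a::{finite,discrete_topology}) \<Rightarrow> real"
  assumes "finite K" "depends_on K h" "\<nu> \<in> borel_prob"
  shows "(\<integral>a. h a \<partial>\<nu>) = (\<Sum>z\<in>patterns K. h z * measure \<nu> (cylinder K z))"
proof -
  interpret prob_space \<nu> using assms(3) by (rule borel_probD)
  note [measurable_cong] = borel_probD(2)[OF assms(3)]
  have m[measurable]: "cylinder K z \<in> sets \<nu>" for z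
    using cylinder_borel[OF assms(1)] borel_probD(2)[OF assms(3)] by metis
  have "(\<integral>a. h a \<partial>\<nu>) = (\<integral>a. (\<Sum>z\<in>patterns K. h z * indicator (cylinder K z) a) \<partial>\<nu>)"
    by (intro Bochner_Integration.integral_cong refl depends_on_eq_sum assms)
  also have "\<dots> = (\<Sum>z\<in>patterns K. \<integral>a. h z * indicator (cylinder K z) a \<partial>\<nu>)"
    by (intro Bochner_Integration.integral_sum integrable_mult_right integrable_real_indicator m)
      (simp add: emeasure_eq_measure)
  also have "\<dots> = (\<Sum>z\<in>patterns K. h z * measure \<nu> (cylinder K z))"
    by (simp add: borel_probD(3)[OF assms(3)])
  finally show ?thesis .
qed

text \<open>The tolerance is divided by the number of patterns so that the errors of all cylinders
  add up to at most \<open>e\<close>. A local function bounded by \<open>B\<close> then changes its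
  integral by at most \<open>e * B\<close>.\<close>

definition cylinder_nbhd :: "'g set \<Rightarrow> real \<Rightarrow> ('g \<Rightarrow> 'a::topological_space) measure \<Rightarrow> ('g \<Rightarrow> 'a) measure set" where
  "cylinder_nbhd K e \<mu> = {\<nu> \<in> borel_prob. \<forall>z\<in>patterns K. \<bar>measure \<nu> (cylinder K z) - measure \<mu> (cylinder K z)\<bar>
    < e / card (patterns K :: ('g \<Rightarrow> 'a) set)}"

lemma cylinder_nbhd_integral:
  fixes h :: "('g \<Rightarrow> 'a::{finite,discrete_topology}) \<Rightarrow> real"
  assumes "finite K" "depends_on K h" "\<mu> \<in> borel_prob" "\<nu> \<in> cylinder_nbhd K e \<mu>" "\<And>a. \<bar>h a\<bar> \<le> B"
  shows "\<bar>(\<integral>a. h a \<partial>\<nu>) - (\<integral>a. h a \<partial>\<mu>)\<bar> \<le> e * B"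
proof -
  define N where "N = real (card (patterns K :: ('g \<Rightarrow> 'a) set))"
  have N: "N > 0" using finite_patterns[OF assms(1)] patterns_nonempty by (simp add: N_def card_gt_0_iff)
  have \<nu>: "\<nu> \<in> borel_prob" and c: "\<And>z. z \<in> patterns K \<Longrightarrow> \<bar>measure \<nu> (cylinder K z) - measure \<mu> (cylinder K z)\<bar> < e / N"
    using assms(4) by (auto simp: cylinder_nbhd_def N_def)
  have B: "0 \<le> B" using assms(5)[of undefined] by linarith
  have "(\<integral>a. h a \<partial>\<nu>) - (\<integral>a. h a \<partial>\<mu>) = (\<Sum>z\<in>patterns K. h z * (measure \<nu> (cylinder K z) - measure \<mu> (cylinder K z)))"
    by (simp add: integral_depends_on[OF assms(1,2)] assms(3) \<nu> sum_subtractf right_diff_distrib)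
  also have "\<bar>\<dots>\<bar> \<le> (\<Sum>z\<in>patterns K. \<bar>h z * (measure \<nu> (cylinder K z) - measure \<mu> (cylinder K z))\<bar>)"
    by (rule sum_abs)
  also have "\<dots> \<le> (\<Sum>z\<in>(patterns K :: ('g \<Rightarrow> 'a) set). B * (e / N))"
  proof (rule sum_mono)
    fix z :: "'g \<Rightarrow> 'a" assume "z \<in> patterns K"
    then show "\<bar>h z * (measure \<nu> (cylinder K z) - measure \<mu> (cylinder K z))\<bar> \<le> B * (e / N)"
      unfolding abs_mult by (intro mult_mono assms(5) B less_imp_le[OF c]) auto
  qed
  finally show ?thesis using N by (simp add: N_def[symmetric] mult_ac)
qed

lemma cylinder_nbhd_measure:
  fixes P :: "('g \<Rightarrow> 'a::{finite,discrete_topology}) \<Rightarrow> bool"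
  assumes "finite K" "depends_on K P" "\<mu> \<in> borel_prob" "\<nu> \<in> cylinder_nbhd K e \<mu>"
  shows "\<bar>measure \<nu> {a. P a} - measure \<mu> {a. P a}\<bar> \<le> e"
proof -
  have d: "depends_on K (indicat_real {a. P a})"
    using depends_on_compose[OF assms(2), of "of_bool :: bool \<Rightarrow> real"]
    by (simp add: indicator_def[abs_def])
  have \<nu>: "\<nu> \<in> borel_prob" using assms(4) by (auto simp: cylinder_nbhd_def)
  have "(\<integral>a. indicat_real {a. P a} a \<partial>\<nu>') = measure \<nu>' {a. P a}" if "\<nu>' \<in> borel_prob" for \<nu>' :: "('g \<Rightarrow> 'a) measure"
    using borel_probD(3)[OF that] by simp
  then show ?thesis using cylinder_nbhd_integral[OF assms(1) d assms(3,4), of 1] \<nu> assms(3)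
    by (simp add: indicator_def)
qed

lemma openin_weak_star_basis:
  fixes f :: "'x::topological_space \<Rightarrow> real"
  assumes "continuous_on UNIV f" "bounded (range f)" "open U"
  shows "openin weak_star_topology {\<nu> \<in> borel_prob. (\<integral>x. f x \<partial>\<nu>) \<in> U}"
  unfolding weak_star_topology_def
  by (rule topology_generated_by_Basis, rule CollectI, rule exI[of _ f], rule exI[of _ U])
    (simp add: assms)

lemma openin_cylinder_nbhd:
  fixes \<mu> :: "('g \<Rightarrow> 'a::{finite,discrete_topology}) measure"
  assumes "finite K"
  shows "openin weak_star_topology (cylinder_nbhd K e \<mu>)"
proof -
  let ?e = "e / card (patterns K :: ('g \<Rightarrow> 'a) set)"
  define U where "U z = {\<nu> :: ('g \<Rightarrow> 'a) measure. \<nu> \<in> borel_prob \<and>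
     (\<integral>x. indicator (cylinder K z) x \<partial>\<nu>) \<in> ball (measure \<mu> (cylinder K z)) ?e}" for z
  have U: "openin weak_star_topology (U z)" for z
    unfolding U_def
  proof (rule openin_weak_star_basis)
    show "continuous_on UNIV (indicat_real (cylinder K z))"
      by (intro continuous_on_indicator_clopen cylinder_clopen assms)
    show "bounded (range (indicat_real (cylinder K z)))"
      by (rule boundedI[of _ 1]) (auto simp: indicator_def)
  qed simp
  have "cylinder_nbhd K e \<mu> = (\<Inter>z\<in>patterns K. U z)"
  proof (rule set_eqI)
    fix \<nu> :: "('g \<Rightarrow> 'a) measure"
    \<comment> \<open>The intersection yields membership in \<open>borel_prob\<close> only because
      it runs over at least one pattern.\<close>
    have z0: "restrict (undefined :: 'g \<Rightarrow> 'a) K \<in> patterns K" by (rule restrict_in_patterns)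
    have "(\<integral>x. indicat_real (cylinder K z) x \<partial>\<nu>) = measure \<nu> (cylinder K z)" if "\<nu> \<in> borel_prob" for z
      using borel_probD(3)[OF that] by simp
    then have "\<nu> \<in> U z \<longleftrightarrow> \<nu> \<in> borel_prob \<and> \<bar>measure \<nu> (cylinder K z) - measure \<mu> (cylinder K z)\<bar> < ?e" for z
      unfolding U_def mem_Collect_eq mem_ball dist_real_def abs_minus_commute[of "measure \<mu> _"]
      by (intro conj_cong) auto
    then show "\<nu> \<in> cylinder_nbhd K e \<mu> \<longleftrightarrow> \<nu> \<in> (\<Inter>z\<in>patterns K. U z)"
      unfolding cylinder_nbhd_def mem_Collect_eq INT_iff using z0 by blast
  qed
  also have "openin weak_star_topology \<dots>"
    using U by (intro openin_Inter) (auto simp: finite_patterns assms)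
  finally show ?thesis .
qed

section \<open>Approximation of factor maps by local maps\<close>

text \<open>The sets that can be approximated with every error form a \<sigma>-algebra containing
  the events on a single coordinate. These generate the Borel sets, as the group is countable and
  the alphabet second countable.\<close>

lemma approximate_by_local_set:
  fixes \<mu> :: "('g::countable \<Rightarrow> 'a::{finite,discrete_topology,second_countable_topology}) measure"
  assumes \<mu>: "\<mu> \<in> borel_prob" and B: "B \<in> sets borel" and "e > 0"
  shows "\<exists>K P. finite K \<and> depends_on K P \<and> measure \<mu> {a. (a \<in> B) \<noteq> P a} < e"
proof -
  interpret prob_space \<mu> using \<mu> by (rule borel_probD)
  note sets\<mu> = borel_probD(2)[OF \<mu>]
  have meas: "{a. (a \<in> A) \<noteq> P a} \<in> sets \<mu>"
    if "A \<in> sets borel" "finite K" "depends_on K P" for A K and P :: "('g \<Rightarrow> 'a) \<Rightarrow> bool"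
  proof -
    have "{a. (a \<in> A) \<noteq> P a} = (A - {a. P a}) \<union> ({a. P a} - A)" by auto
    then show ?thesis using that(1) sets_depends_on[OF that(2,3)] sets\<mu> by auto
  qed
  let ?G = "{{f \<in> (\<Pi>\<^sub>E i\<in>(UNIV::'g set). space (borel::'a measure)). f i \<in> A} | i A. i \<in> UNIV \<and> A \<in> sets (borel::'a measure)}"
  have borel_eq: "sets (borel :: ('g \<Rightarrow> 'a) measure) = sigma_sets UNIV ?G"
    using sets_PiM_equal_borel[where ?'a='g and ?'b='a] sets_PiM_single[of UNIV "\<lambda>_::'g. borel :: 'a measure"]
    by (simp add: PiE_UNIV_domain)
  have "B \<in> sigma_sets UNIV ?G" using B borel_eq by simp
  \<comment> \<open>The error is quantified inside the induction, because the union case calls the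
    hypothesis with a smaller one.\<close>
  then have "\<forall>e>0. \<exists>K P. finite K \<and> depends_on K P \<and> measure \<mu> {a. (a \<in> B) \<noteq> P a} < e"
  proof induction
    case (Basic B)
    then obtain i A where "B = {f. f i \<in> A}" by (auto simp: PiE_UNIV_domain)
    then have "depends_on {i} (\<lambda>a. a \<in> B)" by (auto simp: depends_on_def)
    then show ?case by (intro allI impI exI[of _ "{i}"] exI[of _ "\<lambda>a. a \<in> B"]) auto
  next
    case Empty
    have "depends_on {} (\<lambda>a::'g \<Rightarrow> 'a. False)" by (auto simp: depends_on_def)
    then show ?case by (intro allI impI exI[of _ "{}"] exI[of _ "\<lambda>a. False"]) auto
  next
    case (Compl B)
    show ?case
    proof (intro allI impI)
      fix e :: real assume "e > 0"
      then obtain K P where *: "finite K" "depends_on K P" "measure \<mu> {a. (a \<in> B) \<noteq> P a} < e"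
        using Compl by blast
      have "{a. (a \<in> UNIV - B) \<noteq> (\<not> P a)} = {a. (a \<in> B) \<noteq> P a}" by auto
      then show "\<exists>K P. finite K \<and> depends_on K P \<and> measure \<mu> {a. (a \<in> UNIV - B) \<noteq> P a} < e"
        using * depends_on_compose[OF *(2), of Not] by (intro exI[of _ K] exI[of _ "\<lambda>a. \<not> P a"]) simp
    qed
  next
    case (Union A)
    have A[measurable]: "A i \<in> sets \<mu>" for i using Union.hyps borel_eq sets\<mu> by simp
    show ?case
    proof (intro allI impI)
      fix e :: real assume e: "e > 0"
      have "(\<lambda>n. measure \<mu> (\<Union>i<n. A i)) \<longlonglongrightarrow> measure \<mu> (\<Union>n. \<Union>i<n. A i)"
        by (intro finite_Lim_measure_incseq) (auto simp: incseq_def intro: less_le_trans)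
      also have "(\<Union>n. \<Union>i<n. A i) = (\<Union>i. A i)" by auto
      finally have "eventually (\<lambda>n. dist (measure \<mu> (\<Union>i<n. A i)) (measure \<mu> (\<Union>i. A i)) < e/2) sequentially"
        using e by (intro tendstoD) auto
      then obtain N where "dist (measure \<mu> (\<Union>i<N. A i)) (measure \<mu> (\<Union>i. A i)) < e/2"
        by (auto simp: eventually_sequentially)
      then have N: "measure \<mu> ((\<Union>i. A i) - (\<Union>i<N. A i)) < e/2"
        by (subst finite_measure_Diff) (auto simp: dist_real_def abs_if split: if_splits)
      \<comment> \<open>The first \<open>N\<close> sets contribute at most \<open>e / 2\<close> in
        total, also for \<open>N = 0\<close>; the truncated tail takes the other half.\<close>
      define e' where "e' = e / (2 * (real N + 1))"
      have "e' > 0" using e by (simp add: e'_def)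
      then have "\<forall>i. \<exists>K P. finite K \<and> depends_on K P \<and> measure \<mu> {a. (a \<in> A i) \<noteq> P a} < e'"
        using Union.IH by blast
      then obtain K P where KP: "\<And>i. finite (K i)" "\<And>i. depends_on (K i) (P i)"
          "\<And>i. measure \<mu> {a. (a \<in> A i) \<noteq> P i a} < e'"
        by metis
      define Q where "Q a \<longleftrightarrow> (\<exists>i<N. P i a)" for a
      have m[measurable]: "{a. (a \<in> A i) \<noteq> P i a} \<in> sets \<mu>" for i
        using meas[OF _ KP(1,2)] A sets\<mu> by simp
      have "{a. (a \<in> (\<Union>i. A i)) \<noteq> Q a} \<subseteq> ((\<Union>i. A i) - (\<Union>i<N. A i)) \<union> (\<Union>i<N. {a. (a \<in> A i) \<noteq> P i a})"
        by (auto simp: Q_def)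
      then have "measure \<mu> {a. (a \<in> (\<Union>i. A i)) \<noteq> Q a}
          \<le> measure \<mu> (((\<Union>i. A i) - (\<Union>i<N. A i)) \<union> (\<Union>i<N. {a. (a \<in> A i) \<noteq> P i a}))"
        by (intro finite_measure_mono sets.Un sets.Diff sets.finite_UN sets.countable_UN) (use m A in auto)
      also have "\<dots> \<le> measure \<mu> ((\<Union>i. A i) - (\<Union>i<N. A i)) + measure \<mu> (\<Union>i<N. {a. (a \<in> A i) \<noteq> P i a})"
        by (intro measure_Un_le sets.Diff sets.finite_UN sets.countable_UN) (use m A in auto)
      also have "measure \<mu> (\<Union>i<N. {a. (a \<in> A i) \<noteq> P i a}) \<le> (\<Sum>i<N. measure \<mu> {a. (a \<in> A i) \<noteq> P i a})"
        by (intro finite_measure_subadditive_finite) (use m in blast)+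
      also have "\<dots> \<le> (\<Sum>i<N. e')" by (intro sum_mono less_imp_le KP)
      also have "\<dots> \<le> e/2" using e by (simp add: e'_def field_simps)
      finally have "measure \<mu> {a. (a \<in> (\<Union>i. A i)) \<noteq> Q a} < e" using N by simp
      moreover have "depends_on (\<Union>i<N. K i) Q"
        unfolding depends_on_def Q_def using KP(2) unfolding depends_on_def
        by (meson UN_I lessThan_iff)
      ultimately show "\<exists>K P. finite K \<and> depends_on K P \<and> measure \<mu> {a. (a \<in> (\<Union>i. A i)) \<noteq> P a} < e"
        by (intro exI[of _ "\<Union>i<N. K i"] exI[of _ Q]) (simp add: KP(1))
    qed
  qed
  then show ?thesis using \<open>e > 0\<close> by blast
qed

text \<open>Compactness reduces \<psi> to finitely many events
  \<open>\<psi> a \<in> ball y e\<close>. Each is approximated by a local event, and \<phi> names a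
  centre whose local event holds.\<close>

lemma approximate_by_local_function:
  fixes \<mu> :: "('g::countable \<Rightarrow> 'a::{finite,discrete_topology,second_countable_topology}) measure"
    and \<psi> :: "('g \<Rightarrow> 'a) \<Rightarrow> 'y::{metric_space, second_countable_topology}"
  assumes \<mu>: "\<mu> \<in> borel_prob" and \<psi>[measurable]: "\<psi> \<in> borel \<rightarrow>\<^sub>M borel" and "e > 0"
    and "compact (UNIV :: 'y set)"
  shows "\<exists>K \<phi>. finite K \<and> depends_on K \<phi> \<and> measure \<mu> {a. e \<le> dist (\<phi> a) (\<psi> a)} < e"
proof -
  interpret prob_space \<mu> using \<mu> by (rule borel_probD)
  note sets\<mu> = borel_probD(2)[OF \<mu>]
  obtain D :: "'y set" where D: "finite D" "(UNIV :: 'y set) \<subseteq> (\<Union>y\<in>D. ball y e)"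
    by (rule compactE_image[OF assms(4), of UNIV "\<lambda>y. ball y e"]) (use \<open>e > 0\<close> in auto)
  then have D0: "D \<noteq> {}" by auto
  define B where "B y = \<psi> -` ball y e" for y
  have B: "B y \<in> sets borel" for y
    using measurable_sets[OF \<psi>, of "ball y e"] by (simp add: B_def)
  have c: "e / card D > 0" using \<open>e > 0\<close> D D0 by (simp add: card_gt_0_iff)
  have "\<forall>y. \<exists>K P. finite K \<and> depends_on K P \<and> measure \<mu> {a. (a \<in> B y) \<noteq> P a} < e / card D"
    using approximate_by_local_set[OF \<mu> B c] by blast
  then obtain K P where KP: "\<And>y. finite (K y)" "\<And>y. depends_on (K y) (P y)"
      "\<And>y. measure \<mu> {a. (a \<in> B y) \<noteq> P y a} < e / card D"
    by metis
  have m: "{a. (a \<in> B y) \<noteq> P y a} \<in> sets \<mu>" for y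
  proof -
    have "{a. (a \<in> B y) \<noteq> P y a} = (B y - {a. P y a}) \<union> ({a. P y a} - B y)" by auto
    then show ?thesis using B sets_depends_on[OF KP(1,2)] sets\<mu> by auto
  qed
  define \<phi> where "\<phi> a = (SOME y. y \<in> D \<and> P y a)" for a
  have dep: "depends_on (\<Union>y\<in>D. K y) \<phi>"
    unfolding depends_on_def
  proof (intro allI impI)
    fix a a' :: "'g \<Rightarrow> 'a" assume "\<forall>g\<in>\<Union>y\<in>D. K y. a g = a' g"
    then have "y \<in> D \<and> P y a \<longleftrightarrow> y \<in> D \<and> P y a'" for y
      using depends_onD[OF KP(2), of y a a'] by auto
    then show "\<phi> a = \<phi> a'" by (simp add: \<phi>_def)
  qed
  \<comment> \<open>If every local event agrees with its ball at \<open>a\<close>, then some centre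
    qualifies, and any centre that qualifies is within \<open>e\<close> of \<open>\<psi> a\<close>.
    The arbitrary value of \<open>SOME\<close> is thus confined to the exceptional set.\<close>
  have sub: "{a. e \<le> dist (\<phi> a) (\<psi> a)} \<subseteq> (\<Union>y\<in>D. {a. (a \<in> B y) \<noteq> P y a})"
  proof (rule ccontr)
    assume "\<not> ?thesis"
    then obtain a where a: "e \<le> dist (\<phi> a) (\<psi> a)" "\<And>y. y \<in> D \<Longrightarrow> a \<in> B y \<longleftrightarrow> P y a" by auto
    obtain y where "y \<in> D" "\<psi> a \<in> ball y e" using D(2) by blast
    then have "y \<in> D \<and> P y a" using a(2) by (auto simp: B_def)
    then have "\<phi> a \<in> D \<and> P (\<phi> a) a" unfolding \<phi>_def by (rule someI)
    then have "a \<in> B (\<phi> a)" using a(2) by blast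
    then show False using a(1) by (simp add: B_def)
  qed
  have "measure \<mu> {a. e \<le> dist (\<phi> a) (\<psi> a)} \<le> measure \<mu> (\<Union>y\<in>D. {a. (a \<in> B y) \<noteq> P y a})"
    by (intro finite_measure_mono sub sets.finite_UN D m)
  also have "\<dots> \<le> (\<Sum>y\<in>D. measure \<mu> {a. (a \<in> B y) \<noteq> P y a})"
    by (intro finite_measure_subadditive_finite D) (use m in blast)
  also have "\<dots> < (\<Sum>y\<in>D. e / card D)"
    by (intro sum_strict_mono D D0 KP)
  also have "\<dots> = e" using D D0 by simp
  finally show ?thesis using dep KP(1) D(1) by (intro exI[of _ "\<Union>y\<in>D. K y"] exI[of _ \<phi>]) simp
qed

text \<open>Borel-Cantelli: the exceptional sets have summable measures, so almost every point lies
  in only finitely many of them.\<close>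

lemma approximating_sequence_AE:
  fixes \<mu> :: "('g::countable \<Rightarrow> 'a::{finite,discrete_topology,second_countable_topology}) measure"
    and \<psi> :: "('g \<Rightarrow> 'a) \<Rightarrow> 'y::{metric_space, second_countable_topology}"
  assumes \<mu>: "\<mu> \<in> borel_prob" and \<psi>: "\<psi> \<in> borel \<rightarrow>\<^sub>M borel"
    and \<phi>: "\<And>m. \<phi> m \<in> borel \<rightarrow>\<^sub>M borel"
      "\<And>m. measure \<mu> {a. (1/2)^m \<le> dist (\<phi> m a) (\<psi> a)} < (1/2)^m"
  shows "AE a in \<mu>. (\<lambda>m. \<phi> m a) \<longlonglongrightarrow> \<psi> a"
proof -
  interpret prob_space \<mu> using \<mu> by (rule borel_probD)
  note [measurable_cong] = borel_probD(2)[OF \<mu>]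
  note [measurable] = \<phi>(1) \<psi>
  have sp: "space \<mu> = UNIV" by (rule borel_probD(3)[OF \<mu>])
  have "{a \<in> space \<mu>. (1/2)^m \<le> dist (\<phi> m a) (\<psi> a)} \<in> sets \<mu>" for m by measurable
  then have m: "{a. (1/2)^m \<le> dist (\<phi> m a) (\<psi> a)} \<in> sets \<mu>" for m by (simp add: sp)
  have "summable (\<lambda>m. measure \<mu> {a. (1/2)^m \<le> dist (\<phi> m a) (\<psi> a)})"
    by (rule summable_comparison_test'[OF summable_geometric[of "1/2::real"], of 0])
      (use \<phi>(2) in \<open>auto intro: less_imp_le\<close>)
  then have "AE a in \<mu>. eventually (\<lambda>m. a \<in> space \<mu> - {a. (1/2)^m \<le> dist (\<phi> m a) (\<psi> a)}) sequentially"
    by (intro borel_cantelli_AE1) (auto simp: m emeasure_eq_measure)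
  then show ?thesis
  proof eventually_elim
    case (elim a)
    have "(\<lambda>m. dist (\<phi> m a) (\<psi> a)) \<longlonglongrightarrow> 0"
    proof (rule tendsto_sandwich[OF _ _ tendsto_const])
      show "\<forall>\<^sub>F m in sequentially. dist (\<phi> m a) (\<psi> a) \<le> (1/2)^m"
        using elim by eventually_elim auto
      show "(\<lambda>m. (1/2)^m :: real) \<longlonglongrightarrow> 0" by (rule LIMSEQ_realpow_zero) auto
    qed simp
    then show ?case by (rule tendsto_dist_iff[THEN iffD2])
  qed
qed

section \<open>Shift invariance and nontriviality of the factor\<close>

lemma measurable_gshift [measurable]:
  "gshift g \<in> borel \<rightarrow>\<^sub>M (borel :: ('g::{group_add,countable} \<Rightarrow> 'y::second_countable_topology) measure)"
proof (rule measurable_coordinatewise_then_product)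
  fix h
  have "(\<lambda>a::'g \<Rightarrow> 'y. a (h + g)) \<in> borel \<rightarrow>\<^sub>M borel"
    by (rule borel_measurable_continuous_onI) (rule continuous_on_product_coordinates)
  then show "(\<lambda>a. gshift g a h) \<in> borel \<rightarrow>\<^sub>M (borel :: 'y measure)" by (simp add: gshift_def)
qed

lemma measurable_equivariant_map [measurable]:
  fixes \<psi> :: "('g::{group_add,countable} \<Rightarrow> 'a::second_countable_topology) \<Rightarrow> 'y::second_countable_topology"
  assumes [measurable]: "\<psi> \<in> borel \<rightarrow>\<^sub>M borel"
  shows "equivariant_map \<psi> \<in> borel \<rightarrow>\<^sub>M borel"
proof (rule measurable_coordinatewise_then_product)
  fix g
  show "(\<lambda>a. equivariant_map \<psi> a g) \<in> borel \<rightarrow>\<^sub>M borel"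
    unfolding equivariant_map_def by measurable
qed

text \<open>Invariance moves the null set by each \<open>g\<close>, and countably many null sets
  have a null union.\<close>

lemma process_AE_gshift:
  fixes \<mu> :: "('g::{group_add,countable} \<Rightarrow> 'a::second_countable_topology) measure"
  assumes "process \<mu>" "AE a in \<mu>. P a"
  shows "AE a in \<mu>. \<forall>g. P (gshift g a)"
proof -
  have \<mu>: "\<mu> \<in> borel_prob" using assms(1) by (simp add: process_def)
  have "AE a in \<mu>. P (gshift g a)" for g
  proof (rule AE_distrD[where f="gshift g" and M=\<mu> and M'=borel])
    show "gshift g \<in> measurable \<mu> borel"
      using measurable_gshift measurable_cong_sets[OF borel_probD(2)[OF \<mu>] refl] by blast
    have "distr \<mu> borel (gshift g) = \<mu>" using assms(1) unfolding process_def by blast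
    then show "AE a in distr \<mu> borel (gshift g). P a" using assms(2) by (simp only:)
  qed
  then show ?thesis by (simp add: AE_all_countable)
qed

text \<open>If \<psi> were almost surely constant, invariance would make every coordinate of the
  factor map equal to that constant, and the factor would be a point mass. So the law of \<psi> has
  two support points. They have disjoint open neighbourhoods, and the complement of one of these is
  the required set. Closedness later allows the distance from the set to detect membership.\<close>

lemma factor_nontrivial_closed_set:
  fixes \<mu> :: "('g::{group_add,countable} \<Rightarrow> 'a::second_countable_topology) measure"
    and \<psi> :: "('g \<Rightarrow> 'a) \<Rightarrow> 'y::{metric_space, second_countable_topology}"
  assumes proc: "process \<mu>" and \<psi>[measurable]: "\<psi> \<in> borel \<rightarrow>\<^sub>M borel"
    and nontriv: "\<nexists>y. distr \<mu> borel (equivariant_map \<psi>) = return borel y"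
  obtains B where "closed B" "0 < measure \<mu> {a. \<psi> a \<in> B}" "measure \<mu> {a. \<psi> a \<in> B} < 1"
proof -
  have \<mu>: "\<mu> \<in> borel_prob" using proc by (simp add: process_def)
  interpret prob_space \<mu> using \<mu> by (rule borel_probD)
  note sets\<mu>[measurable_cong] = borel_probD(2)[OF \<mu>]
  have sp: "space \<mu> = UNIV" by (rule borel_probD(3)[OF \<mu>])
  have m: "{a. \<psi> a \<in> B} \<in> sets \<mu>" if "B \<in> sets borel" for B
    using measurable_sets[OF \<psi> that] sets\<mu> by (simp add: vimage_def)
  obtain \<B> :: "'y set set" where \<B>: "countable \<B>" "topological_basis \<B>"
    using ex_countable_basis by blast
  \<comment> \<open>The null members of a countable basis: the points outside all of them form the
    support of the law of \<psi>.\<close>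
  define \<N> where "\<N> = {b\<in>\<B>. measure \<mu> {a. \<psi> a \<in> b} = 0}"
  have "AE a in \<mu>. \<forall>b\<in>\<N>. \<psi> a \<notin> b"
  proof (subst AE_ball_countable)
    show "countable \<N>" using \<B>(1) by (simp add: \<N>_def)
    show "\<forall>b\<in>\<N>. AE a in \<mu>. \<psi> a \<notin> b"
    proof
      fix b assume b: "b \<in> \<N>"
      then have "{a. \<psi> a \<in> b} \<in> sets \<mu>" using \<B>(2) by (intro m) (auto simp: \<N>_def topological_basis_open)
      moreover have "emeasure \<mu> {a. \<psi> a \<in> b} = 0" using b by (simp add: \<N>_def emeasure_eq_measure)
      ultimately show "AE a in \<mu>. \<psi> a \<notin> b" by (intro AE_I[of _ _ "{a. \<psi> a \<in> b}"]) auto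
    qed
  qed
  note AE_supp = this
  obtain a0 where a0: "\<forall>b\<in>\<N>. \<psi> a0 \<notin> b"
  proof (rule ccontr)
    assume "\<not> thesis"
    then have "\<not> (\<forall>b\<in>\<N>. \<psi> a \<notin> b)" for a using that by blast
    with AE_supp have "AE a in \<mu>. False" by (auto elim: eventually_mono)
    then show False by simp
  qed
  obtain a1 where a1: "\<forall>b\<in>\<N>. \<psi> a1 \<notin> b" "\<psi> a1 \<noteq> \<psi> a0"
  proof (rule ccontr)
    assume "\<not> thesis"
    then have "(\<forall>b\<in>\<N>. \<psi> a \<notin> b) \<longrightarrow> \<psi> a = \<psi> a0" for a using that by blast
    with AE_supp have "AE a in \<mu>. \<psi> a = \<psi> a0" by (auto elim: eventually_mono)
    then have "AE a in \<mu>. \<forall>g. \<psi> (gshift g a) = \<psi> a0" by (rule process_AE_gshift[OF proc])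
    then have "AE a in \<mu>. equivariant_map \<psi> a = (\<lambda>_. \<psi> a0)"
      by eventually_elim (auto simp: equivariant_map_def)
    then have "distr \<mu> borel (equivariant_map \<psi>) = distr \<mu> borel (\<lambda>_. (\<lambda>_. \<psi> a0))"
      by (intro distr_cong_AE) auto
    also have "\<dots> = return borel (\<lambda>_. \<psi> a0)" by simp
    finally show False using nontriv by blast
  qed
  obtain U U' where U: "open U" "open U'" "\<psi> a0 \<in> U" "\<psi> a1 \<in> U'" "U \<inter> U' = {}"
    using hausdorff[of "\<psi> a0" "\<psi> a1"] a1(2) by metis
  have pos: "measure \<mu> {a. \<psi> a \<in> W} > 0" if W: "open W" "\<psi> x \<in> W" "\<forall>b\<in>\<N>. \<psi> x \<notin> b" for W x
  proof -
    obtain b where b: "b \<in> \<B>" "\<psi> x \<in> b" "b \<subseteq> W" using topological_basisE[OF \<B>(2) W(1,2)] by blast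
    then have "measure \<mu> {a. \<psi> a \<in> b} \<noteq> 0" using W(3) by (auto simp: \<N>_def)
    moreover have "measure \<mu> {a. \<psi> a \<in> b} \<le> measure \<mu> {a. \<psi> a \<in> W}"
      using b W \<B>(2) by (intro finite_measure_mono m) (auto simp: topological_basis_open)
    ultimately show ?thesis by (smt (verit) measure_nonneg)
  qed
  show thesis
  proof (rule that[of "- U"])
    show "closed (- U)" using U by (simp add: closed_Compl)
    have "{a. \<psi> a \<in> - U} = space \<mu> - {a. \<psi> a \<in> U}" by (auto simp: sp)
    then show "measure \<mu> {a. \<psi> a \<in> - U} < 1"
      using pos[OF U(1,3) a0] prob_compl[OF m[of U]] U(1) by simp
    have "measure \<mu> {a. \<psi> a \<in> U'} \<le> measure \<mu> {a. \<psi> a \<in> - U}"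
      using U by (intro finite_measure_mono m) auto
    then show "0 < measure \<mu> {a. \<psi> a \<in> - U}" using pos[OF U(2,4) a1(1)] by simp
  qed
qed

section \<open>Convergence along sofic approximations\<close>

lemma diagonal_sequence:
  assumes "\<And>m. \<forall>\<^sub>F n in sequentially. P m n"
  obtains k :: "nat \<Rightarrow> nat" where "filterlim k at_top sequentially" "\<forall>\<^sub>F n in sequentially. P (k n) n"
proof -
  obtain N where N: "\<And>m n. N m \<le> n \<Longrightarrow> P m n"
    using assms unfolding eventually_sequentially by metis
  \<comment> \<open>The largest stage whose threshold has been passed. The bound
    \<open>m \<le> n\<close> keeps the set finite, and it is nonempty once
    \<open>N 0 \<le> n\<close>.\<close>
  define k where "k n = Max {m. m \<le> n \<and> N m \<le> n}" for n
  have fin: "finite {m. m \<le> n \<and> N m \<le> n}" for n by simp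
  have "P (k n) n" if "N 0 \<le> n" for n
  proof -
    have "k n \<in> {m. m \<le> n \<and> N m \<le> n}" unfolding k_def by (rule Max_in[OF fin]) (use that in auto)
    then show ?thesis using N by simp
  qed
  moreover have "filterlim k at_top sequentially"
    unfolding filterlim_at_top eventually_sequentially
  proof
    fix Z
    have "Z \<le> k n" if "max Z (N Z) \<le> n" for n
      unfolding k_def by (rule Max_ge[OF fin]) (use that in auto)
    then show "\<exists>M. \<forall>n\<ge>M. Z \<le> k n" by blast
  qed
  ultimately show thesis by (intro that) (auto simp: eventually_sequentially)
qed

text \<open>By Tychonoff, finitely many basic boxes cover the space; on each of them
  \<open>f\<close> varies by less than \<open>e\<close>, and each constrains only finitely many
  coordinates. Points that agree on all these coordinates lie in a common box.\<close>

lemma continuous_finite_dependence: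
  fixes f :: "('g \<Rightarrow> 'y::topological_space) \<Rightarrow> real"
  assumes "compact (UNIV :: 'y set)" "continuous_on UNIV f" "e > 0"
  obtains E where "finite E" "\<And>y y'. (\<And>g. g \<in> E \<Longrightarrow> y g = y' g) \<Longrightarrow> \<bar>f y - f y'\<bar> < e"
proof -
  have "compact_space (product_topology (\<lambda>_::'g. euclidean :: 'y topology) UNIV)"
    unfolding compact_space_product_topology by (simp add: compact_space_def assms(1))
  then have compact: "compact (UNIV :: ('g \<Rightarrow> 'y) set)"
    by (simp add: euclidean_product_topology compact_space_def)
  have "\<exists>X. (\<forall>i. y i \<in> X i) \<and> (\<forall>i. open (X i)) \<and> finite {i. X i \<noteq> UNIV} \<and>
      (\<forall>z. (\<forall>i. z i \<in> X i) \<longrightarrow> \<bar>f z - f y\<bar> < e/2)" for y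
  proof -
    have "open (f -` ball (f y) (e/2))" using assms(2) by (simp add: open_vimage)
    then have "openin (product_topology (\<lambda>_. euclidean) UNIV) (f -` ball (f y) (e/2))"
      by (simp add: euclidean_product_topology)
    from product_topology_open_contains_basis[OF this, of y] \<open>e > 0\<close>
    obtain X where X: "y \<in> PiE UNIV X" "\<And>i. open (X i)" "finite {i. X i \<noteq> UNIV}"
        "PiE UNIV X \<subseteq> f -` ball (f y) (e/2)"
      by auto
    show ?thesis
    proof (intro exI[of _ X] conjI allI impI)
      fix z assume "\<forall>i. z i \<in> X i"
      then have "z \<in> PiE UNIV X" by (auto simp: PiE_UNIV_domain)
      then have "f z \<in> ball (f y) (e/2)" using X(4) by blast
      then show "\<bar>f z - f y\<bar> < e/2" by (simp add: dist_real_def abs_minus_commute)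
    next
    qed (use X in \<open>auto simp: PiE_UNIV_domain\<close>)
  qed
  then obtain X where X: "\<And>y i. y i \<in> X y i" "\<And>y i. open (X y i)" "\<And>y. finite {i. X y i \<noteq> UNIV}"
      "\<And>y z. (\<And>i. z i \<in> X y i) \<Longrightarrow> \<bar>f z - f y\<bar> < e/2"
    by metis
  obtain D where D: "finite D" "UNIV \<subseteq> (\<Union>y\<in>D. PiE UNIV (X y))"
  proof (rule compactE_image[OF compact, of UNIV "\<lambda>y. PiE UNIV (X y)"])
    show "open (PiE UNIV (X y))" for y by (rule open_PiE[OF X(2,3)])
    show "UNIV \<subseteq> (\<Union>y. PiE UNIV (X y))" using X(1) by (auto simp: PiE_UNIV_domain)
  qed auto
  show thesis
  proof (rule that[of "\<Union>y\<in>D. {i. X y i \<noteq> UNIV}"])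
    show "finite (\<Union>y\<in>D. {i. X y i \<noteq> UNIV})" using D(1) X(3) by blast
    fix y y' :: "'g \<Rightarrow> 'y" assume *: "\<And>g. g \<in> (\<Union>y\<in>D. {i. X y i \<noteq> UNIV}) \<Longrightarrow> y g = y' g"
    obtain u where "u \<in> D" "y \<in> PiE UNIV (X u)" using D(2) by blast
    then have u: "u \<in> D" "\<And>i. y i \<in> X u i" by auto
    have "y' i \<in> X u i" for i
    proof (cases "X u i = UNIV")
      case False
      then have "y i = y' i" using u(1) by (intro *) blast
      then show ?thesis using u(2)[of i] by simp
    qed simp
    then have "\<bar>f y' - f u\<bar> < e/2" by (rule X(4))
    then show "\<bar>f y - f y'\<bar> < e" using X(4)[of y u, OF u(2)] by linarith
  qed
qed

section \<open>Vertex properties of density one\<close>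

definition density_one :: "(nat \<Rightarrow> 'v set) \<Rightarrow> (nat \<Rightarrow> 'v \<Rightarrow> bool) \<Rightarrow> bool" where
  "density_one V P \<longleftrightarrow> (\<lambda>n. real (card {v \<in> V n. P n v}) / real (card (V n))) \<longlonglongrightarrow> 1"

text \<open>Serves densities of vertex sets as well as probabilities of events; in both uses the
  lower bound is inclusion-exclusion.\<close>

lemma tendsto_1_conj:
  fixes a b c :: "nat \<Rightarrow> real"
  assumes "a \<longlonglongrightarrow> 1" "b \<longlonglongrightarrow> 1" "\<forall>\<^sub>F n in sequentially. a n + b n - 1 \<le> c n" "\<And>n. c n \<le> 1"
  shows "c \<longlonglongrightarrow> 1"
proof (rule tendsto_sandwich[of "\<lambda>n. a n + b n - 1" c sequentially "\<lambda>_. 1"])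
  have "(\<lambda>n. a n + b n - 1) \<longlonglongrightarrow> 1 + 1 - 1" by (intro tendsto_intros assms)
  then show "(\<lambda>n. a n + b n - 1) \<longlonglongrightarrow> 1" by simp
qed (use assms in auto)

lemma tendsto_1_mono:
  fixes a c :: "nat \<Rightarrow> real"
  assumes "a \<longlonglongrightarrow> 1" "\<forall>\<^sub>F n in sequentially. a n \<le> c n" "\<And>n. c n \<le> 1"
  shows "c \<longlonglongrightarrow> 1"
  by (rule tendsto_sandwich[of a c sequentially "\<lambda>_. 1"]) (use assms in auto)

lemma density_le_1: "finite A \<Longrightarrow> real (card {v \<in> A. P v}) / real (card A) \<le> 1"
  by (cases "card A = 0") (auto simp: divide_le_eq intro: card_mono)

lemma density_one_mono:
  assumes "density_one V P" "\<And>n. finite (V n)" "\<forall>\<^sub>F n in sequentially. \<forall>v\<in>V n. P n v \<longrightarrow> Q n v"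
  shows "density_one V Q"
  unfolding density_one_def
proof (rule tendsto_1_mono[OF assms(1)[unfolded density_one_def]])
  show "\<forall>\<^sub>F n in sequentially. real (card {v \<in> V n. P n v}) / real (card (V n))
      \<le> real (card {v \<in> V n. Q n v}) / real (card (V n))"
    using assms(3)
  proof eventually_elim
    case (elim n)
    then have "card {v \<in> V n. P n v} \<le> card {v \<in> V n. Q n v}"
      by (intro card_mono) (auto simp: assms(2))
    then show ?case by (simp add: divide_right_mono)
  qed
qed (rule density_le_1[OF assms(2)])

lemma density_one_conj:
  assumes "density_one V P" "density_one V Q" "\<And>n. finite (V n)" "\<forall>\<^sub>F n in sequentially. V n \<noteq> {}"
  shows "density_one V (\<lambda>n v. P n v \<and> Q n v)"
  unfolding density_one_def
proof (rule tendsto_1_conj[OF assms(1,2)[unfolded density_one_def]])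
  show "\<forall>\<^sub>F n in sequentially. real (card {v \<in> V n. P n v}) / real (card (V n)) + real (card {v \<in> V n. Q n v}) / real (card (V n)) - 1
      \<le> real (card {v \<in> V n. P n v \<and> Q n v}) / real (card (V n))"
    using assms(4)
  proof eventually_elim
    case (elim n)
    have "card {v \<in> V n. P n v} + card {v \<in> V n. Q n v}
        = card ({v \<in> V n. P n v} \<union> {v \<in> V n. Q n v}) + card ({v \<in> V n. P n v} \<inter> {v \<in> V n. Q n v})"
      by (rule card_Un_Int) (auto simp: assms(3))
    also have "{v \<in> V n. P n v} \<inter> {v \<in> V n. Q n v} = {v \<in> V n. P n v \<and> Q n v}" by auto
    also have "card ({v \<in> V n. P n v} \<union> {v \<in> V n. Q n v}) \<le> card (V n)"
      by (rule card_mono) (auto simp: assms(3))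
    finally have "real (card {v \<in> V n. P n v}) + real (card {v \<in> V n. Q n v}) - real (card (V n))
        \<le> real (card {v \<in> V n. P n v \<and> Q n v})"
      by simp
    then have "(real (card {v \<in> V n. P n v}) + real (card {v \<in> V n. Q n v}) - real (card (V n))) / real (card (V n))
        \<le> real (card {v \<in> V n. P n v \<and> Q n v}) / real (card (V n))"
      by (rule divide_right_mono) simp
    moreover have "card (V n) > 0" using elim assms(3) by (simp add: card_gt_0_iff)
    ultimately show ?case by (simp add: diff_divide_distrib add_divide_distrib)
  qed
qed (rule density_le_1[OF assms(3)])

lemma density_one_finite_ball:
  assumes "finite I" "\<And>i. i \<in> I \<Longrightarrow> density_one V (P i)" "\<And>n. finite (V n)" "\<forall>\<^sub>F n in sequentially. V n \<noteq> {}"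
  shows "density_one V (\<lambda>n v. \<forall>i\<in>I. P i n v)"
  using assms(1,2)
proof (induction I)
  case empty
  have "(\<lambda>n. real (card (V n)) / real (card (V n))) \<longlonglongrightarrow> 1"
  proof (rule Lim_transform_eventually[OF tendsto_const])
    show "\<forall>\<^sub>F n in sequentially. 1 = real (card (V n)) / real (card (V n))"
      using assms(4) by eventually_elim (simp add: assms(3))
  qed
  then show ?case by (simp add: density_one_def)
next
  case (insert i I)
  have "density_one V (\<lambda>n v. P i n v \<and> (\<forall>i\<in>I. P i n v))"
    by (rule density_one_conj[OF _ _ assms(3,4)]) (use insert.prems insert.IH in auto)
  then show ?case by simp
qed

lemma sofic_approximationD:
  assumes "sofic_approximation V \<sigma>"
  shows "finite (V n)" "filterlim (\<lambda>n. card (V n)) at_top sequentially"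
    "\<sigma> n g permutes V n" "\<forall>\<^sub>F n in sequentially. V n \<noteq> {}"
    "density_one V (\<lambda>n v. \<sigma> n g (\<sigma> n h v) = \<sigma> n (g + h) v)"
    "g \<noteq> 0 \<Longrightarrow> density_one V (\<lambda>n v. \<sigma> n g v \<noteq> v)"
proof -
  show *: "filterlim (\<lambda>n. card (V n)) at_top sequentially" using assms by (simp add: sofic_approximation_def)
  from filterlim_at_top[THEN iffD1, OF this, rule_format, of 1]
  show "\<forall>\<^sub>F n in sequentially. V n \<noteq> {}" by (rule eventually_mono) auto
qed (use assms in \<open>simp_all add: sofic_approximation_def density_one_def\<close>)

text \<open>An open subset of a finite product is a countable union of boxes with sides in a
  countable basis. The points are extensional functions and not a whole type, hence the explicit
  \<open>product_topology\<close>.\<close>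

lemma openin_product_measurable:
  fixes S :: "('v \<Rightarrow> 'y::second_countable_topology) set"
  assumes "finite V" "openin (product_topology (\<lambda>_. euclidean) V) S"
  shows "S \<in> sets (PiM V (\<lambda>_. borel))"
proof -
  obtain \<B> :: "'y set set" where \<B>: "countable \<B>" "topological_basis \<B>"
    using ex_countable_basis by blast
  define C where "C = {b \<in> PiE V (\<lambda>_. \<B>). PiE V b \<subseteq> S}"
  have "countable C"
    by (rule countable_subset[OF _ countable_PiE[OF assms(1), of "\<lambda>_. \<B>"]]) (auto simp: C_def \<B>)
  moreover have "S = (\<Union>b\<in>C. PiE V b)"
  proof (intro equalityI subsetI)
    fix y assume y: "y \<in> S"
    from product_topology_open_contains_basis[OF assms(2) y]
    obtain X where X: "y \<in> PiE V X" "\<And>i. open (X i)" "PiE V X \<subseteq> S" by auto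
    have "\<forall>i\<in>V. \<exists>b\<in>\<B>. y i \<in> b \<and> b \<subseteq> X i"
      using X topological_basisE[OF \<B>(2) X(2)] by (metis PiE_mem)
    then obtain b where b: "\<And>i. i \<in> V \<Longrightarrow> b i \<in> \<B> \<and> y i \<in> b i \<and> b i \<subseteq> X i" by metis
    have eq: "PiE V (restrict b V) = PiE V b" by (rule PiE_cong) simp
    have "PiE V b \<subseteq> PiE V X" using b by (intro PiE_mono) auto
    then have "restrict b V \<in> C" using X b eq by (auto simp: C_def)
    moreover have "y \<in> PiE V (restrict b V)" unfolding eq using X(1) b by (auto simp: PiE_iff)
    ultimately show "y \<in> (\<Union>b\<in>C. PiE V b)" by blast
  qed (auto simp: C_def)
  moreover have "PiE V b \<in> sets (PiM V (\<lambda>_. borel))" if "b \<in> C" for b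
    using that \<B>(2) by (intro sets_PiM_I_finite assms) (auto simp: C_def PiE_iff topological_basis_open)
  ultimately show ?thesis by (auto intro!: sets.countable_UN')
qed

lemma continuous_map_pullback_name:
  assumes "\<And>g. \<sigma> g v \<in> V"
  shows "continuous_map (product_topology (\<lambda>_. euclidean) V) euclidean (pullback_name \<sigma> v)"
  unfolding euclidean_product_topology[symmetric] continuous_map_componentwise_UNIV pullback_name_def
  by (intro allI continuous_map_product_projection assms)

lemma measurable_pullback_name:
  fixes V :: "'v set"
  assumes "\<And>g. \<sigma> g v \<in> V" "sets \<nu> = sets (PiM V (\<lambda>_. borel))"
  shows "pullback_name \<sigma> v \<in> \<nu> \<rightarrow>\<^sub>M (borel :: ('g::countable \<Rightarrow> 'y::second_countable_topology) measure)"
proof (rule measurable_coordinatewise_then_product)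
  fix g
  show "(\<lambda>y. pullback_name \<sigma> v y g) \<in> \<nu> \<rightarrow>\<^sub>M (borel :: 'y measure)"
    unfolding pullback_name_def measurable_cong_sets[OF assms(2) refl]
    by (rule measurable_component_singleton[OF assms(1)])
qed

lemma empirical_borel_prob:
  assumes "finite V" "V \<noteq> {}"
  shows "empirical V \<sigma> y \<in> borel_prob"
  unfolding empirical_def borel_prob_def
  by (auto intro!: prob_space.prob_space_distr prob_space_uniform_count_measure assms
      simp: measurable_def sets_uniform_count_measure space_uniform_count_measure)

lemma integral_empirical:
  fixes f :: "('g \<Rightarrow> 'y::topological_space) \<Rightarrow> real"
  assumes "finite V" "f \<in> borel_measurable borel"
  shows "(\<integral>x. f x \<partial>empirical V \<sigma> y) = (\<Sum>v\<in>V. f (pullback_name \<sigma> v y)) / card V"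
  unfolding empirical_def
  by (subst integral_distr[OF _ assms(2)])
    (auto simp: measurable_def sets_uniform_count_measure space_uniform_count_measure
        integral_uniform_count_measure[OF assms(1)])

text \<open>For a subbasic set of measures the condition says that a finite average of continuous
  functions of \<open>y\<close> lies in an open set. Together with
  \<open>openin_product_measurable\<close> this makes the empirical event measurable; on a set that
  is not measurable, \<open>measure\<close> has the default value 0 and monotonicity could
  fail.\<close>

lemma openin_empirical_preimage:
  fixes U :: "('g::countable \<Rightarrow> 'y::second_countable_topology) measure set"
  assumes V: "finite V" "V \<noteq> {}" and \<sigma>: "\<And>g v. v \<in> V \<Longrightarrow> \<sigma> g v \<in> V"
    and U: "openin weak_star_topology U"
  shows "openin (product_topology (\<lambda>_. euclidean) V) {y \<in> PiE V (\<lambda>_. UNIV). empirical V \<sigma> y \<in> U}"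
proof -
  define T where "T = product_topology (\<lambda>_. euclidean :: 'y topology) V"
  have tT: "topspace T = PiE V (\<lambda>_. UNIV)" by (simp add: T_def)
  have "openin T {y \<in> topspace T. empirical V \<sigma> y \<in> U}"
    using U unfolding weak_star_topology_def openin_topology_generated_by_iff
  proof induction
    case (Int a b)
    have "{y \<in> topspace T. empirical V \<sigma> y \<in> a \<inter> b}
        = {y \<in> topspace T. empirical V \<sigma> y \<in> a} \<inter> {y \<in> topspace T. empirical V \<sigma> y \<in> b}" by auto
    then show ?case using Int.IH by (simp add: openin_Int)
  next
    case (UN K)
    have eq: "{y \<in> topspace T. empirical V \<sigma> y \<in> \<Union>K} = (\<Union>k\<in>K. {y \<in> topspace T. empirical V \<sigma> y \<in> k})" by auto
    show ?case unfolding eq by (rule openin_Union) (use UN.IH in blast)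
  next
    case (Basis s)
    then obtain f :: "('g \<Rightarrow> 'y) \<Rightarrow> real" and W where s: "s = {\<nu> \<in> borel_prob. (\<integral>x. f x \<partial>\<nu>) \<in> W}"
      and f: "continuous_on UNIV f" and W: "open W" by auto
    have [measurable]: "f \<in> borel_measurable borel" using f by (rule borel_measurable_continuous_onI)
    have eq: "{y \<in> topspace T. empirical V \<sigma> y \<in> s}
        = {y \<in> topspace T. (\<Sum>v\<in>V. f (pullback_name \<sigma> v y)) / card V \<in> W}"
      using empirical_borel_prob[OF V] integral_empirical[OF V(1), of f] by (auto simp: s)
    have "continuous_map T euclideanreal (\<lambda>y. f (pullback_name \<sigma> v y))" if "v \<in> V" for v
      using continuous_map_compose[OF continuous_map_pullback_name[of \<sigma> v V], of euclideanreal f] \<sigma>[OF that] f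
      by (simp add: T_def o_def)
    then have "continuous_map T euclideanreal (\<lambda>y. (\<Sum>v\<in>V. f (pullback_name \<sigma> v y)) / card V)"
      using V by (intro continuous_map_real_divide continuous_map_sum) auto
    then show ?case unfolding eq by (rule openin_continuous_map_preimage) (use W in simp)
  qed simp
  then show ?thesis by (simp add: tT T_def)
qed

lemma prob_onD: "\<nu> \<in> prob_on V \<Longrightarrow> prob_space \<nu>" "\<nu> \<in> prob_on V \<Longrightarrow> sets \<nu> = sets (PiM V (\<lambda>_. borel))"
  "\<nu> \<in> prob_on V \<Longrightarrow> space \<nu> = PiE V (\<lambda>_. UNIV)"
  using sets_eq_imp_space_eq[of \<nu> "PiM V (\<lambda>_. borel)"] by (auto simp: prob_on_def space_PiM)

text \<open>Weak-star open sets arise from conditions on single integrals by finite intersections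
  and arbitrary unions. Both modes of convergence survive these operations, so it is enough to test
  integrals.\<close>

lemma local_empirical_convergenceI:
  fixes \<nu> :: "nat \<Rightarrow> ('v \<Rightarrow> 'y::second_countable_topology) measure" and \<mu> :: "('g::{group_add,countable} \<Rightarrow> 'y) measure"
  assumes sofic: "sofic_approximation V \<sigma>"
    and \<nu>: "\<And>n. \<nu> n \<in> prob_on (V n)"
    and loc: "\<And>(f :: ('g \<Rightarrow> 'y) \<Rightarrow> real) e. continuous_on UNIV f \<Longrightarrow> bounded (range f) \<Longrightarrow> e > 0 \<Longrightarrow>
      density_one V (\<lambda>n v. \<bar>(\<integral>y. f (pullback_name (\<sigma> n) v y) \<partial>\<nu> n) - (\<integral>x. f x \<partial>\<mu>)\<bar> < e)"
    and emp: "\<And>(f :: ('g \<Rightarrow> 'y) \<Rightarrow> real) e. continuous_on UNIV f \<Longrightarrow> bounded (range f) \<Longrightarrow> e > 0 \<Longrightarrow>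
      (\<lambda>n. measure (\<nu> n) {y \<in> space (\<nu> n).
        \<bar>(\<Sum>v\<in>V n. f (pullback_name (\<sigma> n) v y)) / card (V n) - (\<integral>x. f x \<partial>\<mu>)\<bar> < e}) \<longlonglongrightarrow> 1"
  shows "local_empirical_convergence V \<sigma> \<nu> \<mu>"
proof -
  let ?law = "\<lambda>n v. distr (\<nu> n) borel (pullback_name (\<sigma> n) v)"
  let ?E = "\<lambda>n U. {y \<in> space (\<nu> n). empirical (V n) (\<sigma> n) y \<in> U}"
  note V = sofic_approximationD[OF sofic]
  have \<sigma>: "\<sigma> n g v \<in> V n" if "v \<in> V n" for n g v using permutes_in_image[OF V(3)] that by metis
  have ev: "\<forall>\<^sub>F n in sequentially. V n \<noteq> {}" by (rule V(4))
  have meas: "(?E n U) \<in> sets (\<nu> n)"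
    if "openin weak_star_topology U" "V n \<noteq> {}" for n U
    using openin_product_measurable[OF V(1) openin_empirical_preimage[OF V(1) that(2) \<sigma> that(1)]]
    by (simp add: prob_onD[OF \<nu>])
  have distr: "?law n v \<in> borel_prob" if "v \<in> V n" for n v
    using that by (auto simp: borel_prob_def intro!: prob_space.prob_space_distr prob_onD[OF \<nu>]
        measurable_pullback_name[where V="V n"] \<sigma>)
  \<comment> \<open>The premise \<open>\<mu> \<in> U\<close> belongs to the induction predicate: a
    union contains \<mu> through one of its members, and only the hypothesis for that member is
    used.\<close>
  have "\<mu> \<in> U \<longrightarrow> density_one V (\<lambda>n v. ?law n v \<in> U) \<and>
      (\<lambda>n. measure (\<nu> n) (?E n U)) \<longlonglongrightarrow> 1"
    if "openin weak_star_topology U" for U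
    using that unfolding weak_star_topology_def openin_topology_generated_by_iff
  proof induction
    case (Int a b)
    have op: "openin weak_star_topology a" "openin weak_star_topology b"
      using Int.hyps unfolding weak_star_topology_def openin_topology_generated_by_iff by auto
    show ?case
    proof (intro impI conjI)
      assume "\<mu> \<in> a \<inter> b"
      then have IH: "density_one V (\<lambda>n v. ?law n v \<in> a)"
        "density_one V (\<lambda>n v. ?law n v \<in> b)"
        "(\<lambda>n. measure (\<nu> n) (?E n a)) \<longlonglongrightarrow> 1"
        "(\<lambda>n. measure (\<nu> n) (?E n b)) \<longlonglongrightarrow> 1"
        using Int.IH by auto
      show "density_one V (\<lambda>n v. ?law n v \<in> a \<inter> b)"
        using density_one_conj[OF IH(1,2) V(1) ev] by simp
      show "(\<lambda>n. measure (\<nu> n) (?E n (a \<inter> b))) \<longlonglongrightarrow> 1"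
      proof (rule tendsto_1_conj[OF IH(3,4)])
        show "\<forall>\<^sub>F n in sequentially. measure (\<nu> n) (?E n a)
           + measure (\<nu> n) (?E n b) - 1
           \<le> measure (\<nu> n) (?E n (a \<inter> b))"
          using ev
        proof eventually_elim
          case (elim n)
          interpret prob_space "\<nu> n" by (rule prob_onD[OF \<nu>])
          let ?A = "(?E n a)"
          let ?B = "(?E n b)"
          have "prob (?A \<union> ?B) = prob ?A + prob (?B - ?A)"
            using meas[OF op(1) elim] meas[OF op(2) elim] by (rule finite_measure_Union')
          moreover have "prob (?B - ?A) = prob ?B - prob (?B \<inter> ?A)"
            using meas[OF op(2) elim] meas[OF op(1) elim] by (rule finite_measure_Diff')
          moreover have "?B \<inter> ?A = (?E n (a \<inter> b))" by auto
          ultimately show ?case using prob_le_1[of "?A \<union> ?B"] by simp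
        qed
        show "measure (\<nu> n) (?E n (a \<inter> b)) \<le> 1" for n
          using prob_space.prob_le_1[OF prob_onD(1)[OF \<nu>]] .
      qed
    qed
  next
    case (UN K)
    have op: "openin weak_star_topology (\<Union>K)"
      using generate_topology_on.UN[OF UN.hyps] unfolding weak_star_topology_def openin_topology_generated_by_iff .
    show ?case
    proof (intro impI)
      assume "\<mu> \<in> \<Union>K"
      then obtain k where k: "k \<in> K" "\<mu> \<in> k" by blast
      have sub: "k \<subseteq> \<Union>K" using k by blast
      have IH: "density_one V (\<lambda>n v. ?law n v \<in> k)"
        "(\<lambda>n. measure (\<nu> n) (?E n k)) \<longlonglongrightarrow> 1"
        using UN.IH[OF k(1)] k(2) by auto
      show "density_one V (\<lambda>n v. ?law n v \<in> \<Union>K) \<and>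
        (\<lambda>n. measure (\<nu> n) (?E n (\<Union>K))) \<longlonglongrightarrow> 1"
      proof
        show "density_one V (\<lambda>n v. ?law n v \<in> \<Union>K)"
          by (rule density_one_mono[OF IH(1) V(1)], rule always_eventually) (use sub in blast)
        show "(\<lambda>n. measure (\<nu> n) (?E n (\<Union>K))) \<longlonglongrightarrow> 1"
        proof (rule tendsto_1_mono[OF IH(2)])
          show "\<forall>\<^sub>F n in sequentially. measure (\<nu> n) (?E n k)
             \<le> measure (\<nu> n) (?E n (\<Union>K))"
            using ev
          proof eventually_elim
            case (elim n)
            interpret prob_space "\<nu> n" by (rule prob_onD[OF \<nu>])
            show ?case by (rule finite_measure_mono[OF _ meas[OF op elim]]) (use sub in auto)
          qed
          show "measure (\<nu> n) (?E n (\<Union>K)) \<le> 1" for n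
            using prob_space.prob_le_1[OF prob_onD(1)[OF \<nu>]] .
        qed
      qed
    qed
  next
    case (Basis s)
    then obtain f :: "('g \<Rightarrow> 'y) \<Rightarrow> real" and W where s: "s = {\<nu> \<in> borel_prob. (\<integral>x. f x \<partial>\<nu>) \<in> W}"
      and f: "continuous_on UNIV f" "bounded (range f)" and W: "open W" by auto
    have op: "openin weak_star_topology s" unfolding s by (rule openin_weak_star_basis[OF f W])
    have fm: "f \<in> borel_measurable borel" using f(1) by (rule borel_measurable_continuous_onI)
    show ?case
    proof (intro impI)
      assume "\<mu> \<in> s"
      then have "(\<integral>x. f x \<partial>\<mu>) \<in> W" by (simp add: s)
      then obtain e where e: "e > 0" "ball (\<integral>x. f x \<partial>\<mu>) e \<subseteq> W" using W open_contains_ball by blast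
      have inW: "w \<in> W" if "\<bar>w - (\<integral>x. f x \<partial>\<mu>)\<bar> < e" for w
        using that e(2) by (auto simp: dist_real_def abs_minus_commute)
      show "density_one V (\<lambda>n v. ?law n v \<in> s) \<and>
        (\<lambda>n. measure (\<nu> n) (?E n s)) \<longlonglongrightarrow> 1"
      proof
        show "density_one V (\<lambda>n v. ?law n v \<in> s)"
        proof (rule density_one_mono[OF loc[OF f e(1)] V(1)], intro always_eventually allI ballI impI)
          fix n v assume v: "v \<in> V n" and *: "\<bar>(\<integral>y. f (pullback_name (\<sigma> n) v y) \<partial>\<nu> n) - (\<integral>x. f x \<partial>\<mu>)\<bar> < e"
          have "(\<integral>x. f x \<partial>?law n v) = (\<integral>y. f (pullback_name (\<sigma> n) v y) \<partial>\<nu> n)"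
            by (rule integral_distr[OF measurable_pullback_name[where V="V n"] fm])
              (use v \<sigma> prob_onD[OF \<nu>] in auto)
          then show "?law n v \<in> s"
            using distr[OF v] inW[OF *] by (simp add: s)
        qed
        show "(\<lambda>n. measure (\<nu> n) (?E n s)) \<longlonglongrightarrow> 1"
        proof (rule tendsto_1_mono[OF emp[OF f e(1)]])
          show "\<forall>\<^sub>F n in sequentially. measure (\<nu> n) {y \<in> space (\<nu> n).
              \<bar>(\<Sum>v\<in>V n. f (pullback_name (\<sigma> n) v y)) / card (V n) - (\<integral>x. f x \<partial>\<mu>)\<bar> < e}
              \<le> measure (\<nu> n) (?E n s)"
            using ev
          proof eventually_elim
            case (elim n)
            interpret prob_space "\<nu> n" by (rule prob_onD[OF \<nu>])
            show ?case
              using inW empirical_borel_prob[OF V(1) elim] integral_empirical[OF V(1) fm]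
              by (intro finite_measure_mono[OF _ meas[OF op elim]]) (auto simp: s)
          qed
          show "measure (\<nu> n) (?E n s) \<le> 1" for n
            using prob_space.prob_le_1[OF prob_onD(1)[OF \<nu>]] .
        qed
      qed
    qed
  qed simp
  then show ?thesis unfolding local_empirical_convergence_def density_one_def by blast
qed

section \<open>Models of factors\<close>

definition code_map :: "'v set \<Rightarrow> ('g \<Rightarrow> 'v \<Rightarrow> 'v) \<Rightarrow> (('g \<Rightarrow> 'a) \<Rightarrow> 'y) \<Rightarrow> ('v \<Rightarrow> 'a) \<Rightarrow> 'v \<Rightarrow> 'y" where
  "code_map V \<sigma> \<phi> x = (\<lambda>v\<in>V. \<phi> (pullback_name \<sigma> v x))"

lemma sets_prob_on_finite:
  fixes \<nu> :: "('v \<Rightarrow> 'a::{finite,discrete_topology}) measure"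
  assumes "finite V" "\<nu> \<in> prob_on V"
  shows "sets \<nu> = Pow (patterns V)"
proof
  show "sets \<nu> \<subseteq> Pow (patterns V)"
    using sets.sets_into_space[of _ \<nu>] prob_onD(3)[OF assms(2)] by auto
  show "Pow (patterns V) \<subseteq> sets \<nu>"
  proof
    fix S :: "('v \<Rightarrow> 'a) set" assume "S \<in> Pow (patterns V)"
    then have S: "S \<subseteq> patterns V" by simp
    have fin: "finite S" by (rule finite_subset[OF S finite_patterns[OF assms(1)]])
    have "{y} \<in> sets \<nu>" if "y \<in> S" for y
    proof -
      have "{y} = PiE V (\<lambda>i. {y i})" using S that by (intro PiE_singleton[symmetric]) (auto simp: PiE_def)
      also have "\<dots> \<in> sets (PiM V (\<lambda>_. borel))"
        by (rule sets_PiM_I_finite[OF assms(1)]) (rule borel_open, rule discrete_topology_class.open_discrete)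
      finally show ?thesis by (simp add: prob_onD(2)[OF assms(2)])
    qed
    with sets.finite_UN[OF fin, of "\<lambda>y. {y}" \<nu>] show "S \<in> sets \<nu>" by simp
  qed
qed

lemma measurable_prob_on_finite:
  fixes \<nu> :: "('v \<Rightarrow> 'a::{finite,discrete_topology}) measure"
  assumes "finite V" "\<nu> \<in> prob_on V" "\<And>x. x \<in> patterns V \<Longrightarrow> f x \<in> space N"
  shows "f \<in> \<nu> \<rightarrow>\<^sub>M N"
  by (rule measurableI) (use assms in \<open>auto simp: prob_onD(3)[OF assms(2)] sets_prob_on_finite[OF assms(1,2)]\<close>)

lemma integrable_prob_on_finite:
  fixes \<nu> :: "('v \<Rightarrow> 'a::{finite,discrete_topology}) measure" and f :: "('v \<Rightarrow> 'a) \<Rightarrow> real"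
  assumes "finite V" "\<nu> \<in> prob_on V"
  shows "integrable \<nu> f"
proof -
  interpret prob_space \<nu> by (rule prob_onD[OF assms(2)])
  have "finite ((\<lambda>x. norm (f x)) ` patterns V)" using finite_patterns[OF assms(1)] by blast
  then have "AE x in \<nu>. norm (f x) \<le> Max ((\<lambda>x. norm (f x)) ` patterns V)"
    by (intro AE_I2 Max_ge) (auto simp: prob_onD(3)[OF assms(2)])
  then show ?thesis by (rule integrable_const_bound) (rule measurable_prob_on_finite[OF assms], simp)
qed

lemma factor_prob_on:
  fixes \<nu> :: "('v \<Rightarrow> 'a::{finite,discrete_topology}) measure"
  assumes "finite V" "\<nu> \<in> prob_on V"
  shows "distr \<nu> (PiM V (\<lambda>_. borel)) (code_map V \<sigma> \<phi>) \<in> prob_on V"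
proof -
  interpret prob_space \<nu> by (rule prob_onD[OF assms(2)])
  have "code_map V \<sigma> \<phi> \<in> \<nu> \<rightarrow>\<^sub>M PiM V (\<lambda>_. borel)"
    by (rule measurable_prob_on_finite[OF assms]) (simp add: code_map_def space_PiM)
  then show ?thesis by (simp add: prob_on_def prob_space_distr)
qed

text \<open>Coding with a fixed \<open>\<phi> m\<close> leads to the factor by
  \<open>\<phi> m\<close>, and these factor maps converge almost surely to the one of \<psi>; the
  diagonal choice \<open>k\<close> performs both limits at once. The conclusion also records a dense
  set \<open>U\<close> of vertices with local law close to \<mu>, on which the entropy bound will
  place its windows.\<close>

lemma factor_models:
  fixes \<mu> :: "('g::{group_add,countable} \<Rightarrow> 'a::{finite,discrete_topology,second_countable_topology}) measure"
    and \<psi> :: "('g \<Rightarrow> 'a) \<Rightarrow> 'y::{metric_space, second_countable_topology}"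
    and V :: "nat \<Rightarrow> 'v set"
  assumes proc: "process \<mu>" and sofic: "sofic_approximation V \<sigma>"
    and \<mu>s: "\<And>n. \<mu>s n \<in> prob_on (V n)" and conv: "local_empirical_convergence V \<sigma> \<mu>s \<mu>"
    and \<psi>[measurable]: "\<psi> \<in> borel \<rightarrow>\<^sub>M borel" and cpt: "compact (UNIV :: 'y set)"
  obtains \<phi> :: "nat \<Rightarrow> ('g \<Rightarrow> 'a) \<Rightarrow> 'y" and K :: "nat \<Rightarrow> 'g set" and k :: "nat \<Rightarrow> nat" and U :: "nat \<Rightarrow> 'v \<Rightarrow> bool"
  where "\<And>m. finite (K m)" "\<And>m. depends_on (K m) (\<phi> m)"
    "\<And>m. measure \<mu> {a. (1/2)^m \<le> dist (\<phi> m a) (\<psi> a)} < (1/2)^m"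
    "\<And>g. \<forall>\<^sub>F m in sequentially. g \<in> K m"
    "filterlim k at_top sequentially"
    "density_one V U"
    "\<forall>\<^sub>F n in sequentially. \<forall>v\<in>V n. U n v \<longrightarrow> distr (\<mu>s n) borel (pullback_name (\<sigma> n) v)
       \<in> cylinder_nbhd (K (k n)) (1 / (real (k n) + 1)) \<mu>"
    "local_empirical_convergence V \<sigma>
       (\<lambda>n. distr (\<mu>s n) (PiM (V n) (\<lambda>_. borel)) (code_map (V n) (\<sigma> n) (\<phi> (k n))))
       (distr \<mu> borel (equivariant_map \<psi>))"
proof -
  note V = sofic_approximationD[OF sofic]
  have \<sigma>: "\<sigma> n g v \<in> V n" if "v \<in> V n" for n g v using permutes_in_image[OF V(3)] that by metis
  have \<mu>: "\<mu> \<in> borel_prob" using proc by (simp add: process_def)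
  interpret \<mu>: prob_space \<mu> using \<mu> by (rule borel_probD)
  note sets\<mu>[measurable_cong] = borel_probD(2)[OF \<mu>]
  have "\<forall>m. \<exists>L \<phi>. finite L \<and> depends_on L \<phi> \<and> measure \<mu> {a. (1/2)^m \<le> dist (\<phi> a) (\<psi> a)} < (1/2)^m"
    by (intro allI approximate_by_local_function[OF \<mu> \<psi> _ cpt]) simp
  then obtain L \<phi> where L: "\<And>m. finite (L m)" "\<And>m. depends_on (L m) (\<phi> m)"
      "\<And>m. measure \<mu> {a. (1/2)^m \<le> dist (\<phi> m a) (\<psi> a)} < (1/2)^m"
    by metis
  \<comment> \<open>An exhaustion of the group by finite sets: every finite set of coordinates
    eventually lies in \<open>E m\<close>.\<close>
  define E where "E m = {g::'g. to_nat g \<le> m}" for m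
  have finE: "finite (E m)" for m
    unfolding E_def using finite_vimageI[of "{..m}" "to_nat :: 'g \<Rightarrow> nat"] by (simp add: vimage_def inj_on_def)
  \<comment> \<open>The products \<open>h + g\<close> make \<open>K m\<close> large enough to
    determine the values of \<open>\<phi> m\<close> at all shifts by elements of
    \<open>E m\<close>.\<close>
  define K where "K m = L m \<union> E m \<union> (\<lambda>(h, g). h + g) ` (L m \<times> E m)" for m
  have finK: "finite (K m)" for m using L(1) finE by (simp add: K_def)
  have depK: "depends_on (K m) (\<phi> m)" for m by (rule depends_on_mono[OF L(2)]) (auto simp: K_def)
  have evE: "\<forall>\<^sub>F m in sequentially. g \<in> E m" for g
    unfolding E_def by (simp add: eventually_ge_at_top)
  define O' where "O' m = cylinder_nbhd (K m) (1 / (real m + 1)) \<mu>" for m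
  have cK: "card (patterns (K m) :: ('g \<Rightarrow> 'a) set) > 0" for m
    using finite_patterns[OF finK] patterns_nonempty by (simp add: card_gt_0_iff)
  have O': "openin weak_star_topology (O' m)" "\<mu> \<in> O' m" for m
  proof -
    show "openin weak_star_topology (O' m)" unfolding O'_def by (rule openin_cylinder_nbhd[OF finK])
    show "\<mu> \<in> O' m" unfolding O'_def
using cK[of m] by (simp add: cylinder_nbhd_def \<mu>)
  qed
  \<comment> \<open>The second clause is multiplicativity for the pairs met when the coded name at
    \<open>v\<close> is read on \<open>E m\<close>. It identifies the coded label at
    \<open>\<sigma> n g v\<close> with \<open>\<phi> m\<close> of the shift by \<open>g\<close> of
    the name at \<open>v\<close>.\<close>
  define G where "G m n v \<longleftrightarrow> distr (\<mu>s n) borel (pullback_name (\<sigma> n) v) \<in> O' m \<and>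
      (\<forall>(h, g)\<in>L m \<times> E m. \<sigma> n h (\<sigma> n g v) = \<sigma> n (h + g) v)" for m n v
  define R where "R m n \<longleftrightarrow> V n \<noteq> {} \<and> 1 - 1 / (real m + 1) \<le> real (card {v \<in> V n. G m n v}) / real (card (V n)) \<and>
     1 - 1 / (real m + 1) \<le> measure (\<mu>s n) {x \<in> space (\<mu>s n). empirical (V n) (\<sigma> n) x \<in> O' m}" for m n
  have "\<forall>\<^sub>F n in sequentially. R m n" for m
  proof -
    have "density_one V (\<lambda>n v. distr (\<mu>s n) borel (pullback_name (\<sigma> n) v) \<in> O' m)"
      using conv O' unfolding local_empirical_convergence_def density_one_def by blast
    moreover have "density_one V (\<lambda>n v. \<forall>p\<in>L m \<times> E m. \<sigma> n (fst p) (\<sigma> n (snd p) v) = \<sigma> n (fst p + snd p) v)"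
      by (rule density_one_finite_ball[OF _ V(5) V(1,4)]) (simp add: L finE)
    ultimately have "density_one V (\<lambda>n v. distr (\<mu>s n) borel (pullback_name (\<sigma> n) v) \<in> O' m \<and>
        (\<forall>p\<in>L m \<times> E m. \<sigma> n (fst p) (\<sigma> n (snd p) v) = \<sigma> n (fst p + snd p) v))"
      by (rule density_one_conj[OF _ _ V(1,4)])
    then have *: "density_one V (G m)" unfolding G_def[abs_def] by (simp add: case_prod_unfold)
    have **: "(\<lambda>n. measure (\<mu>s n) {x \<in> space (\<mu>s n). empirical (V n) (\<sigma> n) x \<in> O' m}) \<longlonglongrightarrow> 1"
      using conv O' unfolding local_empirical_convergence_def by blast
    have lt: "1 - 1 / (real m + 1) < 1" by simp
    show ?thesis
      using V(4) order_tendstoD(1)[OF *[unfolded density_one_def] lt] order_tendstoD(1)[OF ** lt]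
      by eventually_elim (simp add: R_def)
  qed
  from diagonal_sequence[of R, OF this] obtain k where
    k: "filterlim k at_top sequentially" "\<forall>\<^sub>F n in sequentially. R (k n) n" by blast
  have k0: "(\<lambda>n. 1 / (real (k n) + 1)) \<longlonglongrightarrow> 0"
  proof -
    have "(\<lambda>m. 1 / (real m + 1)) \<longlonglongrightarrow> 0" by real_asymp
    from filterlim_compose[OF this k(1)] show ?thesis .
  qed
  then have k1: "(\<lambda>n. 1 - 1 / (real (k n) + 1)) \<longlonglongrightarrow> 1"
    using tendsto_diff[OF tendsto_const[of 1] k0] by simp
  have dense: "density_one V (\<lambda>n. G (k n) n)"
    unfolding density_one_def
    by (rule tendsto_1_mono[OF k1 _ density_le_1[OF V(1)]])
      (use k(2) in \<open>auto elim!: eventually_mono simp: R_def\<close>)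
  define \<nu> where "\<nu> n = distr (\<mu>s n) (PiM (V n) (\<lambda>_. borel)) (code_map (V n) (\<sigma> n) (\<phi> (k n)))" for n
  have \<nu>: "\<nu> n \<in> prob_on (V n)" for n unfolding \<nu>_def by (rule factor_prob_on[OF V(1) \<mu>s])
  have code_meas: "code_map (V n) (\<sigma> n) (\<phi> m) \<in> \<mu>s n \<rightarrow>\<^sub>M PiM (V n) (\<lambda>_. borel)" for n m
    by (rule measurable_prob_on_finite[OF V(1) \<mu>s]) (simp add: code_map_def space_PiM)
  have \<phi>m[measurable]: "\<phi> m \<in> borel \<rightarrow>\<^sub>M borel" for m by (rule borel_measurable_depends_on[OF L(1,2)])
  have AE_conv: "AE a in \<mu>. \<forall>g. (\<lambda>m. \<phi> m (gshift g a)) \<longlonglongrightarrow> \<psi> (gshift g a)"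
    by (rule process_AE_gshift[OF proc], rule approximating_sequence_AE[OF \<mu> \<psi> _ L(3)]) simp

  have key: "\<forall>\<^sub>F n in sequentially. V n \<noteq> {} \<and>
      (\<forall>v\<in>V n. G (k n) n v \<longrightarrow> \<bar>(\<integral>y. f (pullback_name (\<sigma> n) v y) \<partial>\<nu> n) - (\<integral>x. f x \<partial>distr \<mu> borel (equivariant_map \<psi>))\<bar> < e) \<and>
      1 - 1 / (real (k n) + 1) \<le> measure (\<nu> n) {y \<in> space (\<nu> n).
        \<bar>(\<Sum>v\<in>V n. f (pullback_name (\<sigma> n) v y)) / card (V n) - (\<integral>x. f x \<partial>distr \<mu> borel (equivariant_map \<psi>))\<bar> < e}"
    if f: "continuous_on UNIV f" "bounded (range f)" and e: "e > 0" for f :: "('g \<Rightarrow> 'y) \<Rightarrow> real" and e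
  proof -
    have fm[measurable]: "f \<in> borel_measurable borel" using f(1) by (rule borel_measurable_continuous_onI)
    obtain B where B: "\<And>y. \<bar>f y\<bar> \<le> B" using f(2) unfolding bounded_iff by auto
    have B0: "B \<ge> 0" using B[of undefined] by linarith
    \<comment> \<open>The local estimate will add up to \<open>4 * e'\<close> and the empirical one
      to \<open>6 * e'\<close>, both below \<open>e\<close>.\<close>
    define e' where "e' = e / 8"
    have e': "e' > 0" using e by (simp add: e'_def)
    obtain E0 where E0: "finite E0" "\<And>y y'. (\<And>g. g \<in> E0 \<Longrightarrow> y g = y' g) \<Longrightarrow> \<bar>f y - f y'\<bar> < e'"
      using continuous_finite_dependence[OF cpt f(1) e'] by blast
    \<comment> \<open>A local stand-in for \<open>f\<close> of the factor name: the coordinates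
      outside \<open>E0\<close> are replaced by a constant, which changes \<open>f\<close> by less
      than \<open>e'\<close>.\<close>
    define h where "h m a = f (\<lambda>g. if g \<in> E0 then \<phi> m (gshift g a) else undefined)" for m and a :: "'g \<Rightarrow> 'a"
    have h_dep: "depends_on (K m) (h m)" if "E0 \<subseteq> E m" for m
      unfolding depends_on_def
    proof (intro allI impI)
      fix a a' :: "'g \<Rightarrow> 'a" assume *: "\<forall>g\<in>K m. a g = a' g"
      have "\<phi> m (gshift g a) = \<phi> m (gshift g a')" if "g \<in> E0" for g
        by (rule depends_onD[OF L(2)]) (use * \<open>E0 \<subseteq> E m\<close> that in \<open>force simp: gshift_def K_def\<close>)
      then show "h m a = h m a'" unfolding h_def by (intro arg_cong[where f=f]) auto
    qed
    have h_B: "\<bar>h m a\<bar> \<le> B" for m a unfolding h_def by (rule B)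
    have h_close: "\<bar>h m a - f (equivariant_map (\<phi> m) a)\<bar> < e'" for m a
      unfolding h_def by (rule E0(2)) (simp add: equivariant_map_def)
    have h_meas[measurable]: "h m \<in> borel_measurable borel" for m
    proof -
      have "(\<lambda>a g. if g \<in> E0 then \<phi> m (gshift g a) else undefined) \<in> borel \<rightarrow>\<^sub>M (borel :: ('g \<Rightarrow> 'y) measure)"
      proof (rule measurable_coordinatewise_then_product)
        show "(\<lambda>a. if g \<in> E0 then \<phi> m (gshift g a) else undefined) \<in> borel \<rightarrow>\<^sub>M (borel :: 'y measure)" for g
          by (cases "g \<in> E0") simp_all
      qed
      from measurable_compose[OF this fm] show ?thesis unfolding h_def .
    qed
    have int_f\<psi>: "(\<integral>x. f x \<partial>distr \<mu> borel (equivariant_map \<psi>)) = (\<integral>a. f (equivariant_map \<psi> a) \<partial>\<mu>)"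
      by (rule integral_distr) measurable
    have "(\<lambda>m. \<integral>a. f (equivariant_map (\<phi> m) a) \<partial>\<mu>) \<longlonglongrightarrow> (\<integral>a. f (equivariant_map \<psi> a) \<partial>\<mu>)"
    proof (rule integral_dominated_convergence[where w="\<lambda>_. B"])
      show "AE a in \<mu>. (\<lambda>m. f (equivariant_map (\<phi> m) a)) \<longlonglongrightarrow> f (equivariant_map \<psi> a)"
        using AE_conv
      proof eventually_elim
        case (elim a)
        have "limitin (product_topology (\<lambda>_. euclidean) UNIV) (\<lambda>m. equivariant_map (\<phi> m) a) (equivariant_map \<psi> a) sequentially"
          unfolding limitin_componentwise using elim by (auto simp: equivariant_map_def)
        then have "(\<lambda>m. equivariant_map (\<phi> m) a) \<longlonglongrightarrow> equivariant_map \<psi> a"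
          by (simp add: euclidean_product_topology)
        moreover have "isCont f (equivariant_map \<psi> a)" using f(1) by (simp add: continuous_on_eq_continuous_at)
        ultimately show ?case by (metis isCont_tendsto_compose)
      qed
      show "AE a in \<mu>. norm (f (equivariant_map (\<phi> m) a)) \<le> B" for m using B by simp
      show "(\<lambda>a. f (equivariant_map \<psi> a)) \<in> borel_measurable \<mu>" by measurable
      show "(\<lambda>a. f (equivariant_map (\<phi> m) a)) \<in> borel_measurable \<mu>" for m by measurable
    qed simp
    then have "\<forall>\<^sub>F m in sequentially. \<bar>(\<integral>a. f (equivariant_map (\<phi> m) a) \<partial>\<mu>) - (\<integral>a. f (equivariant_map \<psi> a) \<partial>\<mu>)\<bar> < e'"
      using e' by (auto dest!: tendstoD simp: dist_real_def)
    moreover have "\<forall>\<^sub>F m in sequentially. \<forall>g\<in>E0. g \<in> E m"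
      using E0(1) evE by (simp add: eventually_ball_finite)
    moreover have "\<forall>\<^sub>F m in sequentially. B * (1 / (real m + 1)) < e'"
    proof -
      have "(\<lambda>m. B * (1 / (real m + 1))) \<longlonglongrightarrow> 0" by real_asymp
      then show ?thesis using e' by (rule order_tendstoD)
    qed
    ultimately have "\<forall>\<^sub>F m in sequentially. \<bar>(\<integral>a. f (equivariant_map (\<phi> m) a) \<partial>\<mu>) - (\<integral>a. f (equivariant_map \<psi> a) \<partial>\<mu>)\<bar> < e'
        \<and> E0 \<subseteq> E m \<and> B * (1 / (real m + 1)) < e'"
      by eventually_elim auto
    from eventually_compose_filterlim[OF this k(1)] k(2)
    show ?thesis
    proof eventually_elim
      case (elim n)
      define m where "m = k n"
      let ?fc = "\<lambda>v x. f (pullback_name (\<sigma> n) v (code_map (V n) (\<sigma> n) (\<phi> m) x))"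
      let ?hn = "\<lambda>v x. h m (pullback_name (\<sigma> n) v x)"
      let ?I = "\<integral>x. f x \<partial>distr \<mu> borel (equivariant_map \<psi>)"
      have m: "\<bar>(\<integral>a. f (equivariant_map (\<phi> m) a) \<partial>\<mu>) - (\<integral>a. f (equivariant_map \<psi> a) \<partial>\<mu>)\<bar> < e'"
          "E0 \<subseteq> E m" "B * (1 / (real m + 1)) < e'" and R: "R m n"
        using elim by (auto simp: m_def)
      have Vn: "V n \<noteq> {}" using R by (simp add: R_def)
      have cV: "card (V n) > 0" using Vn V(1) by (simp add: card_gt_0_iff)
      interpret \<mu>n: prob_space "\<mu>s n" by (rule prob_onD[OF \<mu>s])
      have integ: "integrable (\<mu>s n) F" for F :: "('v \<Rightarrow> 'a) \<Rightarrow> real" by (rule integrable_prob_on_finite[OF V(1) \<mu>s])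
      have hint: "\<bar>(\<integral>a. h m a \<partial>\<mu>) - (\<integral>a. f (equivariant_map \<psi> a) \<partial>\<mu>)\<bar> < 2 * e'"
      proof -
        have i1: "integrable \<mu> (h m)"
          by (rule \<mu>.integrable_const_bound[of _ B]) (use h_B in auto)
        have i2: "integrable \<mu> (\<lambda>a. f (equivariant_map (\<phi> m) a))"
          by (rule \<mu>.integrable_const_bound[of _ B]) (use B in auto)
        have "\<bar>(\<integral>a. h m a \<partial>\<mu>) - (\<integral>a. f (equivariant_map (\<phi> m) a) \<partial>\<mu>)\<bar>
            = \<bar>\<integral>a. h m a - f (equivariant_map (\<phi> m) a) \<partial>\<mu>\<bar>"
          by (simp add: Bochner_Integration.integral_diff[OF i1 i2])
        also have "\<dots> \<le> (\<integral>a. \<bar>h m a - f (equivariant_map (\<phi> m) a)\<bar> \<partial>\<mu>)" by (rule integral_abs_bound)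
        also have "\<dots> \<le> (\<integral>a. e' \<partial>\<mu>)"
          by (rule integral_mono) (use h_close i1 i2 in \<open>auto intro: less_imp_le\<close>)
        also have "\<dots> = e'" by (simp add: \<mu>.prob_space)
        finally show ?thesis using m(1) by linarith
      qed
      have mn_close: "\<bar>(\<integral>a. h m a \<partial>\<eta>) - (\<integral>a. h m a \<partial>\<mu>)\<bar> < e'" if "\<eta> \<in> O' m" for \<eta>
      proof -
        have "\<bar>(\<integral>a. h m a \<partial>\<eta>) - (\<integral>a. h m a \<partial>\<mu>)\<bar> \<le> 1 / (real m + 1) * B"
          by (rule cylinder_nbhd_integral[OF finK h_dep[OF m(2)] \<mu> _ h_B]) (use that in \<open>simp add: O'_def\<close>)
        then show ?thesis using m(3) by (simp add: mult.commute)
      qed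
      have name_close: "\<bar>?fc v x - ?hn v x\<bar> < e'"
        if v: "v \<in> V n" "G m n v" for v x
        unfolding h_def
      proof (rule E0(2))
        fix g assume g: "g \<in> E0"
        have "pullback_name (\<sigma> n) v (code_map (V n) (\<sigma> n) (\<phi> m) x) g = \<phi> m (pullback_name (\<sigma> n) (\<sigma> n g v) x)"
          using \<sigma>[OF v(1)] by (simp add: pullback_name_def[of _ v] code_map_def)
        also have "\<dots> = \<phi> m (gshift g (pullback_name (\<sigma> n) v x))"
        proof (rule depends_onD[OF L(2)])
          fix h assume "h \<in> L m"
          then have "\<sigma> n h (\<sigma> n g v) = \<sigma> n (h + g) v" using v(2) g m(2) by (auto simp: G_def)
          then show "pullback_name (\<sigma> n) (\<sigma> n g v) x h = gshift g (pullback_name (\<sigma> n) v x) h"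
            by (simp add: pullback_name_def gshift_def)
        qed
        finally show "pullback_name (\<sigma> n) v (code_map (V n) (\<sigma> n) (\<phi> m) x) g =
            (if g \<in> E0 then \<phi> m (gshift g (pullback_name (\<sigma> n) v x)) else undefined)" using g by simp
      qed
      have loc: "\<bar>(\<integral>y. f (pullback_name (\<sigma> n) v y) \<partial>\<nu> n) - ?I\<bar> < e"
        if v: "v \<in> V n" "G m n v" for v
      proof -
        have pm: "pullback_name (\<sigma> n) v \<in> \<mu>s n \<rightarrow>\<^sub>M borel"
          by (rule measurable_prob_on_finite[OF V(1) \<mu>s]) simp
        have "(\<integral>y. f (pullback_name (\<sigma> n) v y) \<partial>\<nu> n)
            = (\<integral>x. ?fc v x \<partial>\<mu>s n)"
          unfolding \<nu>_def m_def[symmetric]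
          by (rule integral_distr[OF code_meas measurable_compose[OF measurable_pullback_name fm]])
            (use \<sigma> v in auto)
        moreover have "(\<integral>a. h m a \<partial>distr (\<mu>s n) borel (pullback_name (\<sigma> n) v)) = (\<integral>x. ?hn v x \<partial>\<mu>s n)"
          by (rule integral_distr[OF pm h_meas])
        moreover have "\<bar>(\<integral>x. ?fc v x \<partial>\<mu>s n)
            - (\<integral>x. ?hn v x \<partial>\<mu>s n)\<bar> \<le> e'"
        proof -
          have "\<bar>(\<integral>x. ?fc v x \<partial>\<mu>s n)
            - (\<integral>x. ?hn v x \<partial>\<mu>s n)\<bar>
            = \<bar>\<integral>x. ?fc v x - ?hn v x \<partial>\<mu>s n\<bar>"
            by (simp add: Bochner_Integration.integral_diff[OF integ integ])
          also have "\<dots> \<le> (\<integral>x. \<bar>?fc v x - ?hn v x\<bar> \<partial>\<mu>s n)"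
            by (rule integral_abs_bound)
          also have "\<dots> \<le> (\<integral>x. e' \<partial>\<mu>s n)"
            by (rule integral_mono[OF integ integ]) (use name_close[OF v] in \<open>auto intro: less_imp_le\<close>)
          also have "\<dots> = e'" by (simp add: \<mu>n.prob_space)
          finally show ?thesis .
        qed
        moreover have "\<bar>(\<integral>a. h m a \<partial>distr (\<mu>s n) borel (pullback_name (\<sigma> n) v)) - (\<integral>a. h m a \<partial>\<mu>)\<bar> < e'"
          by (rule mn_close) (use v in \<open>simp add: G_def\<close>)
        ultimately show ?thesis using hint unfolding int_f\<psi> e'_def by linarith
      qed
      have emp: "\<bar>(\<Sum>v\<in>V n. ?fc v x) / card (V n)
          - ?I\<bar> < e"
        if x: "empirical (V n) (\<sigma> n) x \<in> O' m" for x
      proof -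
        have "\<bar>(\<Sum>v\<in>V n. ?fc v x) - (\<Sum>v\<in>V n. ?hn v x)\<bar> \<le> (\<Sum>v\<in>V n. \<bar>?fc v x - ?hn v x\<bar>)"
          unfolding sum_subtractf[symmetric] by (rule sum_abs)
        \<comment> \<open>At a vertex outside \<open>G\<close> the two terms may differ by as much
          as \<open>2 * B\<close>, but by \<open>R\<close> such vertices have proportion at most
          \<open>1 / (m + 1)\<close>.\<close>
        also have "\<dots> \<le> (\<Sum>v\<in>V n. e' + (if G m n v then 0 else 2 * B))"
        proof (rule sum_mono)
          fix v assume v: "v \<in> V n"
          have "\<bar>?fc v x - ?hn v x\<bar> \<le> 2 * B" using B[of "pullback_name (\<sigma> n) v (code_map (V n) (\<sigma> n) (\<phi> m) x)"]
            h_B[of m "pullback_name (\<sigma> n) v x"] by linarith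
          then show "\<bar>?fc v x - ?hn v x\<bar> \<le> e' + (if G m n v then 0 else 2 * B)"
            using name_close[OF v, of x] e' by (cases "G m n v") auto
        qed
        also have "\<dots> = card (V n) * e' + 2 * B * (real (card (V n)) - real (card {v \<in> V n. G m n v}))"
        proof -
          have "(\<Sum>v\<in>V n. if G m n v then 0 else 2 * B) = 2 * B * real (card {v \<in> V n. \<not> G m n v})"
            by (simp add: sum.If_cases[OF V(1)] Int_def Compl_eq)
          moreover have "card (V n) = card {v \<in> V n. G m n v} + card {v \<in> V n. \<not> G m n v}"
            by (subst card_Un_disjoint[symmetric]) (auto simp: V(1) intro!: arg_cong[where f=card])
          ultimately show ?thesis by (simp add: sum.distrib)
        qed
        finally have "\<bar>(\<Sum>v\<in>V n. ?fc v x) - (\<Sum>v\<in>V n. ?hn v x)\<bar> / card (V n)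
            \<le> (card (V n) * e' + 2 * B * (real (card (V n)) - real (card {v \<in> V n. G m n v}))) / card (V n)"
          by (rule divide_right_mono) simp
        also have "\<dots> = e' + 2 * B * (1 - real (card {v \<in> V n. G m n v}) / card (V n))"
          using cV by (simp add: field_simps)
        also have "\<dots> \<le> e' + 2 * B * (1 / (real m + 1))"
          using R B0 by (intro add_left_mono mult_left_mono) (auto simp: R_def)
        also have "\<dots> < 3 * e'" using m(3) by simp
        finally have "\<bar>(\<Sum>v\<in>V n. ?fc v x) / card (V n) - (\<Sum>v\<in>V n. ?hn v x) / card (V n)\<bar> < 3 * e'"
          by (simp add: diff_divide_distrib[symmetric])
        moreover have "\<bar>(\<Sum>v\<in>V n. ?hn v x) / card (V n) - (\<integral>a. h m a \<partial>\<mu>)\<bar> < e'"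
          using mn_close[OF x] by (simp add: integral_empirical[OF V(1) h_meas])
        ultimately show ?thesis using hint unfolding int_f\<psi> e'_def by linarith
      qed
      let ?S = "{y \<in> space (\<nu> n). \<bar>(\<Sum>v\<in>V n. f (pullback_name (\<sigma> n) v y)) / card (V n)
          - ?I\<bar> < e}"
      \<comment> \<open>\<open>emp\<close> is a statement about individual points, so the event that
        the empirical measure of \<open>x\<close> is close to \<mu> is contained in the preimage of
        the required event.\<close>
      have "1 - 1 / (real m + 1) \<le> measure (\<mu>s n) {x \<in> space (\<mu>s n). empirical (V n) (\<sigma> n) x \<in> O' m}"
        using R by (simp add: R_def)
      also have "\<dots> \<le> measure (\<mu>s n) (code_map (V n) (\<sigma> n) (\<phi> m) -` ?S \<inter> space (\<mu>s n))"
        using emp code_meas[of n m, THEN measurable_space]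
        by (intro \<mu>n.finite_measure_mono)
          (auto simp: sets_prob_on_finite[OF V(1) \<mu>s] prob_onD[OF \<nu>] prob_onD[OF \<mu>s] space_PiM)
      also have "\<dots> = measure (\<nu> n) ?S"
      proof -
        have "(\<lambda>y. f (pullback_name (\<sigma> n) v y)) \<in> borel_measurable (\<nu> n)" if "v \<in> V n" for v
          by (rule measurable_compose[OF measurable_pullback_name[where V="V n"] fm])
            (use \<sigma> that prob_onD[OF \<nu>] in auto)
        then have "?S \<in> sets (\<nu> n)" by measurable
        then show ?thesis unfolding \<nu>_def m_def[symmetric]
          by (subst measure_distr[OF code_meas]) auto
      qed
      finally show ?case using loc Vn by (simp add: m_def)
    qed
  qed
  have "local_empirical_convergence V \<sigma> \<nu> (distr \<mu> borel (equivariant_map \<psi>))"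
  proof (rule local_empirical_convergenceI[OF sofic \<nu>])
    fix f :: "('g \<Rightarrow> 'y) \<Rightarrow> real" and e :: real
    assume "continuous_on UNIV f" "bounded (range f)" "e > 0"
    note key = key[OF this]
    show "density_one V (\<lambda>n v. \<bar>(\<integral>y. f (pullback_name (\<sigma> n) v y) \<partial>\<nu> n) - (\<integral>x. f x \<partial>distr \<mu> borel (equivariant_map \<psi>))\<bar> < e)"
      by (rule density_one_mono[OF dense V(1)]) (use key in \<open>auto elim!: eventually_mono\<close>)
    show "(\<lambda>n. measure (\<nu> n) {y \<in> space (\<nu> n).
        \<bar>(\<Sum>v\<in>V n. f (pullback_name (\<sigma> n) v y)) / card (V n) - (\<integral>x. f x \<partial>distr \<mu> borel (equivariant_map \<psi>))\<bar> < e}) \<longlonglongrightarrow> 1"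
      by (rule tendsto_1_mono[OF k1 _ prob_space.prob_le_1[OF prob_onD(1)[OF \<nu>]]])
        (use key in \<open>auto elim!: eventually_mono\<close>)
  qed
  moreover have "\<forall>\<^sub>F m in sequentially. g \<in> K m" for g
    using evE[of g] by eventually_elim (simp add: K_def)
  moreover have "\<forall>\<^sub>F n in sequentially. \<forall>v\<in>V n. G (k n) n v \<longrightarrow> distr (\<mu>s n) borel (pullback_name (\<sigma> n) v)
       \<in> cylinder_nbhd (K (k n)) (1 / (real (k n) + 1)) \<mu>"
    by (rule always_eventually) (simp add: G_def O'_def)
  ultimately show thesis
    using finK depK L(3) k(1) dense unfolding \<nu>_def by (intro that)
qed

section \<open>Entropy and codes\<close>

text \<open>Nonnegativity of relative entropy, from \<open>ln t \<le> t - 1\<close>. As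
  \<open>q\<close> may have total mass below 1, code weights can be used without
  normalisation.\<close>

lemma gibbs_inequality:
  fixes p q :: "'i \<Rightarrow> real"
  assumes "finite I" "\<And>i. i \<in> I \<Longrightarrow> 0 \<le> p i" "(\<Sum>i\<in>I. p i) = 1"
    "\<And>i. i \<in> I \<Longrightarrow> 0 < q i" "(\<Sum>i\<in>I. q i) \<le> 1"
  shows "- (\<Sum>i\<in>I. p i * ln (p i)) \<le> (\<Sum>i\<in>I. p i * - ln (q i))"
proof -
  have "p i * - ln (p i) - p i * - ln (q i) \<le> q i - p i" if "i \<in> I" for i
  proof (cases "p i = 0")
    case False
    then have pos: "p i > 0" "q i > 0" using assms that by (auto simp: less_le)
    have "ln (q i / p i) \<le> q i / p i - 1" using pos by (intro ln_le_minus_one) simp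
    then have "p i * ln (q i / p i) \<le> p i * (q i / p i - 1)" using pos by (intro mult_left_mono) auto
    then show ?thesis using pos by (simp add: ln_div algebra_simps)
  qed (use assms that in \<open>auto intro: less_imp_le\<close>)
  then have "(\<Sum>i\<in>I. p i * - ln (p i) - p i * - ln (q i)) \<le> (\<Sum>i\<in>I. q i - p i)" by (rule sum_mono)
  then show ?thesis using assms by (simp add: sum_subtractf sum_negf)
qed

lemma integral_prob_on_finite:
  fixes \<nu> :: "('v \<Rightarrow> 'a::{finite,discrete_topology}) measure" and f :: "('v \<Rightarrow> 'a) \<Rightarrow> real"
  assumes "finite V" "\<nu> \<in> prob_on V"
  shows "(\<integral>x. f x \<partial>\<nu>) = (\<Sum>x\<in>patterns V. measure \<nu> {x} * f x)"
proof -
  interpret prob_space \<nu> by (rule prob_onD[OF assms(2)])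
  have fin: "finite (patterns V :: ('v \<Rightarrow> 'a) set)" by (rule finite_patterns[OF assms(1)])
  have "(\<integral>x. f x \<partial>\<nu>) = (\<integral>x. (\<Sum>z\<in>patterns V. f z * indicator {z} x) \<partial>\<nu>)"
  proof (rule Bochner_Integration.integral_cong[OF refl])
    fix x assume x: "x \<in> space \<nu>"
    then have "x \<in> patterns V" by (simp add: prob_onD(3)[OF assms(2)])
    have "(\<Sum>z\<in>patterns V. f z * indicator {z} x) = (\<Sum>z\<in>patterns V. if x = z then f z else 0)"
      by (intro sum.cong) auto
    then show "f x = (\<Sum>z\<in>patterns V. f z * indicator {z} x)"
      using \<open>x \<in> patterns V\<close> by (simp add: sum.delta'[OF fin])
  qed
  also have "\<dots> = (\<Sum>z\<in>patterns V. \<integral>x. f z * indicator {z} x \<partial>\<nu>)"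
    by (rule Bochner_Integration.integral_sum) (rule integrable_prob_on_finite[OF assms])
  also have "\<dots> = (\<Sum>x\<in>patterns V. measure \<nu> {x} * f x)"
  proof (rule sum.cong[OF refl])
    fix z :: "'v \<Rightarrow> 'a" assume "z \<in> patterns V"
    then have "{z} \<inter> space \<nu> = {z}" by (simp add: prob_onD(3)[OF assms(2)])
    then show "(\<integral>x. f z * indicator {z} x \<partial>\<nu>) = measure \<nu> {z} * f z" by simp
  qed
  finally show ?thesis .
qed

lemma marginal_prob_on:
  fixes \<nu> :: "('v \<Rightarrow> 'a::topological_space) measure"
  assumes "\<nu> \<in> prob_on V" "T \<subseteq> V"
  shows "marginal T \<nu> \<in> prob_on T" "(\<lambda>y. restrict y T) \<in> \<nu> \<rightarrow>\<^sub>M PiM T (\<lambda>_. borel)"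
proof -
  interpret prob_space \<nu> by (rule prob_onD[OF assms(1)])
  show m: "(\<lambda>y. restrict y T) \<in> \<nu> \<rightarrow>\<^sub>M PiM T (\<lambda>_. borel)"
    unfolding measurable_cong_sets[OF prob_onD(2)[OF assms(1)] refl] by (rule measurable_restrict_subset[OF assms(2)])
  show "marginal T \<nu> \<in> prob_on T"
    unfolding prob_on_def marginal_def using prob_space_distr[OF m] by simp
qed

text \<open>The code weight \<open>q\<close> is the average over \<open>c \<in> W\<close> of the
  product weights given by \<open>\<kappa> c\<close>. At \<open>x\<close> only the term
  \<open>c = w x\<close> is kept, which costs \<open>ln (card W)\<close>. The weight depends on the
  labels in \<open>T\<close> alone, whereas \<open>w x\<close> may depend on all of
  \<open>x\<close>: it merely selects a term for a lower bound.\<close>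

lemma entropy_le_code_length:
  fixes \<nu> :: "('v \<Rightarrow> 'a::{finite,discrete_topology}) measure"
    and \<kappa> :: "'w \<Rightarrow> 'v \<Rightarrow> ('g \<Rightarrow> 'a) \<Rightarrow> real"
  assumes V: "finite V" "\<nu> \<in> prob_on V" and \<sigma>: "\<And>g v. v \<in> V \<Longrightarrow> \<sigma> g v \<in> V"
    and F: "finite F" and S: "S \<subseteq> V"
    and pos: "\<And>w s z. z \<in> patterns F \<Longrightarrow> 0 < \<kappa> w s z"
    and sub: "\<And>w s. (\<Sum>z\<in>patterns F. \<kappa> w s z) \<le> 1"
    and W: "finite W" "\<And>x. x \<in> patterns V \<Longrightarrow> w x \<in> W"
  shows "shannon_entropy (marginal (sofic_image \<sigma> F S) \<nu>)
      \<le> ln (card W) + (\<Sum>s\<in>S. \<integral>x. - ln (\<kappa> (w x) s (restrict (pullback_name \<sigma> s x) F)) \<partial>\<nu>)"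
proof -
  interpret prob_space \<nu> by (rule prob_onD[OF V(2)])
  define T where "T = sofic_image \<sigma> F S"
  have T: "T \<subseteq> V" using \<sigma> S by (auto simp: T_def sofic_image_def)
  have finT: "finite T" and finS: "finite S" using T S V(1) by (auto intro: finite_subset)
  have in_T: "\<sigma> g s \<in> T" if "g \<in> F" "s \<in> S" for g s using that by (auto simp: T_def sofic_image_def)
  have W0: "card W > 0"
    using W by (auto simp: card_gt_0_iff) (metis W(2) ex_in_conv empty_iff patterns_nonempty)
  define pat where "pat s x = restrict (pullback_name \<sigma> s x) F" for s and x :: "'v \<Rightarrow> 'a"
  have pat: "pat s x \<in> patterns F" for s x by (simp add: pat_def)
  define q where "q x = (\<Sum>c\<in>W. \<Prod>s\<in>S. \<kappa> c s (pat s x)) / card W" for x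
  have marg: "marginal T \<nu> \<in> prob_on T" by (rule marginal_prob_on[OF V(2) T])
  interpret M: prob_space "marginal T \<nu>" by (rule prob_onD[OF marg])
  have q_pos: "q x > 0" for x
    unfolding q_def using W0 by (intro divide_pos_pos sum_pos prod_pos pos pat) (auto simp: card_gt_0_iff)
  have q_sum: "(\<Sum>x\<in>patterns T. q x) \<le> 1"
  proof -
    let ?j = "\<lambda>x. \<lambda>s\<in>S. pat s x"
    \<comment> \<open>A pattern on \<open>T\<close> is determined by its windows, so the sum over
      patterns is part of the sum over independent choices of windows. Overlapping windows do no
      harm, since they only make the image smaller.\<close>
    have inj: "inj_on ?j (patterns T)"
    proof (rule inj_onI)
      fix x y :: "'v \<Rightarrow> 'a" assume x: "x \<in> patterns T" and y: "y \<in> patterns T" and eq: "?j x = ?j y"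
      have "x t = y t" if "t \<in> T" for t
      proof -
        obtain g s where gs: "g \<in> F" "s \<in> S" "t = \<sigma> g s" using \<open>t \<in> T\<close> by (auto simp: T_def sofic_image_def)
        have "pat s x = pat s y" using fun_cong[OF eq, of s] gs(2) by simp
        then have "pat s x g = pat s y g" by simp
        then show ?thesis using gs by (simp add: pat_def pullback_name_def)
      qed
      then show "x = y" using x y by (auto intro: PiE_ext)
    qed
    have "(\<Sum>x\<in>patterns T. \<Prod>s\<in>S. \<kappa> c s (pat s x)) \<le> 1" for c
    proof -
      have "(\<Sum>x\<in>patterns T. \<Prod>s\<in>S. \<kappa> c s (pat s x)) = (\<Sum>z\<in>?j ` patterns T. \<Prod>s\<in>S. \<kappa> c s (z s))"
        by (subst sum.reindex[OF inj]) (auto intro!: sum.cong prod.cong)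
      also have "\<dots> \<le> (\<Sum>z\<in>PiE S (\<lambda>_. patterns F). \<Prod>s\<in>S. \<kappa> c s (z s))"
      proof (rule sum_mono2)
        show "finite (PiE S (\<lambda>_. patterns F :: ('g \<Rightarrow> 'a) set))"
          by (intro finite_PiE finS finite_patterns F)
        show "?j ` patterns T \<subseteq> PiE S (\<lambda>_. patterns F)"
          by (intro image_subsetI restrict_PiE_iff[THEN iffD2] ballI pat)
        show "0 \<le> (\<Prod>s\<in>S. \<kappa> c s (z s))" if "z \<in> PiE S (\<lambda>_. patterns F) - ?j ` patterns T" for z
          using that by (intro prod_nonneg ballI less_imp_le pos) (auto dest: PiE_mem)
      qed
      also have "\<dots> = (\<Prod>s\<in>S. \<Sum>z\<in>patterns F. \<kappa> c s z)"
        by (rule prod_sum_PiE[symmetric]) (use finS finite_patterns[OF F] in auto)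
      also have "\<dots> \<le> 1"
        by (intro prod_le_1 conjI sub sum_nonneg less_imp_le pos)
      finally show ?thesis .
    qed
    then have "(\<Sum>c\<in>W. \<Sum>x\<in>patterns T. \<Prod>s\<in>S. \<kappa> c s (pat s x)) \<le> (\<Sum>c\<in>W. 1)" by (intro sum_mono)
    also have "(\<Sum>c\<in>W. \<Sum>x\<in>patterns T. \<Prod>s\<in>S. \<kappa> c s (pat s x)) = (\<Sum>x\<in>patterns T. \<Sum>c\<in>W. \<Prod>s\<in>S. \<kappa> c s (pat s x))"
      by (rule sum.swap)
    finally show ?thesis using W0 unfolding q_def sum_divide_distrib[symmetric] by simp
  qed
  have "shannon_entropy (marginal T \<nu>) \<le> (\<Sum>x\<in>patterns T. measure (marginal T \<nu>) {x} * - ln (q x))"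
    unfolding shannon_entropy_def prob_onD(3)[OF marg]
  proof (rule gibbs_inequality[OF finite_patterns[OF finT] _ _ q_pos q_sum])
    show "(\<Sum>x\<in>patterns T. measure (marginal T \<nu>) {x}) = 1"
      using integral_prob_on_finite[OF finT marg, of "\<lambda>_. 1"] by (simp add: M.prob_space)
  qed simp
  also have "\<dots> = (\<integral>x. - ln (q x) \<partial>marginal T \<nu>)" by (rule integral_prob_on_finite[OF finT marg, symmetric])
  also have "\<dots> = (\<integral>x. - ln (q (restrict x T)) \<partial>\<nu>)"
  proof -
    have "(\<lambda>x. - ln (q x)) \<in> borel_measurable (PiM T (\<lambda>_. borel))"
      using measurable_prob_on_finite[OF finT marg, of "\<lambda>x. - ln (q x)" borel]
      by (simp add: measurable_cong_sets[OF prob_onD(2)[OF marg] refl])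
    then show ?thesis unfolding marginal_def by (intro integral_distr marginal_prob_on[OF V(2) T])
  qed
  also have "\<dots> \<le> (\<integral>x. ln (card W) + (\<Sum>s\<in>S. - ln (\<kappa> (w x) s (pat s x))) \<partial>\<nu>)"
  proof (rule integral_mono[OF integrable_prob_on_finite[OF V] integrable_prob_on_finite[OF V]])
    fix x assume "x \<in> space \<nu>"
    then have x: "x \<in> patterns V" by (simp add: prob_onD(3)[OF V(2)])
    have pat_T: "pat s (restrict x T) = pat s x" if "s \<in> S" for s
      using in_T that by (auto simp: pat_def pullback_name_def intro!: restrict_ext)
    have pp: "(\<Prod>s\<in>S. \<kappa> c s (pat s x)) > 0" for c by (intro prod_pos pos pat)
    have "(\<Prod>s\<in>S. \<kappa> (w x) s (pat s x)) \<le> (\<Sum>c\<in>W. \<Prod>s\<in>S. \<kappa> c s (pat s x))"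
      by (rule member_le_sum[OF W(2)[OF x] less_imp_le[OF pp] W(1)])
    also have "\<dots> = q (restrict x T) * card W" using W0 pat_T by (simp add: q_def)
    finally have "ln (\<Prod>s\<in>S. \<kappa> (w x) s (pat s x)) \<le> ln (q (restrict x T) * card W)"
      using pp by (intro ln_mono) auto
    also have "\<dots> = ln (q (restrict x T)) + ln (card W)" using q_pos[of "restrict x T"] W0 by (simp add: ln_mult_pos)
    also have "ln (\<Prod>s\<in>S. \<kappa> (w x) s (pat s x)) = (\<Sum>s\<in>S. ln (\<kappa> (w x) s (pat s x)))"
      by (rule ln_prod[OF finS less_imp_neq[OF pos[OF pat], symmetric]])
    finally show "- ln (q (restrict x T)) \<le> ln (card W) + (\<Sum>s\<in>S. - ln (\<kappa> (w x) s (pat s x)))"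
      unfolding sum_negf by linarith
  qed
  also have "\<dots> = ln (card W) + (\<Sum>s\<in>S. \<integral>x. - ln (\<kappa> (w x) s (pat s x)) \<partial>\<nu>)"
    by (subst Bochner_Integration.integral_add[OF integrable_prob_on_finite[OF V] integrable_prob_on_finite[OF V]],
        subst Bochner_Integration.integral_sum[OF integrable_prob_on_finite[OF V]])
      (simp add: prob_space)
  finally show ?thesis by (simp add: T_def pat_def)
qed

lemma entropy_marginal_process:
  fixes \<mu> :: "('g::countable \<Rightarrow> 'a::{finite,discrete_topology,second_countable_topology}) measure"
  assumes "\<mu> \<in> borel_prob" "finite F"
  shows "shannon_entropy (marginal F \<mu>) = - (\<Sum>z\<in>patterns F. measure \<mu> (cylinder F z) * ln (measure \<mu> (cylinder F z)))"
proof -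
  have "(\<lambda>y. restrict y F) \<in> (PiM UNIV (\<lambda>_. borel) :: ('g \<Rightarrow> 'a) measure) \<rightarrow>\<^sub>M PiM F (\<lambda>_. borel)"
    by (rule measurable_restrict_subset) simp
  then have m: "(\<lambda>y. restrict y F) \<in> \<mu> \<rightarrow>\<^sub>M PiM F (\<lambda>_. borel)"
    using measurable_cong_sets[OF borel_probD(2)[OF assms(1)] refl]
      measurable_cong_sets[OF sets_PiM_equal_borel[where ?'a='g and ?'b='a] refl] by blast
  have "measure (marginal F \<mu>) {z} = measure \<mu> (cylinder F z)" if z: "z \<in> patterns F" for z
  proof -
    have "{z} \<in> sets (PiM F (\<lambda>_. borel :: 'a measure))"
    proof -
      have "{z} = PiE F (\<lambda>i. {z i})" using z by (intro PiE_singleton[symmetric]) (auto simp: PiE_def)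
      also have "\<dots> \<in> sets (PiM F (\<lambda>_. borel))"
        by (rule sets_PiM_I_finite[OF assms(2)]) (rule borel_open, rule discrete_topology_class.open_discrete)
      finally show ?thesis .
    qed
    moreover have "(\<lambda>y. restrict y F) -` {z} \<inter> space \<mu> = cylinder F z"
      using in_cylinder_iff[OF z] by (auto simp: borel_probD(3)[OF assms(1)])
    ultimately show ?thesis unfolding marginal_def by (simp add: measure_distr[OF m])
  qed
  moreover have "space (marginal F \<mu>) = patterns F" by (simp add: marginal_def space_PiM)
  ultimately show ?thesis unfolding shannon_entropy_def by (auto intro!: sum.cong)
qed

text \<open>
  The kernel \<open>\<kappa> t\<close> gives weight \<open>1 - \<beta>\<close> to the patterns of type \<open>t\<close> and \<open>\<beta>\<close> to the others, and is
  proportional to \<open>\<mu>\<^sub>F\<close> within each type. Mixing \<open>\<mu>\<^sub>F\<close> with the uniform distribution keeps all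
  logarithms finite, also on patterns that occur in the models but have \<open>\<mu>\<^sub>F\<close>-measure \<open>0\<close>.
\<close>

lemma binary_code_kernel:
  fixes \<mu> :: "('g::countable \<Rightarrow> 'a::{finite,discrete_topology,second_countable_topology}) measure"
  assumes \<mu>: "\<mu> \<in> borel_prob" and F: "finite F" and P: "depends_on F P"
    and \<tau>: "0 < \<tau>" "\<tau> \<le> measure \<mu> {a. P a}" "measure \<mu> {a. P a} \<le> 1 - \<tau>"
    and h: "h = - ln (1 - \<tau>/2)" and \<beta>: "\<beta> = 1 - exp (- h/8)"
  obtains \<kappa> :: "bool \<Rightarrow> ('g \<Rightarrow> 'a) \<Rightarrow> real" and g :: "('g \<Rightarrow> 'a) \<Rightarrow> real" where
    "\<And>t z. z \<in> patterns F \<Longrightarrow> 0 < \<kappa> t z"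
    "\<And>t. (\<Sum>z\<in>patterns F. \<kappa> t z) \<le> 1"
    "\<And>t z. z \<in> patterns F \<Longrightarrow> - ln (\<kappa> t z) \<le> g z - 7 * h / 8 + (if P z = t then 0 else - ln \<beta>)"
    "(\<Sum>z\<in>patterns F. g z * measure \<mu> (cylinder F z)) \<le> shannon_entropy (marginal F \<mu>) + h/8"
proof -
  interpret prob_space \<mu> using \<mu> by (rule borel_probD)
  have sp: "space \<mu> = UNIV" by (rule borel_probD(3)[OF \<mu>])
  have \<tau>1: "\<tau> \<le> 1/2" using \<tau> by linarith
  have h0: "h > 0" unfolding h using \<tau> \<tau>1 by simp
  have exp_h: "exp (- h) = 1 - \<tau>/2" unfolding h using \<tau>1 by simp
  have \<beta>0: "0 < \<beta>" and \<beta>1: "\<beta> < 1" using h0 by (simp_all add: \<beta>)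
  \<comment> \<open>The choice of \<beta> has two effects: a correct bit costs only
    \<open>h / 8\<close>, and \<open>\<beta> \<le> \<tau> / 2\<close> keeps the mass of each type at
    most \<open>1 - \<tau> / 2 = exp (- h)\<close> after mixing with the uniform
    distribution.\<close>
  have "exp (- h) \<le> exp (- h/8)" using h0 by simp
  then have \<beta>\<tau>: "\<beta> \<le> \<tau>/2" unfolding \<beta> exp_h by simp
  have ln1\<beta>: "ln (1 - \<beta>) = - h/8" by (simp add: \<beta>)
  define N where "N = real (card (patterns F :: ('g \<Rightarrow> 'a) set))"
  have fin: "finite (patterns F :: ('g \<Rightarrow> 'a) set)" by (rule finite_patterns[OF F])
  have N: "N > 0" using fin patterns_nonempty by (simp add: N_def card_gt_0_iff)
  define p where "p z = measure \<mu> (cylinder F z)" for z :: "'g \<Rightarrow> 'a"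
  define mt where "mt z = (1 - \<beta>) * p z + \<beta> / N" for z
  define tt where "tt b = (\<Sum>z\<in>{z\<in>patterns F. P z = b}. mt z)" for b
  have p0: "p z \<ge> 0" for z by (simp add: p_def)
  have mt_pos: "mt z > 0" for z unfolding mt_def using \<beta>0 \<beta>1 N p0[of z] by (intro add_nonneg_pos) auto
  have pP: "(\<Sum>z\<in>{z\<in>patterns F. P z = b}. p z) = measure \<mu> {a. P a = b}" for b
  proof -
    have d: "depends_on F (indicat_real {a. P a = b})"
      using depends_on_compose[OF P, of "\<lambda>x. of_bool (x = b) :: real"] by (simp add: indicator_def[abs_def])
    have "measure \<mu> {a. P a = b} = (\<integral>a. indicat_real {a. P a = b} a \<partial>\<mu>)" by (simp add: sp)
    also have "\<dots> = (\<Sum>z\<in>patterns F. indicat_real {a. P a = b} z * p z)"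
      unfolding p_def by (rule integral_depends_on[OF F d \<mu>])
    also have "\<dots> = (\<Sum>z\<in>patterns F. if P z = b then p z else 0)" by (intro sum.cong) auto
    also have "\<dots> = (\<Sum>z\<in>{z\<in>patterns F. P z = b}. p z)"
      by (rule sum.inter_filter[symmetric]) (rule fin)
    finally show ?thesis ..
  qed
  have P_meas: "{a. P a} \<in> sets \<mu>" using sets_depends_on[OF F P] borel_probD(2)[OF \<mu>] by simp
  have pPle: "measure \<mu> {a. P a = b} \<le> 1 - \<tau>" for b
  proof (cases b)
    case False
    have "{a. P a = b} = space \<mu> - {a. P a}" using False by (auto simp: sp)
    then show ?thesis using prob_compl[OF P_meas] \<tau> by simp
  qed (use \<tau> in simp)
  have tt_le: "tt b \<le> 1 - \<tau>/2" for b
  proof -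
    have "tt b = (1 - \<beta>) * measure \<mu> {a. P a = b} + \<beta> * (real (card {z\<in>patterns F :: ('g \<Rightarrow> 'a) set. P z = b}) / N)"
      by (simp add: tt_def mt_def sum.distrib pP[symmetric] sum_distrib_left)
    also have "real (card {z\<in>patterns F :: ('g \<Rightarrow> 'a) set. P z = b}) / N \<le> 1"
      unfolding N_def by (rule density_le_1[OF fin])
    then have "(1 - \<beta>) * measure \<mu> {a. P a = b} + \<beta> * (real (card {z\<in>patterns F :: ('g \<Rightarrow> 'a) set. P z = b}) / N)
       \<le> (1 - \<beta>) * (1 - \<tau>) + \<beta> * 1"
      using \<beta>0 \<beta>1 pPle by (intro add_mono mult_left_mono) auto
    also have "\<dots> = 1 - \<tau> + \<beta> * \<tau>" by (simp add: algebra_simps)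
    also have "\<beta> * \<tau> \<le> (1/2) * \<tau>" using \<beta>\<tau> \<tau>1 \<tau>(1) by (intro mult_right_mono) auto
    finally show ?thesis by simp
  qed
  have tt_pos: "tt (P z) > 0" if "z \<in> patterns F" for z
    unfolding tt_def using that fin by (intro sum_pos mt_pos) auto
  define \<kappa> where "\<kappa> t z = (if P z = t then 1 - \<beta> else \<beta>) * (mt z / tt (P z))" for t z
  have ratio: "(\<Sum>z\<in>{z\<in>patterns F. P z = b}. mt z / tt (P z)) \<le> 1" for b
  proof -
    have "(\<Sum>z\<in>{z\<in>patterns F. P z = b}. mt z / tt (P z)) = (\<Sum>z\<in>{z\<in>patterns F. P z = b}. mt z / tt b)"
      by (intro sum.cong) auto
    also have "\<dots> = tt b / tt b" by (simp only: tt_def sum_divide_distrib)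
    also have "\<dots> \<le> 1" by simp
    finally show ?thesis .
  qed
  show thesis
  proof (rule that[of \<kappa> "\<lambda>z. - ln (mt z)"])
    show "0 < \<kappa> t z" if "z \<in> patterns F" for t z
      unfolding \<kappa>_def using \<beta>0 \<beta>1 mt_pos tt_pos[OF that] by auto
    show "(\<Sum>z\<in>patterns F. \<kappa> t z) \<le> 1" for t
    proof -
      have "(\<Sum>z\<in>patterns F. \<kappa> t z) = (\<Sum>z\<in>patterns F. (if P z = t then (1 - \<beta>) * (mt z / tt (P z)) else 0)
          + (if P z = (\<not> t) then \<beta> * (mt z / tt (P z)) else 0))"
        unfolding \<kappa>_def by (intro sum.cong refl) auto
      also have "\<dots> = (\<Sum>z\<in>{z\<in>patterns F. P z = t}. (1 - \<beta>) * (mt z / tt (P z)))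
          + (\<Sum>z\<in>{z\<in>patterns F. P z = (\<not> t)}. \<beta> * (mt z / tt (P z)))"
        by (simp only: sum.distrib sum.inter_filter[OF fin])
      also have "\<dots> = (1 - \<beta>) * (\<Sum>z\<in>{z\<in>patterns F. P z = t}. mt z / tt (P z))
          + \<beta> * (\<Sum>z\<in>{z\<in>patterns F. P z = (\<not> t)}. mt z / tt (P z))"
        by (simp only: sum_distrib_left)
      also have "\<dots> \<le> (1 - \<beta>) * 1 + \<beta> * 1"
        using \<beta>0 \<beta>1 ratio by (intro add_mono mult_left_mono) auto
      finally show ?thesis by simp
    qed
    \<comment> \<open>Conditioning on the type divides by a mass of at most \<open>exp (- h)\<close>
      and so saves \<open>h\<close>; the factor \<open>1 - \<beta>\<close> of a correct bit takes
      back \<open>h / 8\<close>.\<close>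
    show "- ln (\<kappa> t z) \<le> - ln (mt z) - 7 * h / 8 + (if P z = t then 0 else - ln \<beta>)"
      if z: "z \<in> patterns F" for t z
    proof -
      have "ln (\<kappa> t z) = ln (if P z = t then 1 - \<beta> else \<beta>) + (ln (mt z) - ln (tt (P z)))"
        unfolding \<kappa>_def using \<beta>0 \<beta>1 mt_pos[of z] tt_pos[OF z] by (auto simp: ln_mult ln_div)
      moreover have "ln (tt (P z)) \<le> - h"
        using ln_mono[OF tt_le[of "P z"] tt_pos[OF z]] unfolding exp_h[symmetric] by simp
      ultimately show ?thesis using ln1\<beta> h0 by auto
    qed
    \<comment> \<open>Mixing with the uniform distribution keeps at least the fraction
      \<open>1 - \<beta> = exp (- h / 8)\<close> of each probability, hence the excess
      \<open>h / 8\<close> over the entropy.\<close>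
    have "(\<Sum>z\<in>patterns F. - ln (mt z) * p z) \<le> (\<Sum>z\<in>patterns F. (h/8 - ln (p z)) * p z)"
    proof (rule sum_mono)
      fix z :: "'g \<Rightarrow> 'a"
      show "- ln (mt z) * p z \<le> (h/8 - ln (p z)) * p z"
      proof (cases "p z = 0")
        case False
        then have pz: "p z > 0" using p0[of z] by simp
        have "ln ((1 - \<beta>) * p z) \<le> ln (mt z)"
          using pz \<beta>1 \<beta>0 N by (intro ln_mono) (auto simp: mt_def)
        then have "- ln (mt z) \<le> h/8 - ln (p z)" using pz \<beta>1 ln1\<beta> by (simp add: ln_mult)
        then show ?thesis using pz by (intro mult_right_mono) auto
      qed simp
    qed
    also have "\<dots> = (h/8) * (\<Sum>z\<in>patterns F. p z) + shannon_entropy (marginal F \<mu>)"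
      unfolding entropy_marginal_process[OF \<mu> F] p_def[symmetric]
      by (simp add: right_diff_distrib sum_subtractf sum_distrib_left mult.commute[of _ "p _"])
    also have "(\<Sum>z\<in>patterns F. p z) = 1"
    proof -
      have d: "depends_on F (\<lambda>_::'g \<Rightarrow> 'a. 1 :: real)" by (simp add: depends_on_def)
      show ?thesis using integral_depends_on[OF F d \<mu>] by (simp add: p_def prob_space)
    qed
    finally show "(\<Sum>z\<in>patterns F. - ln (mt z) * measure \<mu> (cylinder F z)) \<le> shannon_entropy (marginal F \<mu>) + h/8"
      by (simp add: p_def)
  qed
qed

text \<open>Counts wrong bits at the price \<open>D\<close>; \<open>Q\<close> decodes the bit from a
  covering name. A point that is not covered may spoil all of \<open>S\<close>. A covered one errs
  only at bad windows and where the covering name is at distance at least \<eta>, which by Markov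
  happens at most \<open>\<delta> * card V / \<eta>\<close> times.\<close>

lemma entropy_le_covering:
  fixes \<nu> :: "('v \<Rightarrow> 'a::{finite,discrete_topology}) measure"
    and \<phi> :: "('g \<Rightarrow> 'a) \<Rightarrow> 'y::metric_space" and W :: "('v \<Rightarrow> 'y) set"
    and g :: "('g \<Rightarrow> 'a) \<Rightarrow> real" and b b1 b2 D \<delta> \<epsilon> \<eta> :: real
  assumes V: "finite V" "\<nu> \<in> prob_on V" and \<sigma>: "\<And>g v. v \<in> V \<Longrightarrow> \<sigma> g v \<in> V"
    and F: "finite F" and S: "S \<subseteq> V"
    and pos: "\<And>t z. z \<in> patterns F \<Longrightarrow> 0 < \<kappa> t z"
    and sub: "\<And>t. (\<Sum>z\<in>patterns F. \<kappa> t z) \<le> 1"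
    and code_length: "\<And>t z. z \<in> patterns F \<Longrightarrow> - ln (\<kappa> t z) \<le> g z - b + (if P z = t then 0 else D)"
    and P: "depends_on F P" and D: "D \<ge> 0" and \<eta>: "\<eta> > 0"
    and bad: "\<And>a y. dist y (\<phi> a) < \<eta> \<Longrightarrow> P a \<noteq> Q y \<Longrightarrow> bad a"
    and g_bound: "\<And>s. s \<in> S \<Longrightarrow> (\<integral>x. g (restrict (pullback_name \<sigma> s x) F) \<partial>\<nu>) \<le> b1"
    and bad_bound: "\<And>s. s \<in> S \<Longrightarrow> measure \<nu> {x \<in> space \<nu>. bad (pullback_name \<sigma> s x)} \<le> b2"
    and W: "finite W"
    and cov: "measure \<nu> {x \<in> space \<nu>. \<exists>y\<in>W. hamming_average V y (code_map V \<sigma> \<phi> x) < \<delta>} > 1 - \<epsilon>"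
    and W0: "W \<noteq> {}" and V0: "V \<noteq> {}" and \<delta>: "\<delta> \<ge> 0"
  shows "shannon_entropy (marginal (sofic_image \<sigma> F S) \<nu>)
      \<le> ln (card W) + card S * (b1 - b + D * (b2 + \<epsilon>)) + D * (\<delta> * card V / \<eta>)"
proof -
  interpret prob_space \<nu> by (rule prob_onD[OF V(2)])
  note integ = integrable_prob_on_finite[OF V]
  have cV: "card V > 0" using V(1) V0 by (simp add: card_gt_0_iff)
  define covered where "covered x \<longleftrightarrow> (\<exists>y\<in>W. hamming_average V y (code_map V \<sigma> \<phi> x) < \<delta>)" for x
  \<comment> \<open>For a point that is not covered any element of \<open>W\<close> serves: each
    window then costs at most the additional \<open>D\<close> of a wrong bit.\<close>
  define w where "w x = (if covered x then SOME y. y \<in> W \<and> hamming_average V y (code_map V \<sigma> \<phi> x) < \<delta> else SOME y. y \<in> W)" for x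
  have w: "w x \<in> W \<and> (covered x \<longrightarrow> hamming_average V (w x) (code_map V \<sigma> \<phi> x) < \<delta>)" for x
  proof (cases "covered x")
    case True
    then have "\<exists>y. y \<in> W \<and> hamming_average V y (code_map V \<sigma> \<phi> x) < \<delta>" by (auto simp: covered_def)
    from someI_ex[OF this] show ?thesis using True by (simp add: w_def)
  qed (use W0 in \<open>simp add: w_def some_in_eq\<close>)
  let ?pat = "\<lambda>s x. restrict (pullback_name \<sigma> s x) F"
  define err where "err s x \<longleftrightarrow> P (?pat s x) \<noteq> Q (w x s)" for s x
  have err_sum: "(\<Sum>s\<in>S. of_bool (err s x))
      \<le> card S * (of_bool (\<not> covered x)) + (\<Sum>s\<in>S. of_bool (bad (pullback_name \<sigma> s x))) + \<delta> * card V / \<eta>" for x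
  proof (cases "covered x")
    case False
    have "(\<Sum>s\<in>S. of_bool (err s x)) \<le> (\<Sum>s\<in>S. 1::real)" by (intro sum_mono) auto
    moreover have "0 \<le> (\<Sum>s\<in>S. of_bool (bad (pullback_name \<sigma> s x)) :: real)" by (intro sum_nonneg) auto
    moreover have "0 \<le> \<delta> * card V / \<eta>" using \<eta> \<delta> by simp
    ultimately show ?thesis using False by simp
  next
    case True
    let ?d = "\<lambda>v. dist (w x v) (code_map V \<sigma> \<phi> x v)"
    have "of_bool (err s x) \<le> of_bool (bad (pullback_name \<sigma> s x)) + ?d s / \<eta>" if "s \<in> S" for s
    proof (cases "?d s < \<eta>")
      case True
      have Peq: "P (?pat s x) = P (pullback_name \<sigma> s x)" by (rule depends_onD[OF P]) simp
      have "code_map V \<sigma> \<phi> x s = \<phi> (pullback_name \<sigma> s x)" using that S by (auto simp: code_map_def)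
      then have "err s x \<Longrightarrow> bad (pullback_name \<sigma> s x)" using True bad unfolding err_def Peq by simp
      then show ?thesis using \<eta> by auto
    next
      case False
      then have "1 \<le> ?d s / \<eta>" using \<eta> by simp
      then show ?thesis by (cases "err s x"; cases "bad (pullback_name \<sigma> s x)") auto
    qed
    then have "(\<Sum>s\<in>S. of_bool (err s x)) \<le> (\<Sum>s\<in>S. of_bool (bad (pullback_name \<sigma> s x)) + ?d s / \<eta>)"
      by (rule sum_mono)
    also have "\<dots> = (\<Sum>s\<in>S. of_bool (bad (pullback_name \<sigma> s x))) + (\<Sum>s\<in>S. ?d s) / \<eta>"
      by (simp add: sum.distrib sum_divide_distrib)
    \<comment> \<open>The Hamming distance controls only the sum over \<open>V\<close>, which could
      be concentrated on \<open>S\<close>; hence \<open>card V\<close> and not \<open>card S\<close>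
      in the bound.\<close>
    also have "(\<Sum>s\<in>S. ?d s) \<le> (\<Sum>v\<in>V. ?d v)" by (rule sum_mono2[OF V(1) S]) simp
    also have "\<dots> \<le> \<delta> * card V"
      using w[of x] True cV by (simp add: hamming_average_def divide_less_eq)
    finally show ?thesis using \<eta> True by (simp add: divide_right_mono)
  qed
  have "shannon_entropy (marginal (sofic_image \<sigma> F S) \<nu>)
      \<le> ln (card W) + (\<Sum>s\<in>S. \<integral>x. - ln (\<kappa> (Q (w x s)) (?pat s x)) \<partial>\<nu>)"
    by (rule entropy_le_code_length[OF V \<sigma> F S, where \<kappa>="\<lambda>y s. \<kappa> (Q (y s))" and w=w]) (use pos sub W w in auto)
  also have "(\<Sum>s\<in>S. \<integral>x. - ln (\<kappa> (Q (w x s)) (?pat s x)) \<partial>\<nu>)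
      \<le> (\<Sum>s\<in>S. \<integral>x. g (?pat s x) - b + D * of_bool (err s x) \<partial>\<nu>)"
  proof (intro sum_mono integral_mono integ)
    fix s x
    show "- ln (\<kappa> (Q (w x s)) (?pat s x)) \<le> g (?pat s x) - b + D * of_bool (err s x)"
      using code_length[of "?pat s x" "Q (w x s)"] by (simp add: err_def split: if_splits)
  qed
  also have "\<dots> = (\<Sum>s\<in>S. (\<integral>x. g (?pat s x) \<partial>\<nu>) - b) + D * (\<integral>x. (\<Sum>s\<in>S. of_bool (err s x)) \<partial>\<nu>)"
    by (simp add: Bochner_Integration.integral_add[OF integ integ] Bochner_Integration.integral_diff[OF integ integ]
        Bochner_Integration.integral_sum[OF integ] sum.distrib sum_distrib_left prob_space)
  also have "\<dots> \<le> (\<Sum>s\<in>S. b1 - b) + D * (\<integral>x. card S * (of_bool (\<not> covered x))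
      + (\<Sum>s\<in>S. of_bool (bad (pullback_name \<sigma> s x))) + \<delta> * card V / \<eta> \<partial>\<nu>)"
    by (intro add_mono sum_mono mult_left_mono D integral_mono integ err_sum) (simp add: g_bound)
  also have "(\<integral>x. card S * (of_bool (\<not> covered x))
      + (\<Sum>s\<in>S. of_bool (bad (pullback_name \<sigma> s x))) + \<delta> * card V / \<eta> \<partial>\<nu>)
      = card S * (\<integral>x. of_bool (\<not> covered x) \<partial>\<nu>) + (\<Sum>s\<in>S. \<integral>x. of_bool (bad (pullback_name \<sigma> s x)) \<partial>\<nu>) + \<delta> * card V / \<eta>"
    by (simp add: Bochner_Integration.integral_add[OF integ integ]
        Bochner_Integration.integral_sum[OF integ] prob_space)
  finally have total: "shannon_entropy (marginal (sofic_image \<sigma> F S) \<nu>)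
      \<le> ln (card W) + ((\<Sum>s\<in>S. b1 - b) + D * (card S * (\<integral>x. of_bool (\<not> covered x) \<partial>\<nu>)
        + (\<Sum>s\<in>S. \<integral>x. of_bool (bad (pullback_name \<sigma> s x)) \<partial>\<nu>) + \<delta> * card V / \<eta>))"
    by simp
  have int_bad: "(\<Sum>s\<in>S. \<integral>x. of_bool (bad (pullback_name \<sigma> s x)) \<partial>\<nu>) \<le> (\<Sum>s\<in>S. b2)"
  proof (rule sum_mono)
    fix s assume s: "s \<in> S"
    have "(\<integral>x. of_bool (bad (pullback_name \<sigma> s x)) \<partial>\<nu>) = (\<integral>x. indicator {x. bad (pullback_name \<sigma> s x)} x \<partial>\<nu>)"
      by (simp add: indicator_def)
    also have "\<dots> = measure \<nu> {x \<in> space \<nu>. bad (pullback_name \<sigma> s x)}"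
      by (simp add: Int_def conj_commute)
    finally show "(\<integral>x. of_bool (bad (pullback_name \<sigma> s x)) \<partial>\<nu>) \<le> b2" using bad_bound[OF s] by simp
  qed
  have int_cov: "(\<integral>x. of_bool (\<not> covered x) \<partial>\<nu>) \<le> \<epsilon>"
  proof -
    have m: "{x \<in> space \<nu>. covered x} \<in> sets \<nu>" by (auto simp: sets_prob_on_finite[OF V] prob_onD(3)[OF V(2)])
    have "(\<integral>x. of_bool (\<not> covered x) \<partial>\<nu>) = (\<integral>x. indicator {x. \<not> covered x} x \<partial>\<nu>)"
      by (simp add: indicator_def)
    also have "\<dots> = measure \<nu> (space \<nu> - {x \<in> space \<nu>. covered x})"
      by (simp add: set_diff_eq Int_def conj_commute cong: conj_cong)
    also have "\<dots> = 1 - measure \<nu> {x \<in> space \<nu>. covered x}" by (rule prob_compl[OF m])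
    finally show ?thesis using cov by (simp add: covered_def)
  qed
  have "card S * (\<integral>x. of_bool (\<not> covered x) \<partial>\<nu>)
        + (\<Sum>s\<in>S. \<integral>x. of_bool (bad (pullback_name \<sigma> s x)) \<partial>\<nu>) + \<delta> * card V / \<eta>
      \<le> card S * \<epsilon> + (\<Sum>s\<in>S. b2) + \<delta> * card V / \<eta>"
    by (intro add_mono mult_left_mono int_bad int_cov) auto
  from mult_left_mono[OF this D] total show ?thesis by (simp add: algebra_simps)
qed

text \<open>The consequence of uniform mixing that the entropy bound needs; it does not refer to a metric.\<close>

definition separated_mixing ::
  "(nat \<Rightarrow> 'v set) \<Rightarrow> (nat \<Rightarrow> 'g \<Rightarrow> 'v \<Rightarrow> 'v) \<Rightarrow> (nat \<Rightarrow> ('v \<Rightarrow> 'a::topological_space) measure) \<Rightarrow> ('g \<Rightarrow> 'a) measure \<Rightarrow> bool" where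
  "separated_mixing V \<sigma> \<mu>s \<mu> \<longleftrightarrow> (\<forall>F e. finite F \<and> e > 0 \<longrightarrow> (\<exists>c>0. \<forall>U. density_one V U \<longrightarrow>
      (\<forall>\<^sub>F n in sequentially. \<exists>S\<subseteq>{v\<in>V n. U n v}. c * real (card (V n)) \<le> real (card S) \<and>
        card S * (shannon_entropy (marginal F \<mu>) - e) \<le> shannon_entropy (marginal (sofic_image (\<sigma> n) F S) (\<mu>s n)))))"

text \<open>The image of the finite space of models is itself a finite covering set, so the
  \<open>LEAST\<close> in the covering number is attained.\<close>

lemma covering_number_factor:
  fixes \<nu> :: "('v \<Rightarrow> 'a::{finite,discrete_topology}) measure"
    and \<phi> :: "('g \<Rightarrow> 'a) \<Rightarrow> 'y::{metric_space,second_countable_topology}"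
  assumes V: "finite V" "\<nu> \<in> prob_on V" and "\<epsilon> > 0" "\<delta> > 0"
  obtains W where "finite W"
    "card W = covering_number \<epsilon> \<delta> V (distr \<nu> (PiM V (\<lambda>_. borel)) (code_map V \<sigma> \<phi>))"
    "measure \<nu> {x \<in> space \<nu>. \<exists>y\<in>W. hamming_average V y (code_map V \<sigma> \<phi> x) < \<delta>} > 1 - \<epsilon>"
proof -
  interpret prob_space \<nu> by (rule prob_onD[OF V(2)])
  define \<eta> where "\<eta> = distr \<nu> (PiM V (\<lambda>_. borel)) (code_map V \<sigma> \<phi>)"
  have code_meas: "code_map V \<sigma> \<phi> \<in> \<nu> \<rightarrow>\<^sub>M PiM V (\<lambda>_. borel)"
    by (rule measurable_prob_on_finite[OF V]) (simp add: code_map_def space_PiM)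
  have sp: "space \<eta> = PiE V (\<lambda>_. UNIV)" by (simp add: \<eta>_def space_PiM)
  have meas_eq: "measure \<eta> {y \<in> space \<eta>. \<exists>x\<in>W. hamming_average V x y < \<delta>}
      = measure \<nu> {x \<in> space \<nu>. \<exists>y\<in>W. hamming_average V y (code_map V \<sigma> \<phi> x) < \<delta>}" if "finite W" for W
  proof -
    have "(\<lambda>y. hamming_average V x y) \<in> borel_measurable (PiM V (\<lambda>_. borel))" for x :: "'v \<Rightarrow> 'y"
      unfolding hamming_average_def by measurable
    then have "{y \<in> space (PiM V (\<lambda>_. borel)). \<exists>x\<in>W. hamming_average V x y < \<delta>} \<in> sets (PiM V (\<lambda>_. borel))"
      using that by measurable
    then show ?thesis unfolding \<eta>_def
      by (subst measure_distr[OF code_meas])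
        (auto intro!: arg_cong[where f="measure \<nu>"] dest: measurable_space[OF code_meas])
  qed
  define Z where "Z = code_map V \<sigma> \<phi> ` patterns V"
  define ok where "ok j \<longleftrightarrow> (\<exists>W. W \<subseteq> space \<eta> \<and> finite W \<and> card W = j \<and>
      measure \<eta> {y \<in> space \<eta>. \<exists>x\<in>W. hamming_average V x y < \<delta>} > 1 - \<epsilon>)" for j
  have "finite Z" unfolding Z_def using finite_patterns[OF V(1)] by blast
  moreover have "Z \<subseteq> space \<eta>" by (auto simp: Z_def sp code_map_def)
  moreover have "{x \<in> space \<nu>. \<exists>y\<in>Z. hamming_average V y (code_map V \<sigma> \<phi> x) < \<delta>} = space \<nu>"
  proof -
    have "hamming_average V y y < \<delta>" for y :: "'v \<Rightarrow> 'y" using \<open>\<delta> > 0\<close> by (simp add: hamming_average_def)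
    then show ?thesis unfolding Z_def prob_onD(3)[OF V(2)] by blast
  qed
  ultimately have "ok (card Z)" unfolding ok_def using meas_eq[of Z] \<open>\<epsilon> > 0\<close> prob_space by auto
  then have "ok (LEAST j. ok j)" by (rule LeastI)
  then have "ok (covering_number \<epsilon> \<delta> V \<eta>)" unfolding covering_number_def ok_def .
  then obtain W where "finite W" "card W = covering_number \<epsilon> \<delta> V \<eta>"
      "measure \<eta> {y \<in> space \<eta>. \<exists>x\<in>W. hamming_average V x y < \<delta>} > 1 - \<epsilon>"
    unfolding ok_def by blast
  then show thesis using meas_eq[of W] that unfolding \<eta>_def by auto
qed

text \<open>The order of choices matters: first the window \<open>F\<close> with \<open>P\<close>
  and \<kappa>, then the width \<eta>, then the density \<open>c\<close> supplied by mixing, and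
  last \<delta>. The maps \<open>\<phi> m\<close> enter only for large \<open>m\<close>. All losses
  are measured in fractions of \<open>h\<close>.\<close>

lemma positive_entropy_if_mixing:
  fixes \<mu> :: "('g::{group_add,countable} \<Rightarrow> 'a::{finite,discrete_topology,second_countable_topology}) measure"
    and \<psi> :: "('g \<Rightarrow> 'a) \<Rightarrow> 'y::{metric_space, second_countable_topology}"
    and V :: "nat \<Rightarrow> 'v set"
  assumes proc: "process \<mu>" and sofic: "sofic_approximation V \<sigma>"
    and \<mu>s: "\<And>n. \<mu>s n \<in> prob_on (V n)" and conv: "local_empirical_convergence V \<sigma> \<mu>s \<mu>"
    and mixing: "separated_mixing V \<sigma> \<mu>s \<mu>"
    and \<psi>[measurable]: "\<psi> \<in> borel \<rightarrow>\<^sub>M borel" and cpt: "compact (UNIV :: 'y set)"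
    and nontriv: "\<nexists>y. distr \<mu> borel (equivariant_map \<psi>) = return borel y"
  shows "lower_model_measure_entropy V \<sigma> (distr \<mu> borel (equivariant_map \<psi>)) > 0"
proof -
  note V = sofic_approximationD[OF sofic]
  have \<sigma>: "\<sigma> n g v \<in> V n" if "v \<in> V n" for n g v using permutes_in_image[OF V(3)] that by metis
  have \<mu>: "\<mu> \<in> borel_prob" using proc by (simp add: process_def)
  interpret \<mu>: prob_space \<mu> using \<mu> by (rule borel_probD)
  note sets\<mu>[measurable_cong] = borel_probD(2)[OF \<mu>]
  obtain B where B: "closed B" "0 < measure \<mu> {a. \<psi> a \<in> B}" "measure \<mu> {a. \<psi> a \<in> B} < 1"
    by (rule factor_nontrivial_closed_set[OF proc \<psi> nontriv])
  have B0: "B \<noteq> {}" using B(2) by auto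
  have [measurable]: "B \<in> sets borel" using B(1) by (rule borel_closed)
  have [measurable]: "(\<lambda>a. infdist (\<psi> a) B) \<in> borel_measurable borel"
    by (rule measurable_compose[OF \<psi>], rule borel_measurable_continuous_onI)
      (intro continuous_intros)
  \<comment> \<open>Half the distance of the measure from 0 and 1; the other half is left to the
    error of the local event \<open>P\<close>.\<close>
  define \<tau> where "\<tau> = min (measure \<mu> {a. \<psi> a \<in> B}) (1 - measure \<mu> {a. \<psi> a \<in> B}) / 2"
  have \<tau>0: "\<tau> > 0" and \<tau>1: "2 * \<tau> \<le> measure \<mu> {a. \<psi> a \<in> B}" "measure \<mu> {a. \<psi> a \<in> B} \<le> 1 - 2 * \<tau>"
    using B by (auto simp: \<tau>_def)
  define h where "h = - ln (1 - \<tau>/2)"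
  have h0: "h > 0" using \<tau>0 \<tau>1 by (simp add: h_def)
  define \<beta> where "\<beta> = 1 - exp (- h/8)"
  have \<beta>0: "0 < \<beta>" and \<beta>1: "\<beta> < 1" using h0 by (simp_all add: \<beta>_def)
  define D where "D = - ln \<beta>"
  have D0: "D > 0" using \<beta>0 \<beta>1 by (simp add: D_def)
  \<comment> \<open>With a wrong bit costing \<open>D\<close>, an error of probability \<gamma>
    costs \<open>h / 16\<close>.\<close>
  define \<gamma> where "\<gamma> = h / (16 * D)"
  have \<gamma>0: "\<gamma> > 0" using h0 D0 by (simp add: \<gamma>_def)
  have D\<gamma>: "D * \<gamma> = h / 16" using D0 by (simp add: \<gamma>_def)
  have "{a. \<psi> a \<in> B} \<in> sets borel" using measurable_sets[OF \<psi>, of B] by (simp add: vimage_def)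
  from approximate_by_local_set[OF \<mu> this, of "min (\<gamma>/4) \<tau>"] \<gamma>0 \<tau>0
  obtain F P where F: "finite F" and P: "depends_on F P"
    and P_err: "measure \<mu> {a. (\<psi> a \<in> B) \<noteq> P a} < \<gamma>/4" "measure \<mu> {a. (\<psi> a \<in> B) \<noteq> P a} < \<tau>" by auto
  have [measurable]: "Measurable.pred borel P"
    using measurable_depends_on[OF F P] by simp
  have meas: "{a. R a} \<in> sets \<mu>" if "Measurable.pred borel R" for R
    using that by (simp add: pred_def sets\<mu>)
  have ms: "{a. P a} \<in> sets \<mu>" "{a. \<psi> a \<in> B} \<in> sets \<mu>" "{a. (\<psi> a \<in> B) \<noteq> P a} \<in> sets \<mu>"
    by (rule meas, measurable)+
  have P_range: "\<tau> \<le> measure \<mu> {a. P a}" "measure \<mu> {a. P a} \<le> 1 - \<tau>"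
  proof -
    have "measure \<mu> {a. \<psi> a \<in> B} \<le> measure \<mu> ({a. P a} \<union> {a. (\<psi> a \<in> B) \<noteq> P a})"
      by (intro \<mu>.finite_measure_mono sets.Un ms) auto
    also have "\<dots> \<le> measure \<mu> {a. P a} + measure \<mu> {a. (\<psi> a \<in> B) \<noteq> P a}"
      by (intro measure_Un_le ms)
    finally show "\<tau> \<le> measure \<mu> {a. P a}" using P_err \<tau>1 by linarith
    have "measure \<mu> {a. P a} \<le> measure \<mu> ({a. \<psi> a \<in> B} \<union> {a. (\<psi> a \<in> B) \<noteq> P a})"
      by (intro \<mu>.finite_measure_mono sets.Un ms) auto
    also have "\<dots> \<le> measure \<mu> {a. \<psi> a \<in> B} + measure \<mu> {a. (\<psi> a \<in> B) \<noteq> P a}"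
      by (intro measure_Un_le ms)
    finally show "measure \<mu> {a. P a} \<le> 1 - \<tau>" using P_err \<tau>1 by linarith
  qed
  obtain \<kappa> g where \<kappa>: "\<And>t z. z \<in> patterns F \<Longrightarrow> 0 < \<kappa> t z"
    "\<And>t. (\<Sum>z\<in>patterns F. \<kappa> t z) \<le> 1"
    "\<And>t z. z \<in> patterns F \<Longrightarrow> - ln (\<kappa> t z) \<le> g z - 7 * h / 8 + (if P z = t then 0 else D)"
    and g: "(\<Sum>z\<in>patterns F. g z * measure \<mu> (cylinder F z)) \<le> shannon_entropy (marginal F \<mu>) + h/8"
    unfolding D_def by (rule binary_code_kernel[OF \<mu> F P \<tau>0 P_range h_def \<beta>_def]) blast
  \<comment> \<open>As \<open>B\<close> is closed, the shells around it decrease to the empty set.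
    The width \<open>4 * \<eta>\<close> leaves room for two successive errors of size \<eta>, from
    \<psi> to \<open>\<phi> m\<close> and from there to the covering name, with the decision at
    \<open>2 * \<eta>\<close>.\<close>
  obtain \<eta> where \<eta>: "\<eta> > 0" "measure \<mu> {a. \<psi> a \<notin> B \<and> infdist (\<psi> a) B < 4 * \<eta>} < \<gamma>/4"
  proof -
    define A where "A j = {a. \<psi> a \<notin> B \<and> infdist (\<psi> a) B < 4 * (1 / (real j + 1))}" for j
    have Am: "A j \<in> sets \<mu>" for j unfolding A_def by (intro meas) measurable
    have "decseq A" unfolding A_def
    proof (intro decseq_SucI subsetI CollectI conjI)
      fix j a assume a: "a \<in> {a. \<psi> a \<notin> B \<and> infdist (\<psi> a) B < 4 * (1 / (real (Suc j) + 1))}"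
      then show "\<psi> a \<notin> B" by simp
      have "4 * (1 / (real (Suc j) + 1)) \<le> 4 * (1 / (real j + 1))" by (simp add: field_simps)
      then show "infdist (\<psi> a) B < 4 * (1 / (real j + 1))" using a by simp
    qed
    then have "(\<lambda>j. measure \<mu> (A j)) \<longlonglongrightarrow> measure \<mu> (\<Inter>j. A j)"
      by (intro \<mu>.finite_Lim_measure_decseq) (auto simp: Am)
    also have "(\<Inter>j. A j) = {}"
    proof (rule equals0I)
      fix a assume a: "a \<in> (\<Inter>j. A j)"
      then have "\<psi> a \<notin> B" by (auto simp: A_def)
      then have "infdist (\<psi> a) B > 0" using B(1) B0 infdist_pos_not_in_closed by blast
      moreover have "(\<lambda>j. 4 * (1 / (real j + 1))) \<longlonglongrightarrow> 0" by real_asymp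
      ultimately have "\<forall>\<^sub>F j in sequentially. 4 * (1 / (real j + 1)) < infdist (\<psi> a) B" by (intro order_tendstoD)
      then obtain j where "4 * (1 / (real j + 1)) < infdist (\<psi> a) B" by (auto simp: eventually_sequentially)
      then show False using a unfolding A_def INT_iff by (auto dest!: spec[of _ j])
    qed
    finally have "\<forall>\<^sub>F j in sequentially. measure \<mu> (A j) < \<gamma>/4" using \<gamma>0 by (intro order_tendstoD) auto
    then obtain j where "measure \<mu> (A j) < \<gamma>/4" by (auto simp: eventually_sequentially)
    then show thesis by (intro that[of "1 / (real j + 1)"]) (auto simp: A_def)
  qed
  obtain c where c: "c > 0" and mix: "\<And>U. density_one V U \<Longrightarrow>
      \<forall>\<^sub>F n in sequentially. \<exists>S\<subseteq>{v\<in>V n. U n v}. c * real (card (V n)) \<le> real (card S) \<and>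
        card S * (shannon_entropy (marginal F \<mu>) - h/8) \<le> shannon_entropy (marginal (sofic_image (\<sigma> n) F S) (\<mu>s n))"
    using mixing[unfolded separated_mixing_def, THEN spec, THEN spec, of F "h/8"] F h0 by auto
  obtain \<phi> :: "nat \<Rightarrow> ('g \<Rightarrow> 'a) \<Rightarrow> 'y" and K k U where
    K: "\<And>m. finite (K m)" and \<phi>: "\<And>m. depends_on (K m) (\<phi> m)"
      "\<And>m. measure \<mu> {a. (1/2)^m \<le> dist (\<phi> m a) (\<psi> a)} < (1/2)^m"
    and K_ex: "\<And>g. \<forall>\<^sub>F m in sequentially. g \<in> K m"
    and k: "filterlim k at_top sequentially" and U: "density_one V U"
    and U_nbhd: "\<forall>\<^sub>F n in sequentially. \<forall>v\<in>V n. U n v \<longrightarrow> distr (\<mu>s n) borel (pullback_name (\<sigma> n) v)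
       \<in> cylinder_nbhd (K (k n)) (1 / (real (k n) + 1)) \<mu>"
    and \<nu>_conv: "local_empirical_convergence V \<sigma>
       (\<lambda>n. distr (\<mu>s n) (PiM (V n) (\<lambda>_. borel)) (code_map (V n) (\<sigma> n) (\<phi> (k n))))
       (distr \<mu> borel (equivariant_map \<psi>))"
    by (rule factor_models[OF proc sofic \<mu>s conv \<psi> cpt]) blast
  define \<nu> where "\<nu> n = distr (\<mu>s n) (PiM (V n) (\<lambda>_. borel)) (code_map (V n) (\<sigma> n) (\<phi> (k n)))" for n
  have \<nu>: "\<nu> n \<in> prob_on (V n)" for n unfolding \<nu>_def by (rule factor_prob_on[OF V(1) \<mu>s])
  have [measurable]: "\<phi> m \<in> borel \<rightarrow>\<^sub>M borel" for m by (rule borel_measurable_depends_on[OF K \<phi>(1)])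
  \<comment> \<open>The cap at 1/2 keeps \<epsilon> below 1, so that a covering set cannot be
    empty.\<close>
  define \<epsilon> where "\<epsilon> = min \<gamma> (1/2)"
  \<comment> \<open>The separated set has at least \<open>c * card (V n)\<close> elements, so even a
    Hamming error that falls entirely on it causes wrong bits on at most a fraction
    \<gamma>.\<close>
  define \<delta> where "\<delta> = c * \<eta> * \<gamma>"
  have \<epsilon>0: "\<epsilon> > 0" "\<epsilon> \<le> \<gamma>" "\<epsilon> < 1" and \<delta>0: "\<delta> > 0" using \<gamma>0 c \<eta> by (auto simp: \<epsilon>_def \<delta>_def)

  define g' where "g' a = g (restrict a F)" for a
  have g'_dep: "depends_on F g'" unfolding depends_on_def g'_def
  proof (intro allI impI)
    fix a a' :: "'g \<Rightarrow> 'a" assume "\<forall>i\<in>F. a i = a' i"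
    then have "restrict a F = restrict a' F" by (intro restrict_ext) auto
    then show "g (restrict a F) = g (restrict a' F)" by simp
  qed
  define G where "G = Max ((\<lambda>z. \<bar>g z\<bar>) ` patterns F)"
  have g'_G: "\<bar>g' a\<bar> \<le> G" for a
    unfolding G_def g'_def using finite_patterns[OF F] by (intro Max_ge) auto
  have g'_int: "(\<integral>a. g' a \<partial>\<mu>) \<le> shannon_entropy (marginal F \<mu>) + h/8"
  proof -
    have "(\<integral>a. g' a \<partial>\<mu>) = (\<Sum>z\<in>patterns F. g' z * measure \<mu> (cylinder F z))"
      by (rule integral_depends_on[OF F g'_dep \<mu>])
    also have "\<dots> = (\<Sum>z\<in>patterns F. g z * measure \<mu> (cylinder F z))"
      by (intro sum.cong refl) (simp add: g'_def PiE_restrict)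
    finally show ?thesis using g by simp
  qed

  \<comment> \<open>Let \<open>y\<close> be within \<eta> of \<open>\<phi> m a\<close>. Outside the
    bad event its distance from \<open>B\<close> is below \<open>2 * \<eta>\<close> if
    \<open>P a\<close>, and above it otherwise, because \<open>infdist\<close> is
    1-Lipschitz.\<close>
  define Q where "Q y \<longleftrightarrow> infdist y B < 2 * \<eta>" for y
  define bad where "bad m a \<longleftrightarrow> (P a \<and> \<eta> \<le> infdist (\<phi> m a) B) \<or> (\<not> P a \<and> infdist (\<phi> m a) B < 3 * \<eta>)" for m a
  have bad_dep: "depends_on (K m) (bad m)" if "F \<subseteq> K m" for m
    unfolding bad_def[abs_def]
    by (rule depends_on_compose2[OF depends_on_mono[OF P that] \<phi>(1),
        of "\<lambda>p y. (p \<and> \<eta> \<le> infdist y B) \<or> (\<not> p \<and> infdist y B < 3 * \<eta>)"])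
  have bad_Q: "bad m a" if "dist y (\<phi> m a) < \<eta>" "P a \<noteq> Q y" for m a y
    using that infdist_triangle[of y B "\<phi> m a"] infdist_triangle[of "\<phi> m a" B y]
    unfolding bad_def Q_def by (auto simp: dist_commute)
  \<comment> \<open>The three exceptional sets have measures below \<open>\<gamma> / 4\<close>,
    \<open>\<gamma> / 4\<close> and \<open>\<gamma> / 2\<close>.\<close>
  have bad_small: "measure \<mu> {a. bad m a} \<le> \<gamma>" if m: "(1/2)^m \<le> \<eta>" "(1/2::real)^m \<le> \<gamma>/2" for m
  proof -
    let ?A1 = "{a. (\<psi> a \<in> B) \<noteq> P a}" and ?A2 = "{a. \<psi> a \<notin> B \<and> infdist (\<psi> a) B < 4 * \<eta>}"
      and ?A3 = "{a. (1/2)^m \<le> dist (\<phi> m a) (\<psi> a)}"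
    have ms': "?A1 \<in> sets \<mu>" "?A2 \<in> sets \<mu>" "?A3 \<in> sets \<mu>"
      by (intro meas; measurable)+
    have "{a. bad m a} \<subseteq> ?A1 \<union> ?A2 \<union> ?A3"
    proof (intro subsetI)
      fix a assume "a \<in> {a. bad m a}"
      then have b: "bad m a" by simp
      show "a \<in> ?A1 \<union> ?A2 \<union> ?A3"
      proof (rule ccontr)
        assume "a \<notin> ?A1 \<union> ?A2 \<union> ?A3"
        then have *: "(\<psi> a \<in> B) = P a" "\<psi> a \<notin> B \<Longrightarrow> 4 * \<eta> \<le> infdist (\<psi> a) B" "dist (\<phi> m a) (\<psi> a) < \<eta>"
          using m(1) by (auto simp: not_le not_less)
        show False
        proof (cases "P a")
          case True
          then have "infdist (\<psi> a) B = 0" using * by simp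
          then show ?thesis using b True *(3) infdist_triangle[of "\<phi> m a" B "\<psi> a"] by (simp add: bad_def)
        next
          case False
          then show ?thesis using b * infdist_triangle[of "\<psi> a" B "\<phi> m a"] by (auto simp: bad_def dist_commute)
        qed
      qed
    qed
    then have "measure \<mu> {a. bad m a} \<le> measure \<mu> (?A1 \<union> ?A2 \<union> ?A3)"
      using ms' by (intro \<mu>.finite_measure_mono sets.Un)
    also have "\<dots> \<le> measure \<mu> (?A1 \<union> ?A2) + measure \<mu> ?A3" using ms' by (intro measure_Un_le sets.Un)
    also have "measure \<mu> (?A1 \<union> ?A2) \<le> measure \<mu> ?A1 + measure \<mu> ?A2" using ms' by (intro measure_Un_le)
    finally show ?thesis using P_err(1) \<eta>(2) \<phi>(2)[of m] m(2) by linarith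
  qed

  have ev_m: "\<forall>\<^sub>F m in sequentially. F \<subseteq> K m \<and> (1/2)^m \<le> \<eta> \<and> (1/2::real)^m \<le> \<gamma>/2
      \<and> 1 / (real m + 1) * G \<le> h/8 \<and> 1 / (real m + 1) \<le> \<gamma>"
  proof (intro eventually_conj)
    have "\<forall>\<^sub>F m in sequentially. \<forall>g\<in>F. g \<in> K m" using F K_ex by (simp add: eventually_ball_finite)
    then show "\<forall>\<^sub>F m in sequentially. F \<subseteq> K m" by (simp add: subset_eq)
    have p: "(\<lambda>m. (1/2::real)^m) \<longlonglongrightarrow> 0" by (rule LIMSEQ_realpow_zero) auto
    show "\<forall>\<^sub>F m in sequentially. (1/2)^m \<le> \<eta>" using order_tendstoD(2)[OF p \<eta>(1)] by eventually_elim simp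
    show "\<forall>\<^sub>F m in sequentially. (1/2::real)^m \<le> \<gamma>/2"
      using order_tendstoD(2)[OF p, of "\<gamma>/2"] \<gamma>0 by (auto elim: eventually_mono)
    have "(\<lambda>m. 1 / (real m + 1) * G) \<longlonglongrightarrow> 0" by real_asymp
    moreover have "0 < h/8" using h0 by simp
    ultimately have "\<forall>\<^sub>F m in sequentially. 1 / (real m + 1) * G < h/8" by (rule order_tendstoD)
    then show "\<forall>\<^sub>F m in sequentially. 1 / (real m + 1) * G \<le> h/8" by (rule eventually_mono) (rule less_imp_le)
    have "(\<lambda>m. 1 / (real m + 1)) \<longlonglongrightarrow> 0" by real_asymp
    from order_tendstoD(2)[OF this \<gamma>0] show "\<forall>\<^sub>F m in sequentially. 1 / (real m + 1) \<le> \<gamma>"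
      by (rule eventually_mono) (rule less_imp_le)
  qed
  have bound: "\<forall>\<^sub>F n in sequentially. ereal (c * h / 4)
      \<le> log_card (covering_number \<epsilon> \<delta> (V n) (\<nu> n)) / ereal (real (card (V n)))"
    using eventually_compose_filterlim[OF ev_m k] U_nbhd mix[OF U] V(4)
  proof eventually_elim
    case (elim n)
    define m where "m = k n"
    have m: "F \<subseteq> K m" "(1/2)^m \<le> \<eta>" "(1/2::real)^m \<le> \<gamma>/2" "1 / (real m + 1) * G \<le> h/8" "1 / (real m + 1) \<le> \<gamma>"
      using elim(1) by (auto simp: m_def)
    have nbhd: "distr (\<mu>s n) borel (pullback_name (\<sigma> n) v)
        \<in> cylinder_nbhd (K m) (1 / (real m + 1)) \<mu>"
      if "v \<in> V n" "U n v" for v using elim(2) that by (simp add: m_def)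
    obtain S where S: "S \<subseteq> {v\<in>V n. U n v}" "c * real (card (V n)) \<le> real (card S)"
        "card S * (shannon_entropy (marginal F \<mu>) - h/8) \<le> shannon_entropy (marginal (sofic_image (\<sigma> n) F S) (\<mu>s n))"
      using elim(3) by blast
    have cV: "card (V n) > 0" using elim(4) V(1) by (simp add: card_gt_0_iff)
    interpret \<mu>n: prob_space "\<mu>s n" by (rule prob_onD[OF \<mu>s])
    obtain W where W: "finite W" "card W = covering_number \<epsilon> \<delta> (V n) (\<nu> n)"
      "measure (\<mu>s n) {x \<in> space (\<mu>s n). \<exists>y\<in>W. hamming_average (V n) y (code_map (V n) (\<sigma> n) (\<phi> m) x) < \<delta>} > 1 - \<epsilon>"
      unfolding \<nu>_def m_def by (rule covering_number_factor[OF V(1) \<mu>s \<epsilon>0(1) \<delta>0])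
    have W0: "W \<noteq> {}" using W(3) \<epsilon>0(3) by auto
    have pm: "pullback_name (\<sigma> n) v \<in> \<mu>s n \<rightarrow>\<^sub>M borel" for v
      by (rule measurable_prob_on_finite[OF V(1) \<mu>s]) simp
    \<comment> \<open>The \<open>h / 4\<close> is \<open>h / 8\<close> from the kernel plus
      \<open>h / 8\<close> for replacing \<mu> by the local law; likewise the bad event gets one
      \<gamma> from \<mu> and one from the local law.\<close>
    have "shannon_entropy (marginal (sofic_image (\<sigma> n) F S) (\<mu>s n))
      \<le> ln (card W) + card S * ((shannon_entropy (marginal F \<mu>) + h/4) - 7 * h / 8 + D * (2 * \<gamma> + \<epsilon>)) + D * (\<delta> * card (V n) / \<eta>)"
    proof (rule entropy_le_covering[OF V(1) \<mu>s \<sigma> F _ \<kappa>(1,2) _ P less_imp_le[OF D0] \<eta>(1) _ _ _ W(1,3) W0 elim(4) less_imp_le[OF \<delta>0]])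
      show "S \<subseteq> V n" using S by auto
      show "- ln (\<kappa> t z) \<le> g z - 7 * h / 8 + (if P z = t then 0 else D)" if "z \<in> patterns F" for t z
        by (rule \<kappa>(3)[OF that])
      show "bad m a" if "dist y (\<phi> m a) < \<eta>" "P a \<noteq> Q y" for a y by (rule bad_Q[OF that])
      fix s assume s: "s \<in> S"
      then have nb: "distr (\<mu>s n) borel (pullback_name (\<sigma> n) s)
        \<in> cylinder_nbhd (K m) (1 / (real m + 1)) \<mu>"
        using S nbhd by auto
      have "\<bar>(\<integral>a. g' a \<partial>distr (\<mu>s n) borel (pullback_name (\<sigma> n) s)) - (\<integral>a. g' a \<partial>\<mu>)\<bar> \<le>
         1 / (real m + 1) * G"
        by (rule cylinder_nbhd_integral[OF K depends_on_mono[OF g'_dep m(1)] \<mu> nb g'_G])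
      also have "\<dots> \<le> h/8" by (rule m(4))
      finally have "(\<integral>a. g' a \<partial>distr (\<mu>s n) borel (pullback_name (\<sigma> n) s)) \<le> shannon_entropy (marginal F \<mu>) + h/4"
        using g'_int by linarith
      also have "(\<integral>a. g' a \<partial>distr (\<mu>s n) borel (pullback_name (\<sigma> n) s)) = (\<integral>x. g' (pullback_name (\<sigma> n) s x) \<partial>\<mu>s n)"
        by (rule integral_distr[OF pm borel_measurable_depends_on[OF F g'_dep]])
      finally show "(\<integral>x. g (restrict (pullback_name (\<sigma> n) s x) F) \<partial>\<mu>s n) \<le> shannon_entropy (marginal F \<mu>) + h/4"
        by (simp add: g'_def)
      have "\<bar>measure (distr (\<mu>s n) borel (pullback_name (\<sigma> n) s)) {a. bad m a} - measure \<mu> {a. bad m a}\<bar>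
        \<le> 1 / (real m + 1)"
        by (rule cylinder_nbhd_measure[OF K bad_dep[OF m(1)] \<mu> nb])
      then have "measure (distr (\<mu>s n) borel (pullback_name (\<sigma> n) s)) {a. bad m a} \<le> 2 * \<gamma>"
        using bad_small[OF m(2,3)] m(5) by linarith
      also have "measure (distr (\<mu>s n) borel (pullback_name (\<sigma> n) s)) {a. bad m a}
          = measure (\<mu>s n) (pullback_name (\<sigma> n) s -` {a. bad m a} \<inter> space (\<mu>s n))"
        by (rule measure_distr[OF pm sets_depends_on[OF K bad_dep[OF m(1)]]])
      also have "pullback_name (\<sigma> n) s -` {a. bad m a} \<inter> space (\<mu>s n) = {x \<in> space (\<mu>s n). bad m (pullback_name (\<sigma> n) s x)}"
        by auto
      finally show "measure (\<mu>s n) {x \<in> space (\<mu>s n). bad m (pullback_name (\<sigma> n) s x)} \<le> 2 * \<gamma>" .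
    qed
    also have "D * (\<delta> * card (V n) / \<eta>) = (h / 16) * (c * card (V n))"
      using \<eta>(1) D\<gamma> by (simp add: \<delta>_def mult_ac)
    also have "\<dots> \<le> (h / 16) * card S" using S(2) h0 by (intro mult_left_mono) auto
    also have "D * (2 * \<gamma> + \<epsilon>) \<le> 3 * h / 16"
    proof -
      have "D * (2 * \<gamma> + \<epsilon>) \<le> D * (3 * \<gamma>)" using \<epsilon>0(2) D0 by (intro mult_left_mono) auto
      then show ?thesis using D\<gamma> by simp
    qed
    then have "card S * ((shannon_entropy (marginal F \<mu>) + h/4) - 7 * h / 8 + D * (2 * \<gamma> + \<epsilon>))
        \<le> card S * ((shannon_entropy (marginal F \<mu>) + h/4) - 7 * h / 8 + 3 * h / 16)"
      by (intro mult_left_mono) auto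
    \<comment> \<open>With \<open>H\<close> the entropy of the marginal, the cost for each window is
      at most \<open>H + h/4 - 7*h/8 + 3*h/16 + h/16 = H - 3*h/8\<close>, against at least
      \<open>H - h/8\<close> from mixing. The difference \<open>h/4\<close> is left for
      \<open>ln (card W)\<close>.\<close>
    finally have "card S * (h / 4) \<le> ln (card W)" using S(3) by (simp add: algebra_simps)
    moreover have "c * card (V n) * (h / 4) \<le> card S * (h/4)" using S(2) h0 by (intro mult_right_mono) auto
    ultimately have "c * h / 4 * card (V n) \<le> ln (card W)" by (simp add: mult_ac)
    then have "c * h / 4 \<le> ln (card W) / card (V n)" using cV by (simp add: pos_le_divide_eq)
    moreover have "card W \<noteq> 0" using W0 W(1) by simp
    ultimately show ?case using cV by (simp add: W(2)[symmetric] log_card_def)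
  qed
  have "0 < ereal (c * h / 4)" using c h0 by simp
  also have "\<dots> \<le> liminf (\<lambda>n. log_card (covering_number \<epsilon> \<delta> (V n) (\<nu> n)) / ereal (real (card (V n))))"
    using bound by (rule Liminf_bounded)
  also have "\<dots> \<le> (SUP (\<epsilon>, \<delta>) \<in> {0<..} \<times> {0<..}.
      liminf (\<lambda>n. log_card (covering_number \<epsilon> \<delta> (V n) (\<nu> n)) / ereal (real (card (V n)))))"
    by (rule SUP_upper2[of "(\<epsilon>, \<delta>)"]) (use \<epsilon>0 \<delta>0 in auto)
  also have "\<dots> \<le> lower_model_measure_entropy V \<sigma> (distr \<mu> borel (equivariant_map \<psi>))"
    unfolding lower_model_measure_entropy_def
    by (rule SUP_upper) (use \<nu> \<nu>_conv in \<open>auto simp: \<nu>_def\<close>)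
  finally show ?thesis .
qed

section \<open>Mixing over infinite groups\<close>

text \<open>Greedy selection: each chosen vertex discards at most \<open>D\<close> vertices, itself
  included.\<close>

lemma separated_subset_greedy:
  assumes "finite A" "\<And>v. N v v" "\<And>v w. N v w \<Longrightarrow> N w v" "\<And>v. v \<in> A \<Longrightarrow> card {w \<in> A. N v w} \<le> D"
  shows "\<exists>S\<subseteq>A. (\<forall>v\<in>S. \<forall>w\<in>S. v \<noteq> w \<longrightarrow> \<not> N v w) \<and> card A \<le> D * card S"
  using assms(1,4)
proof (induction A rule: finite_psubset_induct)
  case (psubset A)
  show ?case
  proof (cases "A = {}")
    case False
    then obtain a where a: "a \<in> A" by blast
    define A' where "A' = A - {w. N a w}"
    have sub: "A' \<subset> A" using a assms(2)[of a] by (auto simp: A'_def)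
    have "card {w \<in> A'. N v w} \<le> D" if "v \<in> A'" for v
    proof -
      have "card {w \<in> A'. N v w} \<le> card {w \<in> A. N v w}"
        using psubset.hyps sub by (intro card_mono) auto
      also have "\<dots> \<le> D" using that sub by (intro psubset.prems) blast
      finally show ?thesis .
    qed
    then obtain S where S: "S \<subseteq> A'" "\<forall>v\<in>S. \<forall>w\<in>S. v \<noteq> w \<longrightarrow> \<not> N v w" "card A' \<le> D * card S"
      using psubset.IH[OF sub] by blast
    have aS: "a \<notin> S" using S(1) assms(2)[of a] by (auto simp: A'_def)
    have "finite S" using S(1) sub psubset.hyps by (meson finite_subset psubset_imp_subset)
    have "A = A' \<union> {w \<in> A. N a w}" by (auto simp: A'_def)
    then have "card A \<le> card A' + card {w \<in> A. N a w}" by (metis card_Un_le)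
    also have "\<dots> \<le> D * card S + D" using S(3) psubset.prems[OF a] by simp
    also have "\<dots> = D * card (insert a S)" using aS \<open>finite S\<close> by simp
    finally have "card A \<le> D * card (insert a S)" .
    moreover have "\<forall>v\<in>insert a S. \<forall>w\<in>insert a S. v \<noteq> w \<longrightarrow> \<not> N v w"
    proof -
      have "\<not> N a w" if "w \<in> S" for w using S(1) that by (auto simp: A'_def)
      then show ?thesis using S(2) assms(3) by blast
    qed
    moreover have "insert a S \<subseteq> A" using a S(1) sub by auto
    ultimately show ?thesis by blast
  qed auto
qed

lemma density_one_eventually_ge:
  fixes \<theta> :: real
  assumes "density_one V P" "\<forall>\<^sub>F n in sequentially. V n \<noteq> {}" "\<And>n. finite (V n)" "\<theta> < 1"
  shows "\<forall>\<^sub>F n in sequentially. \<theta> * card (V n) \<le> card {v \<in> V n. P n v}"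
  using order_tendstoD(1)[OF assms(1)[unfolded density_one_def] assms(4)] assms(2)
proof eventually_elim
  case (elim n)
  then have "card (V n) > 0" using assms(3) by (simp add: card_gt_0_iff)
  then show ?case using elim(1) by (simp add: pos_less_divide_eq)
qed

lemma density_one_eventually_ex:
  assumes "density_one V P"
  shows "\<forall>\<^sub>F n in sequentially. \<exists>v\<in>V n. P n v"
proof -
  have "\<forall>\<^sub>F n in sequentially. 0 < real (card {v \<in> V n. P n v}) / real (card (V n))"
    using order_tendstoD(1)[OF assms[unfolded density_one_def], of 0] by simp
  then show ?thesis
  proof eventually_elim
    case (elim n)
    then have "{v \<in> V n. P n v} \<noteq> {}" by (metis card.empty div_0 less_irrefl of_nat_0)
    then show ?case by blast
  qed
qed

text \<open>Both directions are included because the inverse of the permutation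
  \<open>\<sigma> g\<close> need not be of the form \<open>\<sigma> h\<close>. Staying put is
  allowed, so that the power \<open>j\<close> means at most \<open>j\<close> moves.\<close>

definition near_step :: "'g set \<Rightarrow> ('g \<Rightarrow> 'v \<Rightarrow> 'v) \<Rightarrow> 'v \<Rightarrow> 'v \<Rightarrow> bool" where
  "near_step L \<sigma> u w \<longleftrightarrow> u = w \<or> (\<exists>g\<in>L. \<sigma> g u = w \<or> \<sigma> g w = u)"

lemma near_step_sym: "near_step L \<sigma> u w \<Longrightarrow> near_step L \<sigma> w u"
  by (auto simp: near_step_def)

lemma near_step_pow_sym: "(near_step L \<sigma> ^^ j) u w \<Longrightarrow> (near_step L \<sigma> ^^ j) w u"
proof (induction j arbitrary: w)
  case (Suc j)
  then obtain x where "(near_step L \<sigma> ^^ j) u x" "near_step L \<sigma> x w" by auto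
  then show ?case using Suc.IH near_step_sym by (metis relpowp_Suc_I2)
qed auto

lemma near_step_pow_refl: "(near_step L \<sigma> ^^ j) u u"
proof (induction j)
  case (Suc j)
  then show ?case by (auto intro!: relcomppI[of _ u u] simp: near_step_def)
qed auto

text \<open>By injectivity each \<open>g\<close> has at most one backward neighbour, so a vertex has
  at most \<open>2 * card L\<close> neighbours besides itself.\<close>

lemma near_step_pow_card:
  assumes L: "finite L" and inj: "\<And>g. inj (\<sigma> g)"
  shows "finite {w. (near_step L \<sigma> ^^ j) u w} \<and> card {w. (near_step L \<sigma> ^^ j) u w} \<le> (1 + 2 * card L) ^ j"
proof (induction j)
  case (Suc j)
  have one: "finite {w. near_step L \<sigma> x w} \<and> card {w. near_step L \<sigma> x w} \<le> 1 + 2 * card L" for x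
  proof -
    let ?B = "insert x ((\<lambda>g. \<sigma> g x) ` L \<union> (\<lambda>g. inv (\<sigma> g) x) ` L)"
    have sub: "{w. near_step L \<sigma> x w} \<subseteq> ?B"
    proof
      fix w assume "w \<in> {w. near_step L \<sigma> x w}"
      then consider "w = x" | g where "g \<in> L" "\<sigma> g x = w" | g where "g \<in> L" "\<sigma> g w = x"
        by (auto simp: near_step_def)
      then show "w \<in> ?B"
      proof cases
        case (3 g)
        then have "w = inv (\<sigma> g) x" using inj by (metis inv_f_f)
        then show ?thesis using 3 by blast
      qed auto
    qed
    have fin: "finite ?B" using L by simp
    have "card ?B \<le> 1 + card ((\<lambda>g. \<sigma> g x) ` L \<union> (\<lambda>g. inv (\<sigma> g) x) ` L)"
      by (simp add: card_insert_if L)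
    also have "\<dots> \<le> 1 + (card ((\<lambda>g. \<sigma> g x) ` L) + card ((\<lambda>g. inv (\<sigma> g) x) ` L))"
      by (intro add_left_mono card_Un_le)
    also have "\<dots> \<le> 1 + (card L + card L)" by (intro add_left_mono add_mono card_image_le L)
    finally show ?thesis using card_mono[OF fin sub] finite_subset[OF sub fin] by simp
  qed
  let ?A = "{w. (near_step L \<sigma> ^^ j) u w}"
  have eq: "{w. (near_step L \<sigma> ^^ Suc j) u w} = (\<Union>x\<in>?A. {w. near_step L \<sigma> x w})" by auto
  have "card (\<Union>x\<in>?A. {w. near_step L \<sigma> x w}) \<le> (\<Sum>x\<in>?A. card {w. near_step L \<sigma> x w})"
    using Suc.IH by (intro card_UN_le) simp
  also have "\<dots> \<le> (\<Sum>x\<in>?A. 1 + 2 * card L)" by (intro sum_mono) (use one in blast)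
  also have "\<dots> = card ?A * (1 + 2 * card L)" by simp
  also have "\<dots> \<le> (1 + 2 * card L) ^ j * (1 + 2 * card L)" using Suc.IH by (intro mult_right_mono) auto
  finally show ?case unfolding eq using Suc.IH one by (simp add: mult.commute)
qed simp

section \<open>Walk lengths and the weighted distance\<close>

lemma same_component_walk:
  assumes "same_component V \<sigma> v w"
  shows "\<exists>l. sofic_walk V \<rho> \<sigma> v w l"
proof -
  have "(sofic_edge V \<sigma>)\<^sup>*\<^sup>* v w" "w \<in> V" using assms by (auto simp: same_component_def)
  then show ?thesis by (induction rule: converse_rtranclp_induct) (auto intro: sofic_walk.intros)
qed

context
  fixes \<rho> :: "'g::group_add \<Rightarrow> 'g \<Rightarrow> real"
  assumes \<rho>: "proper_right_invariant_metric \<rho>"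
begin

lemma metric_nonneg: "0 \<le> \<rho> g h"
proof -
  have "Metric_space UNIV \<rho>" using \<rho> by (simp add: proper_right_invariant_metric_def)
  then show ?thesis by (rule Metric_space.nonneg)
qed

lemma finite_metric_ball: "finite {g. \<rho> g 0 < r}"
proof -
  have M: "Metric_space UNIV \<rho>" and f: "finite (Metric_space.mball UNIV \<rho> 0 r)"
    using \<rho> by (simp_all add: proper_right_invariant_metric_def)
  have "{g. \<rho> g 0 < r} = Metric_space.mball UNIV \<rho> 0 r"
    by (auto simp: Metric_space.in_mball[OF M] Metric_space.commute[OF M])
  then show ?thesis using f by simp
qed

text \<open>By properness only finitely many elements lie within distance 1 of the identity. The gap
  turns a bound on the length of a walk into a bound on its number of moves.\<close>

lemma metric_gap: "\<exists>d>0. \<forall>g. g \<noteq> 0 \<longrightarrow> d \<le> \<rho> g 0"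
proof -
  have M: "Metric_space UNIV \<rho>" using \<rho> by (simp add: proper_right_invariant_metric_def)
  define A where "A = insert 1 ((\<lambda>g. \<rho> g 0) ` {g. g \<noteq> 0 \<and> \<rho> g 0 < 1})"
  have fin: "finite A" unfolding A_def
    by (intro finite.insertI finite_imageI finite_subset[OF _ finite_metric_ball[of 1]]) auto
  have pos: "a > 0" if "a \<in> A" for a
    using that metric_nonneg Metric_space.zero[OF M] by (auto simp: A_def less_le)
  have "Min A \<in> A" by (rule Min_in[OF fin]) (simp add: A_def)
  moreover have "Min A \<le> \<rho> g 0" if "g \<noteq> 0" for g
  proof (cases "\<rho> g 0 < 1")
    case True
    then show ?thesis using that fin by (intro Min_le) (auto simp: A_def)
  next
    case False
    have "Min A \<le> 1" using fin by (intro Min_le) (auto simp: A_def)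
    then show ?thesis using False by simp
  qed
  ultimately show ?thesis using pos by blast
qed

lemma edge_weight_nonneg:
  assumes "sofic_edge V \<sigma> u v" shows "0 \<le> edge_weight \<rho> \<sigma> u v"
  unfolding edge_weight_def
  by (rule cInf_greatest) (use assms metric_nonneg in \<open>auto simp: sofic_edge_def\<close>)

text \<open>
  An edge between distinct vertices has weight at least \<open>d\<close> unless it is realised by \<open>g = 0\<close>. As
  \<open>\<sigma>\<^sup>0\<close> need not be the identity, edges of weight \<open>0\<close> can occur; the hypothesis on \<open>b\<close> keeps the walk
  away from them.
\<close>

lemma short_walk_near:
  assumes walk: "sofic_walk V \<rho> \<sigma> u w l" and inj: "\<And>g. inj (\<sigma> g)"
    and gap: "\<And>g. g \<noteq> 0 \<Longrightarrow> d \<le> \<rho> g 0" and d: "d > 0"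
  shows "0 \<le> l \<and> (\<forall>j. l < d * (real j + 1) \<and> l < r \<and>
     (\<forall>b. (near_step {g. g \<noteq> 0 \<and> \<rho> g 0 < r} \<sigma> ^^ j) u b \<longrightarrow> \<sigma> 0 b = b)
       \<longrightarrow> (near_step {g. g \<noteq> 0 \<and> \<rho> g 0 < r} \<sigma> ^^ j) u w)"
  using walk
proof induction
  case (Nil v)
  then show ?case by (auto intro: near_step_pow_refl)
next
  case (Cons u v w l)
  let ?N = "near_step {g. g \<noteq> 0 \<and> \<rho> g 0 < r} \<sigma>"
  let ?e = "edge_weight \<rho> \<sigma> u v"
  have e0: "0 \<le> ?e" by (rule edge_weight_nonneg[OF Cons.hyps(1)])
  have l0: "0 \<le> l" using Cons.IH by blast
  show ?case
  proof (intro conjI allI impI)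
    show "0 \<le> ?e + l" using e0 l0 by simp
    fix j assume *: "?e + l < d * (real j + 1) \<and> ?e + l < r \<and> (\<forall>b. (?N ^^ j) u b \<longrightarrow> \<sigma> 0 b = b)"
    show "(?N ^^ j) u w"
    \<comment> \<open>A loop does not change the vertex, so it uses up nothing of \<open>j\<close>,
      whatever its weight.\<close>
    proof (cases "u = v")
      case True
      then show ?thesis using Cons.IH * e0 by auto
    next
      case False
      let ?A = "{\<rho> g 0 |g. \<sigma> g u = v \<or> \<sigma> g v = u}"
      have A0: "?A \<noteq> {}" using Cons.hyps(1) by (auto simp: sofic_edge_def)
      \<comment> \<open>The hypothesis on \<open>b\<close>, applied at \<open>u\<close> itself: if
        \<open>g = 0\<close> realised the edge, injectivity of \<open>\<sigma> 0\<close> would force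
        \<open>u = v\<close>.\<close>
      have u0: "\<sigma> 0 u = u" using * near_step_pow_refl[of j "{g. g \<noteq> 0 \<and> \<rho> g 0 < r}" \<sigma> u] by simp
      have ne: "g \<noteq> 0" if "\<sigma> g u = v \<or> \<sigma> g v = u" for g
      proof
        assume "g = 0"
        then have "\<sigma> 0 v = \<sigma> 0 u" using that u0 False by auto
        then show False using inj[of 0] False by (auto dest: injD)
      qed
      have de: "d \<le> ?e" unfolding edge_weight_def by (rule cInf_greatest[OF A0]) (use ne gap in auto)
      have "Inf ?A < r" using * l0 unfolding edge_weight_def by linarith
      from cInf_lessD[OF A0 this] obtain g where g: "\<sigma> g u = v \<or> \<sigma> g v = u" "\<rho> g 0 < r" by auto
      then have step: "?N u v" using ne[OF g(1)] by (auto simp: near_step_def)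
      \<comment> \<open>This edge weighs at least \<open>d\<close>, whereas \<open>j = 0\<close>
        would allow only lengths below \<open>d\<close>. So \<open>j\<close> is a successor, and the
        remaining walk satisfies the bound with \<open>j\<close> lowered by one.\<close>
      have "d * 1 < d * (real j + 1)" using * de l0 by linarith
      then obtain i where j: "j = Suc i" using d by (cases j) auto
      have "l < d * (real i + 1)" using * de by (simp add: j algebra_simps)
      moreover have "l < r" using * e0 by linarith
      moreover have "\<sigma> 0 b = b" if "(?N ^^ i) v b" for b
        using * relpowp_Suc_I2[of ?N u v i b, OF step that] by (simp only: j)
      ultimately have "(?N ^^ i) v w" using Cons.IH by simp
      then show ?thesis unfolding j using relpowp_Suc_I2[of ?N u v i w, OF step] by simp
    qed
  qed
qed

lemma sofic_dist_far:
  assumes inj: "\<And>g. inj (\<sigma> g)" and gap: "\<And>g. g \<noteq> 0 \<Longrightarrow> d \<le> \<rho> g 0" and d: "d > 0"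
    and k: "r \<le> d * (real k + 1)"
    and fixed: "\<And>b. (near_step {g. g \<noteq> 0 \<and> \<rho> g 0 < r} \<sigma> ^^ k) v b \<Longrightarrow> \<sigma> 0 b = b"
    and far: "\<not> (near_step {g. g \<noteq> 0 \<and> \<rho> g 0 < r} \<sigma> ^^ k) v w"
    and comp: "same_component V \<sigma> v w"
  shows "r \<le> sofic_dist M V \<rho> \<sigma> v w"
proof -
  have "r \<le> l" if "sofic_walk V \<rho> \<sigma> v w l" for l
  proof (rule ccontr)
    assume "\<not> r \<le> l"
    then show False using short_walk_near[OF that inj gap d, of r] k fixed far by auto
  qed
  moreover have "{l. sofic_walk V \<rho> \<sigma> v w l} \<noteq> {}" using same_component_walk[OF comp] by auto
  ultimately have "r \<le> Inf {l. sofic_walk V \<rho> \<sigma> v w l}" by (intro cInf_greatest) auto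
  then show ?thesis using comp by (simp add: sofic_dist_def)
qed

text \<open>With at most \<open>D\<close> vertices within \<open>k\<close> moves of any vertex,
  greedy selection from half of the vertices keeps the proportion \<open>1 / (2 * D)\<close>. For
  \<open>r\<close>-separation the selected vertices must have no edges of weight 0 nearby, which is
  the role of \<open>G\<close>, and pairs in different components rely on
  \<open>r \<le> M n\<close>.\<close>

lemma mixing_infinite_group:
  fixes V :: "nat \<Rightarrow> 'v set" and \<mu> :: "('g \<Rightarrow> 'a::topological_space) measure"
  assumes inf: "infinite (UNIV :: 'g set)" and sofic: "sofic_approximation V \<sigma>"
    and M: "\<And>n. exceeds_component_distances (M n) (V n) \<rho> (\<sigma> n)"
    and umm: "uniformly_model_mixing V \<sigma> (\<lambda>n. sofic_dist (M n) (V n) \<rho> (\<sigma> n)) \<mu>s \<mu>"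
  shows "separated_mixing V \<sigma> \<mu>s \<mu>"
  unfolding separated_mixing_def
proof (intro allI impI, elim conjE)
  fix F :: "'g set" and e :: real
  assume F: "finite F" and e: "e > 0"
  let ?H = "shannon_entropy (marginal F \<mu>)"
  let ?HS = "\<lambda>n S. shannon_entropy (marginal (sofic_image (\<sigma> n) F S) (\<mu>s n))"
  note V = sofic_approximationD[OF sofic]
  have \<sigma>: "\<sigma> n g v \<in> V n" if "v \<in> V n" for n g v using permutes_in_image[OF V(3)] that by metis
  have inj: "inj (\<sigma> n g)" for n g by (rule permutes_inj[OF V(3)])
  obtain r W where rW: "(\<forall>n. W n \<subseteq> V n) \<and> (\<lambda>n. real (card (W n)) / real (card (V n))) \<longlonglongrightarrow> 1 \<and>
      (\<forall>n S. S \<subseteq> W n \<and> separated (sofic_dist (M n) (V n) \<rho> (\<sigma> n)) r S \<longrightarrow>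
       ?HS n S \<ge> card S * (?H - e))"
    using umm[unfolded uniformly_model_mixing_def, THEN spec, THEN spec, of F e, THEN mp, OF conjI[OF F e]]
    by (elim exE) (rule that)
  then have W: "\<And>n. W n \<subseteq> V n" "(\<lambda>n. real (card (W n)) / real (card (V n))) \<longlonglongrightarrow> 1"
    and mix: "\<And>n S. S \<subseteq> W n \<Longrightarrow> separated (sofic_dist (M n) (V n) \<rho> (\<sigma> n)) r S \<Longrightarrow>
       ?HS n S \<ge> card S * (?H - e)"
    by simp_all
  define L where "L = {g. g \<noteq> 0 \<and> \<rho> g 0 < r}"
  have L: "finite L" by (rule finite_subset[OF _ finite_metric_ball[of r]]) (auto simp: L_def)
  obtain d where d: "d > 0" "\<And>g. g \<noteq> 0 \<Longrightarrow> d \<le> \<rho> g 0" using metric_gap by blast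
  \<comment> \<open>With this \<open>k\<close> a walk of length less than \<open>r\<close> makes at
    most \<open>k\<close> moves, provided all of them weigh at least \<open>d\<close>.\<close>
  obtain k :: nat where "r / d \<le> real k" using real_arch_simple by blast
  then have k: "r \<le> d * (real k + 1)" using d(1) by (simp add: divide_le_eq algebra_simps)
  define N where "N n = near_step L (\<sigma> n) ^^ k" for n
  define D where "D = (1 + 2 * card L) ^ k"
  have D: "finite {w. N n u w}" "card {w. N n u w} \<le> D" for n u
    using near_step_pow_card[of L "\<sigma> n" k u, OF L inj] by (auto simp: N_def D_def)
  have D0: "D > 0" by (simp add: D_def)
  have N_sym: "N n u w \<Longrightarrow> N n w u" for n u w unfolding N_def by (rule near_step_pow_sym)
  have N_refl: "N n u u" for n u unfolding N_def by (rule near_step_pow_refl)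
  define G where "G n v \<longleftrightarrow> (\<forall>b. N n v b \<longrightarrow> \<sigma> n 0 b = b)" for n v
  \<comment> \<open>Multiplicativity for the pair 0, 0 reads
    \<open>\<sigma> n 0 (\<sigma> n 0 v) = \<sigma> n 0 v\<close>, and \<open>\<sigma> n 0\<close>
    is injective.\<close>
  have dense0: "density_one V (\<lambda>n v. \<sigma> n 0 v = v)"
    by (rule density_one_mono[OF V(5)[of 0 0] V(1)])
      (intro always_eventually allI ballI impI, use inj in \<open>auto dest: injD\<close>)
  \<comment> \<open>Each vertex moved by \<open>\<sigma> n 0\<close> spoils at most \<open>D\<close>
    vertices, by symmetry of \<open>N\<close>, and the moved vertices have density 0.\<close>
  have dense_G: "density_one V G"
    unfolding density_one_def
  proof (rule tendsto_1_mono[OF _ _ density_le_1[OF V(1)]])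
    have "(\<lambda>n. 1 - real D * (1 - real (card {v \<in> V n. \<sigma> n 0 v = v}) / real (card (V n)))) \<longlonglongrightarrow> 1 - real D * (1 - 1)"
      by (intro tendsto_intros dense0[unfolded density_one_def])
    then show "(\<lambda>n. 1 - real D * (1 - real (card {v \<in> V n. \<sigma> n 0 v = v}) / real (card (V n)))) \<longlonglongrightarrow> 1" by simp
    show "\<forall>\<^sub>F n in sequentially. 1 - real D * (1 - real (card {v \<in> V n. \<sigma> n 0 v = v}) / real (card (V n)))
        \<le> real (card {v \<in> V n. G n v}) / real (card (V n))"
      using V(4)
    proof eventually_elim
      case (elim n)
      then have cV: "card (V n) > 0" using V(1) by (simp add: card_gt_0_iff)
      let ?B = "{b \<in> V n. \<sigma> n 0 b \<noteq> b}"
      have split: "card (V n) = card {v \<in> V n. P v} + card {v \<in> V n. \<not> P v}" for P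
        by (subst card_Un_disjoint[symmetric]) (auto simp: V(1) intro!: arg_cong[where f=card])
      have "{v \<in> V n. \<not> G n v} \<subseteq> (\<Union>b\<in>?B. {w. N n b w})"
      proof
        fix v assume "v \<in> {v \<in> V n. \<not> G n v}"
        then obtain b where b: "N n v b" "\<sigma> n 0 b \<noteq> b" by (auto simp: G_def)
        then have "b \<in> ?B" using permutes_not_in[OF V(3)] by blast
        then show "v \<in> (\<Union>b\<in>?B. {w. N n b w})" using N_sym[OF b(1)] by blast
      qed
      then have "card {v \<in> V n. \<not> G n v} \<le> card (\<Union>b\<in>?B. {w. N n b w})"
        by (rule card_mono[rotated]) (simp add: D V(1))
      also have "\<dots> \<le> (\<Sum>b\<in>?B. card {w. N n b w})" by (rule card_UN_le) (simp add: V(1))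
      also have "\<dots> \<le> (\<Sum>b\<in>?B. D)" by (intro sum_mono D)
      finally have "card {v \<in> V n. \<not> G n v} \<le> D * card ?B" by (simp add: mult.commute)
      then have "real (card {v \<in> V n. \<not> G n v}) \<le> real D * real (card ?B)"
        unfolding of_nat_mult[symmetric] by (simp only: of_nat_le_iff)
      moreover have "real (card {v \<in> V n. \<not> G n v}) = real (card (V n)) - real (card {v \<in> V n. G n v})"
        using split[of "G n"] by linarith
      moreover have "real (card ?B) = real (card (V n)) - real (card {v \<in> V n. \<sigma> n 0 v = v})"
        using split[of "\<lambda>v. \<sigma> n 0 v = v"] by linarith
      ultimately have "real (card (V n)) - real (card {v \<in> V n. G n v})
          \<le> real D * (real (card (V n)) - real (card {v \<in> V n. \<sigma> n 0 v = v}))"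
        by (simp only:)
      then have "(real (card (V n)) - real (card {v \<in> V n. G n v})) / real (card (V n))
          \<le> real D * (real (card (V n)) - real (card {v \<in> V n. \<sigma> n 0 v = v})) / real (card (V n))"
        by (rule divide_right_mono) simp
      then show ?case using cV by (simp add: diff_divide_distrib right_diff_distrib)
    qed
  qed
  have far: "r \<le> sofic_dist (M n) (V n) \<rho> (\<sigma> n) v w"
    if "G n v" "\<not> N n v w" "same_component (V n) (\<sigma> n) v w" for n v w
    by (rule sofic_dist_far[where \<sigma>="\<sigma> n", OF inj d(2,1) k _ _ that(3)]) (use that in \<open>auto simp: G_def N_def L_def\<close>)
  \<comment> \<open>A vertex with more than \<open>D\<close> distinct images has one of them at distance at least \<open>r\<close> in its component.\<close>
  have M_ge: "\<forall>\<^sub>F n in sequentially. r \<le> M n"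
  proof -
    obtain E :: "'g set" where E: "finite E" "card E = D + 1"
      using infinite_arbitrarily_large[OF inf] by blast
    have "density_one V (\<lambda>n v. \<forall>p\<in>E \<times> E. fst p \<noteq> snd p \<longrightarrow> \<sigma> n (fst p) v \<noteq> \<sigma> n (snd p) v)"
    proof (rule density_one_finite_ball[OF _ _ V(1,4)])
      fix p :: "'g \<times> 'g"
      obtain g h where p: "p = (g, h)" by (cases p)
      show "density_one V (\<lambda>n v. fst p \<noteq> snd p \<longrightarrow> \<sigma> n (fst p) v \<noteq> \<sigma> n (snd p) v)"
      proof (cases "g = h")
        case True
        then show ?thesis unfolding p by (intro density_one_mono[OF dense0 V(1)]) simp
      next
        case False
        then have "- g + h \<noteq> 0" by (simp add: neg_eq_iff_add_eq_0[symmetric])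
        \<comment> \<open>If \<open>\<sigma> n g v = \<sigma> n h v\<close>, then applying
          \<open>\<sigma> n (- g)\<close> gives \<open>v = \<sigma> n (- g + h) v\<close>, which
          fails for most \<open>v\<close>.\<close>
        then have "density_one V (\<lambda>n v. ((\<sigma> n (- g) (\<sigma> n g v) = \<sigma> n (- g + g) v \<and> \<sigma> n (- g) (\<sigma> n h v) = \<sigma> n (- g + h) v)
            \<and> \<sigma> n (- g + h) v \<noteq> v) \<and> \<sigma> n 0 v = v)"
          by (intro density_one_conj V dense0)
        then show ?thesis
          by (rule density_one_mono[OF _ V(1)]) (intro always_eventually allI ballI impI notI, auto simp: p)
      qed
    qed (use E in simp)
    from density_one_conj[OF dense_G this V(1,4)]
    have "\<forall>\<^sub>F n in sequentially. \<exists>v\<in>V n. G n v \<and>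
       (\<forall>p\<in>E \<times> E. fst p \<noteq> snd p \<longrightarrow> \<sigma> n (fst p) v \<noteq> \<sigma> n (snd p) v)"
      by (rule density_one_eventually_ex)
    then show ?thesis
    proof eventually_elim
      case (elim n)
      then obtain v where v: "v \<in> V n" "G n v" "\<And>g h. g \<in> E \<Longrightarrow> h \<in> E \<Longrightarrow> g \<noteq> h \<Longrightarrow> \<sigma> n g v \<noteq> \<sigma> n h v"
        by auto
      have "inj_on (\<lambda>g. \<sigma> n g v) E" using v(3) by (auto intro: inj_onI)
      then have "card ((\<lambda>g. \<sigma> n g v) ` E) = D + 1" using E by (simp add: card_image)
      then have "\<not> (\<lambda>g. \<sigma> n g v) ` E \<subseteq> {w. N n v w}"
        using card_mono[OF D(1)[of n v], of "(\<lambda>g. \<sigma> n g v) ` E"] D(2)[of n v] by auto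
      then obtain g where g: "\<not> N n v (\<sigma> n g v)" by blast
      have "same_component (V n) (\<sigma> n) v (\<sigma> n g v)"
        unfolding same_component_def using v(1) \<sigma>[OF v(1)] by (auto simp: sofic_edge_def intro!: r_into_rtranclp)
      then show ?case using far[OF v(2) g] M[of n] unfolding exceeds_component_distances_def by fastforce
    qed
  qed
  have dense_W: "density_one V (\<lambda>n v. v \<in> W n)"
  proof -
    have "{v \<in> V n. v \<in> W n} = W n" for n using W(1) by auto
    then show ?thesis using W(2) by (simp add: density_one_def)
  qed
  show "\<exists>c>0. \<forall>U. density_one V U \<longrightarrow>
      (\<forall>\<^sub>F n in sequentially. \<exists>S\<subseteq>{v\<in>V n. U n v}. c * real (card (V n)) \<le> real (card S) \<and>
        card S * (?H - e) \<le> ?HS n S)"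
  proof (intro exI[of _ "1 / (2 * real D)"] conjI allI impI)
    show "1 / (2 * real D) > 0" using D0 by simp
    fix U assume U: "density_one V U"
    have dense_A: "density_one V (\<lambda>n v. (U n v \<and> v \<in> W n) \<and> G n v)"
      by (intro density_one_conj U dense_W dense_G V)
    have "\<forall>\<^sub>F n in sequentially. 1/2 * real (card (V n)) \<le> card {v \<in> V n. (U n v \<and> v \<in> W n) \<and> G n v}"
      by (rule density_one_eventually_ge[OF dense_A V(4,1)]) simp
    from this M_ge
    show "\<forall>\<^sub>F n in sequentially. \<exists>S\<subseteq>{v\<in>V n. U n v}. 1 / (2 * real D) * real (card (V n)) \<le> real (card S) \<and>
        card S * (?H - e) \<le> ?HS n S"
    proof eventually_elim
      case (elim n)
      let ?A = "{v \<in> V n. (U n v \<and> v \<in> W n) \<and> G n v}"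
      have "card {w \<in> ?A. N n v w} \<le> D" for v
        by (rule order_trans[OF card_mono[OF D(1)] D(2)]) auto
      then obtain S where S: "S \<subseteq> ?A" "\<And>v w. v \<in> S \<Longrightarrow> w \<in> S \<Longrightarrow> v \<noteq> w \<Longrightarrow> \<not> N n v w" "card ?A \<le> D * card S"
        using separated_subset_greedy[of ?A "N n" D] V(1) N_refl N_sym by auto
      have "separated (sofic_dist (M n) (V n) \<rho> (\<sigma> n)) r S"
        unfolding separated_def
      proof (intro ballI impI)
        fix v w assume vw: "v \<in> S" "w \<in> S" "v \<noteq> w"
        show "r \<le> sofic_dist (M n) (V n) \<rho> (\<sigma> n) v w"
        proof (cases "same_component (V n) (\<sigma> n) v w")
          case True
          then show ?thesis using vw S by (intro far) auto
        next
          case False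
          then show ?thesis using elim(2) by (simp add: sofic_dist_def)
        qed
      qed
      then have "card S * (?H - e) \<le> ?HS n S"
        using S(1) by (intro mix) auto
      moreover have "1 / 2 * real (card (V n)) \<le> real D * real (card S)"
        using elim(1) of_nat_mono[OF S(3), where ?'a = real] by simp
      then have "1 / (2 * real D) * real (card (V n)) \<le> real (card S)"
        using D0 by (simp add: field_simps)
      ultimately show ?case using S(1) by (intro exI[of _ S]) auto
    qed
  qed
qed

end

section \<open>Independent models over finite groups\<close>

text \<open>The union of the free orbits, on which \<sigma> is a genuine free action of the
  group.\<close>

definition free_vertices :: "'v set \<Rightarrow> ('g::group_add \<Rightarrow> 'v \<Rightarrow> 'v) \<Rightarrow> 'v set" where
  "free_vertices V \<sigma> = {v \<in> V. (\<forall>g h. \<sigma> g (\<sigma> h v) = \<sigma> (g + h) v) \<and> (\<forall>g. g \<noteq> 0 \<longrightarrow> \<sigma> g v \<noteq> v)}"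

text \<open>The choice is made from the orbit as a set, so all vertices of a free orbit obtain the
  same representative.\<close>

definition orbit_rep :: "('g \<Rightarrow> 'v \<Rightarrow> 'v) \<Rightarrow> 'v \<Rightarrow> 'v" where
  "orbit_rep \<sigma> v = (SOME w. w \<in> range (\<lambda>g. \<sigma> g v))"

definition orbit_elt :: "('g \<Rightarrow> 'v \<Rightarrow> 'v) \<Rightarrow> 'v \<Rightarrow> 'g" where
  "orbit_elt \<sigma> v = (SOME g. \<sigma> g (orbit_rep \<sigma> v) = v)"

definition transversal :: "'v set \<Rightarrow> ('g::group_add \<Rightarrow> 'v \<Rightarrow> 'v) \<Rightarrow> 'v set" where
  "transversal V \<sigma> = orbit_rep \<sigma> ` free_vertices V \<sigma>"

text \<open>A free orbit is identified with the group through its representative \<open>t\<close>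
  and copies the sample \<open>\<omega> t\<close>. The remaining vertices, of density 0 along the
  sofic approximation, receive a fixed label.\<close>

definition free_labelling :: "'v set \<Rightarrow> ('g::group_add \<Rightarrow> 'v \<Rightarrow> 'v) \<Rightarrow> ('v \<Rightarrow> 'g \<Rightarrow> 'a) \<Rightarrow> 'v \<Rightarrow> 'a" where
  "free_labelling V \<sigma> \<omega> = (\<lambda>v\<in>V. if v \<in> free_vertices V \<sigma> then \<omega> (orbit_rep \<sigma> v) (orbit_elt \<sigma> v) else undefined)"

definition free_model :: "'v set \<Rightarrow> ('g::group_add \<Rightarrow> 'v \<Rightarrow> 'v) \<Rightarrow> ('g \<Rightarrow> 'a::topological_space) measure \<Rightarrow> ('v \<Rightarrow> 'a) measure" where
  "free_model V \<sigma> \<mu> = distr (PiM (transversal V \<sigma>) (\<lambda>_. \<mu>)) (PiM V (\<lambda>_. borel)) (free_labelling V \<sigma>)"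

section \<open>Coordinates on the free orbits\<close>

context
  fixes V :: "'v set" and \<sigma> :: "'g::{group_add,countable} \<Rightarrow> 'v \<Rightarrow> 'v"
  assumes finV: "finite V" and perm: "\<And>g. \<sigma> g permutes V" and finG: "finite (UNIV :: 'g set)"
begin

lemma free_vertices_subset: "free_vertices V \<sigma> \<subseteq> V"
  by (auto simp: free_vertices_def)

lemma free_vertices_add: "v \<in> free_vertices V \<sigma> \<Longrightarrow> \<sigma> g (\<sigma> h v) = \<sigma> (g + h) v"
  by (simp add: free_vertices_def)

lemma free_vertices_0:
  assumes "v \<in> free_vertices V \<sigma>" shows "\<sigma> 0 v = v"
proof -
  have "\<sigma> 0 (\<sigma> 0 v) = \<sigma> 0 v" using free_vertices_add[OF assms, of 0 0] by simp
  then show ?thesis using permutes_inj[OF perm[of 0]] by (auto dest: injD)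
qed

lemma free_vertices_inj:
  assumes "v \<in> free_vertices V \<sigma>" "\<sigma> g v = \<sigma> h v" shows "g = h"
proof (rule ccontr)
  assume "g \<noteq> h"
  then have "- h + g \<noteq> 0" by (metis add.right_neutral add_minus_cancel)
  moreover have "\<sigma> (- h + g) v = v"
    using free_vertices_add[OF assms(1), of "- h" g] free_vertices_add[OF assms(1), of "- h" h]
      free_vertices_0[OF assms(1)] assms(2) by simp
  ultimately show False using assms(1) by (auto simp: free_vertices_def)
qed

lemma free_vertices_closed:
  assumes "v \<in> free_vertices V \<sigma>" shows "\<sigma> k v \<in> free_vertices V \<sigma>"
proof -
  have "\<sigma> k v \<in> V" using assms permutes_in_image[OF perm] by (auto simp: free_vertices_def)
  moreover have "\<sigma> g (\<sigma> k v) \<noteq> \<sigma> k v" if "g \<noteq> 0" for g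
  proof
    assume "\<sigma> g (\<sigma> k v) = \<sigma> k v"
    then have "g + k = 0 + k" using free_vertices_inj[OF assms, of "g + k" k] free_vertices_add[OF assms] by simp
    then show False using that by (simp only: add_right_cancel)
  qed
  ultimately show ?thesis
    using free_vertices_add[OF assms] by (simp add: free_vertices_def add.assoc)
qed

lemma orbit_shift:
  assumes "v \<in> free_vertices V \<sigma>" shows "range (\<lambda>g. \<sigma> g (\<sigma> k v)) = range (\<lambda>g. \<sigma> g v)"
proof -
  have "\<sigma> g (\<sigma> k v) = \<sigma> (g + k) v" "\<sigma> g v = \<sigma> (g - k) (\<sigma> k v)" for g
    using free_vertices_add[OF assms] by simp_all
  then show ?thesis by (intro equalityI image_subsetI) (metis rangeI)+
qed

lemma orbit_rep_shift:
  assumes "v \<in> free_vertices V \<sigma>" shows "orbit_rep \<sigma> (\<sigma> k v) = orbit_rep \<sigma> v"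
  unfolding orbit_rep_def orbit_shift[OF assms] ..

lemma orbit_rep_range:
  "\<exists>g. orbit_rep \<sigma> v = \<sigma> g v"
proof -
  have "orbit_rep \<sigma> v \<in> range (\<lambda>g. \<sigma> g v)" unfolding orbit_rep_def by (rule someI[of _ "\<sigma> 0 v"]) simp
  then show ?thesis by auto
qed

lemma transversal_free: "transversal V \<sigma> \<subseteq> free_vertices V \<sigma>"
proof
  fix t assume "t \<in> transversal V \<sigma>"
  then obtain v where v: "v \<in> free_vertices V \<sigma>" "t = orbit_rep \<sigma> v" by (auto simp: transversal_def)
  obtain g where "t = \<sigma> g v" using orbit_rep_range v(2) by blast
  then show "t \<in> free_vertices V \<sigma>" using free_vertices_closed[OF v(1)] by simp
qed

lemma transversal_rep:
  assumes "t \<in> transversal V \<sigma>" shows "orbit_rep \<sigma> (\<sigma> g t) = t"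
proof -
  obtain v where v: "v \<in> free_vertices V \<sigma>" "t = orbit_rep \<sigma> v" using assms by (auto simp: transversal_def)
  have t: "t \<in> free_vertices V \<sigma>" using assms transversal_free by auto
  obtain k where k: "t = \<sigma> k v" using orbit_rep_range v(2) by blast
  have "orbit_rep \<sigma> (\<sigma> g t) = orbit_rep \<sigma> t" by (rule orbit_rep_shift[OF t])
  also have "\<dots> = orbit_rep \<sigma> v" unfolding k by (rule orbit_rep_shift[OF v(1)])
  finally show ?thesis using v(2) by simp
qed

lemma transversal_elt:
  assumes "t \<in> transversal V \<sigma>" shows "orbit_elt \<sigma> (\<sigma> g t) = g"
proof -
  have t: "t \<in> free_vertices V \<sigma>" using assms transversal_free by auto
  have "\<sigma> (orbit_elt \<sigma> (\<sigma> g t)) t = \<sigma> g t"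
    unfolding orbit_elt_def transversal_rep[OF assms] by (rule someI[of _ g]) simp
  then show ?thesis by (rule free_vertices_inj[OF t])
qed

lemma free_vertex_cases:
  assumes "v \<in> free_vertices V \<sigma>"
  shows "orbit_rep \<sigma> v \<in> transversal V \<sigma>" "\<sigma> (orbit_elt \<sigma> v) (orbit_rep \<sigma> v) = v"
proof -
  show "orbit_rep \<sigma> v \<in> transversal V \<sigma>" using assms by (simp add: transversal_def)
  obtain k where k: "orbit_rep \<sigma> v = \<sigma> k v" using orbit_rep_range by blast
  have "\<sigma> (- k) (orbit_rep \<sigma> v) = v"
    unfolding k using free_vertices_add[OF assms, of "- k" k] free_vertices_0[OF assms] by simp
  then show "\<sigma> (orbit_elt \<sigma> v) (orbit_rep \<sigma> v) = v"
    unfolding orbit_elt_def by (rule someI[where P="\<lambda>g. \<sigma> g (orbit_rep \<sigma> v) = v"])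
qed

lemma finite_transversal: "finite (transversal V \<sigma>)"
  using finite_subset[OF _ finV] free_vertices_subset by (auto simp: transversal_def)

lemma card_free_vertices_le: "card (free_vertices V \<sigma>) \<le> card (UNIV :: 'g set) * card (transversal V \<sigma>)"
proof -
  have "free_vertices V \<sigma> \<subseteq> (\<lambda>(g, t). \<sigma> g t) ` (UNIV \<times> transversal V \<sigma>)"
  proof
    fix v assume "v \<in> free_vertices V \<sigma>"
    from free_vertex_cases[OF this] show "v \<in> (\<lambda>(g, t). \<sigma> g t) ` (UNIV \<times> transversal V \<sigma>)"
      by (intro image_eqI[of _ _ "(orbit_elt \<sigma> v, orbit_rep \<sigma> v)"]) auto
  qed
  then have "card (free_vertices V \<sigma>) \<le> card ((\<lambda>(g, t). \<sigma> g t) ` (UNIV \<times> transversal V \<sigma>))"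
    using finG finite_transversal by (intro card_mono) auto
  also have "\<dots> \<le> card ((UNIV :: 'g set) \<times> transversal V \<sigma>)"
    using finG finite_transversal by (intro card_image_le) auto
  finally show ?thesis by (simp add: card_cartesian_product)
qed

lemma free_labelling_transversal:
  assumes "t \<in> transversal V \<sigma>"
  shows "free_labelling V \<sigma> \<omega> (\<sigma> g t) = \<omega> t g"
proof -
  have "\<sigma> g t \<in> free_vertices V \<sigma>" using assms transversal_free free_vertices_closed by blast
  then show ?thesis using assms free_vertices_subset
    by (auto simp: free_labelling_def transversal_rep transversal_elt)
qed

text \<open>The name at a free vertex is exactly a shift of the sample on its orbit. Invariance then
  makes its law equal to \<mu>, with no error term.\<close>

lemma pullback_free_labelling:
  assumes "v \<in> free_vertices V \<sigma>"
  shows "pullback_name \<sigma> v (free_labelling V \<sigma> \<omega>) = gshift (orbit_elt \<sigma> v) (\<omega> (orbit_rep \<sigma> v))"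
proof
  fix g
  note t = free_vertex_cases[OF assms]
  have "\<sigma> g v = \<sigma> (g + orbit_elt \<sigma> v) (orbit_rep \<sigma> v)"
    using free_vertices_add[of "orbit_rep \<sigma> v" g "orbit_elt \<sigma> v"] t transversal_free by auto
  then show "pullback_name \<sigma> v (free_labelling V \<sigma> \<omega>) g = gshift (orbit_elt \<sigma> v) (\<omega> (orbit_rep \<sigma> v)) g"
    by (simp add: pullback_name_def gshift_def free_labelling_transversal[OF t(1)])
qed

section \<open>Law, concentration and entropy of the independent model\<close>

context
  fixes \<mu> :: "('g \<Rightarrow> 'a::{finite,discrete_topology,second_countable_topology}) measure"
  assumes proc: "process \<mu>"
begin

abbreviation (input) "PM \<equiv> PiM (transversal V \<sigma>) (\<lambda>_. \<mu>)"

lemma \<mu>_borel_prob: "\<mu> \<in> borel_prob"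
  using proc by (simp add: process_def)

lemma prob_space_PM: "prob_space PM"
  by (intro prob_space_PiM borel_probD[OF \<mu>_borel_prob])

lemma measurable_free_labelling: "free_labelling V \<sigma> \<in> PM \<rightarrow>\<^sub>M PiM V (\<lambda>_. borel)"
  unfolding free_labelling_def
proof (rule measurable_restrict)
  fix v
  show "(\<lambda>\<omega>. if v \<in> free_vertices V \<sigma> then \<omega> (orbit_rep \<sigma> v) (orbit_elt \<sigma> v) else undefined) \<in> PM \<rightarrow>\<^sub>M (borel :: 'a measure)"
  proof (cases "v \<in> free_vertices V \<sigma>")
    case True
    have "(\<lambda>\<omega>. \<omega> (orbit_rep \<sigma> v)) \<in> PM \<rightarrow>\<^sub>M \<mu>"
      by (rule measurable_component_singleton[OF free_vertex_cases(1)[OF True]])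
    moreover have "(\<lambda>a. a (orbit_elt \<sigma> v)) \<in> \<mu> \<rightarrow>\<^sub>M (borel :: 'a measure)"
      unfolding measurable_cong_sets[OF borel_probD(2)[OF \<mu>_borel_prob] refl]
      by (intro borel_measurable_continuous_onI) (rule continuous_on_product_coordinates)
    ultimately show ?thesis using True by simp
  qed simp
qed

lemma free_model_prob_on: "free_model V \<sigma> \<mu> \<in> prob_on V"
proof -
  interpret prob_space PM by (rule prob_space_PM)
  show ?thesis unfolding free_model_def prob_on_def using prob_space_distr[OF measurable_free_labelling] by simp
qed

lemma integral_component:
  fixes f :: "('g \<Rightarrow> 'a) \<Rightarrow> real"
  assumes "t \<in> transversal V \<sigma>" "f \<in> borel_measurable borel"
  shows "(\<integral>\<omega>. f (\<omega> t) \<partial>PM) = (\<integral>a. f a \<partial>\<mu>)"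
proof -
  have "(\<integral>a. f a \<partial>\<mu>) = (\<integral>a. f a \<partial>distr PM \<mu> (\<lambda>\<omega>. \<omega> t))"
    by (subst distr_PiM_component[OF borel_probD(1)[OF \<mu>_borel_prob] assms(1)]) simp
  also have "\<dots> = (\<integral>\<omega>. f (\<omega> t) \<partial>PM)"
    by (rule integral_distr[OF measurable_component_singleton[OF assms(1)]])
      (use assms(2) borel_probD(2)[OF \<mu>_borel_prob] in \<open>simp add: measurable_cong_sets[OF borel_probD(2)[OF \<mu>_borel_prob] refl]\<close>)
  finally show ?thesis ..
qed

lemma integral_gshift:
  fixes f :: "('g \<Rightarrow> 'a) \<Rightarrow> real"
  assumes "f \<in> borel_measurable borel"
  shows "(\<integral>a. f (gshift k a) \<partial>\<mu>) = (\<integral>a. f a \<partial>\<mu>)"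
proof -
  have "gshift k \<in> \<mu> \<rightarrow>\<^sub>M borel"
    using measurable_gshift measurable_cong_sets[OF borel_probD(2)[OF \<mu>_borel_prob] refl] by blast
  then have "(\<integral>a. f a \<partial>distr \<mu> borel (gshift k)) = (\<integral>a. f (gshift k a) \<partial>\<mu>)"
    by (rule integral_distr) (rule assms)
  moreover have "distr \<mu> borel (gshift k) = \<mu>" using proc unfolding process_def by blast
  ultimately show ?thesis by simp
qed

lemma free_model_local:
  fixes f :: "('g \<Rightarrow> 'a) \<Rightarrow> real"
  assumes v: "v \<in> free_vertices V \<sigma>" and f: "f \<in> borel_measurable borel"
  shows "(\<integral>y. f (pullback_name \<sigma> v y) \<partial>free_model V \<sigma> \<mu>) = (\<integral>a. f a \<partial>\<mu>)"
proof -
  have \<sigma>v: "\<sigma> g v \<in> V" for g using v permutes_in_image[OF perm] free_vertices_subset by auto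
  have "(\<integral>y. f (pullback_name \<sigma> v y) \<partial>free_model V \<sigma> \<mu>) = (\<integral>\<omega>. f (pullback_name \<sigma> v (free_labelling V \<sigma> \<omega>)) \<partial>PM)"
    unfolding free_model_def
    by (rule integral_distr[OF measurable_free_labelling measurable_compose[OF measurable_pullback_name[where V=V] f]])
      (use \<sigma>v in auto)
  also have "\<dots> = (\<integral>\<omega>. f (gshift (orbit_elt \<sigma> v) (\<omega> (orbit_rep \<sigma> v))) \<partial>PM)"
    by (simp add: pullback_free_labelling[OF v])
  also have "\<dots> = (\<integral>a. f (gshift (orbit_elt \<sigma> v) a) \<partial>\<mu>)"
    by (rule integral_component[OF free_vertex_cases(1)[OF v] measurable_compose[OF measurable_gshift f]])
  also have "\<dots> = (\<integral>a. f a \<partial>\<mu>)" by (rule integral_gshift[OF f])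
  finally show ?thesis .
qed

lemma finite_product_prob_space_PM: "finite_product_prob_space (\<lambda>_. \<mu>) (transversal V \<sigma>)"
proof -
  interpret product_prob_space "\<lambda>_. \<mu>" "transversal V \<sigma>"
    by (rule product_prob_spaceI) (rule borel_probD[OF \<mu>_borel_prob])
  show ?thesis by unfold_locales (rule finite_transversal)
qed

text \<open>Independence of different orbits, obtained from a product integral with constant factors
  1 at all other representatives.\<close>

lemma integral_two_components:
  fixes f1 f2 :: "('g \<Rightarrow> 'a) \<Rightarrow> real"
  assumes st: "s \<in> transversal V \<sigma>" "t \<in> transversal V \<sigma>" "s \<noteq> t"
    and f: "integrable \<mu> f1" "integrable \<mu> f2"
  shows "(\<integral>\<omega>. f1 (\<omega> s) * f2 (\<omega> t) \<partial>PM) = (\<integral>a. f1 a \<partial>\<mu>) * (\<integral>a. f2 a \<partial>\<mu>)"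
proof -
  interpret \<mu>: prob_space \<mu> by (rule borel_probD[OF \<mu>_borel_prob])
  interpret finite_product_prob_space "\<lambda>_. \<mu>" "transversal V \<sigma>" by (rule finite_product_prob_space_PM)
  define F where "F i = (if i = s then f1 else if i = t then f2 else (\<lambda>_. 1))" for i
  have split: "(\<Prod>i\<in>transversal V \<sigma>. G i) = G s * (G t * 1)"
    if "\<And>i. i \<noteq> s \<Longrightarrow> i \<noteq> t \<Longrightarrow> G i = 1" for G :: "'v \<Rightarrow> real"
  proof -
    have "(\<Prod>i\<in>transversal V \<sigma>. G i) = G s * (\<Prod>i\<in>transversal V \<sigma> - {s}. G i)"
      by (rule prod.remove[OF finite_transversal st(1)])
    also have "(\<Prod>i\<in>transversal V \<sigma> - {s}. G i) = G t * (\<Prod>i\<in>transversal V \<sigma> - {s} - {t}. G i)"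
      by (rule prod.remove) (use finite_transversal st in auto)
    also have "(\<Prod>i\<in>transversal V \<sigma> - {s} - {t}. G i) = 1" by (rule prod.neutral) (use that in auto)
    finally show ?thesis .
  qed
  have "(\<integral>\<omega>. (\<Prod>i\<in>transversal V \<sigma>. F i (\<omega> i)) \<partial>PM) = (\<Prod>i\<in>transversal V \<sigma>. \<integral>a. F i a \<partial>\<mu>)"
    by (rule product_integral_prod[OF finite_transversal]) (use f in \<open>auto simp: F_def\<close>)
  also have "(\<lambda>\<omega>. \<Prod>i\<in>transversal V \<sigma>. F i (\<omega> i)) = (\<lambda>\<omega>. f1 (\<omega> s) * f2 (\<omega> t))"
  proof
    show "(\<Prod>i\<in>transversal V \<sigma>. F i (\<omega> i)) = f1 (\<omega> s) * f2 (\<omega> t)" for \<omega>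
      using st(3) by (subst split) (auto simp: F_def)
  qed
  also have "(\<Prod>i\<in>transversal V \<sigma>. \<integral>a. F i a \<partial>\<mu>) = (\<integral>a. f1 a \<partial>\<mu>) * (\<integral>a. f2 a \<partial>\<mu>)"
    using st(3) by (subst split) (auto simp: F_def \<mu>.prob_space)
  finally show ?thesis .
qed

text \<open>Chebyshev's inequality. Labels on different orbits are independent, so at most
  \<open>card V * card UNIV\<close> covariances survive, each at most \<open>4 * B\<^sup>2\<close>.
  The fluctuation may use half of \<open>e\<close>, which gives the other factor 4 in the constant
  16; the second half is left to the vertices that are not free.\<close>

lemma free_model_empirical:
  fixes f :: "('g \<Rightarrow> 'a) \<Rightarrow> real" and B e :: real
  assumes f: "f \<in> borel_measurable borel" and B: "\<And>a. \<bar>f a\<bar> \<le> B" and V0: "V \<noteq> {}" and e: "e > 0"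
    and few: "2 * B * (card V - card (free_vertices V \<sigma>)) < e / 2 * card V"
  shows "1 - 16 * B\<^sup>2 * card (UNIV :: 'g set) / (e\<^sup>2 * card V)
    \<le> measure (free_model V \<sigma> \<mu>) {y \<in> space (free_model V \<sigma> \<mu>).
        \<bar>(\<Sum>v\<in>V. f (pullback_name \<sigma> v y)) / card V - (\<integral>x. f x \<partial>\<mu>)\<bar> < e}"
proof -
  interpret PM: prob_space PM by (rule prob_space_PM)
  interpret \<mu>: prob_space \<mu> by (rule borel_probD[OF \<mu>_borel_prob])
  note [measurable] = f
  note [measurable_cong] = borel_probD(2)[OF \<mu>_borel_prob]
  let ?R = "free_vertices V \<sigma>"
  have cV: "card V > 0" using finV V0 by (simp add: card_gt_0_iff)
  have finR: "finite ?R" by (rule finite_subset[OF free_vertices_subset finV])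
  define I where "I = (\<integral>x. f x \<partial>\<mu>)"
  have f_int: "integrable \<mu> f" by (rule \<mu>.integrable_const_bound[of _ B]) (use B in auto)
  have I_B: "\<bar>I\<bar> \<le> B"
  proof -
    have "\<bar>I\<bar> \<le> (\<integral>x. \<bar>f x\<bar> \<partial>\<mu>)" unfolding I_def by (rule integral_abs_bound)
    also have "\<dots> \<le> (\<integral>x. B \<partial>\<mu>)" by (rule integral_mono) (use B f_int in auto)
    finally show ?thesis by (simp add: \<mu>.prob_space)
  qed
  have B0: "B \<ge> 0" using I_B by linarith
  define Z where "Z v \<omega> = f (gshift (orbit_elt \<sigma> v) (\<omega> (orbit_rep \<sigma> v))) - I" for v and \<omega> :: "'v \<Rightarrow> 'g \<Rightarrow> 'a"
  have Z_meas[measurable]: "Z v \<in> borel_measurable PM" if "v \<in> ?R" for v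
    unfolding Z_def using free_vertex_cases(1)[OF that] by measurable
  have Z_B: "\<bar>Z v \<omega>\<bar> \<le> 2 * B" for v \<omega>
    unfolding Z_def using B[of "gshift (orbit_elt \<sigma> v) (\<omega> (orbit_rep \<sigma> v))"] I_B by linarith
  have ZZ_B: "\<bar>Z v \<omega> * Z w \<omega>\<bar> \<le> 4 * B\<^sup>2" for v w \<omega>
    using mult_mono[OF Z_B[of v \<omega>] Z_B[of w \<omega>]] B0 by (simp add: abs_mult power2_eq_square)
  have ZZ_int: "integrable PM (\<lambda>\<omega>. Z v \<omega> * Z w \<omega>)" if "v \<in> ?R" "w \<in> ?R" for v w
  proof (rule PM.integrable_const_bound[of _ "4 * B\<^sup>2"])
    show "(\<lambda>\<omega>. Z v \<omega> * Z w \<omega>) \<in> borel_measurable PM" using that by measurable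
  qed (use ZZ_B in auto)
  have ZZ: "(\<integral>\<omega>. Z v \<omega> * Z w \<omega> \<partial>PM) \<le> (if orbit_rep \<sigma> v = orbit_rep \<sigma> w then 4 * B\<^sup>2 else 0)"
    if vw: "v \<in> ?R" "w \<in> ?R" for v w
  proof (cases "orbit_rep \<sigma> v = orbit_rep \<sigma> w")
    case True
    have "(\<integral>\<omega>. Z v \<omega> * Z w \<omega> \<partial>PM) \<le> (\<integral>\<omega>. 4 * B\<^sup>2 \<partial>PM)"
      by (rule integral_mono[OF ZZ_int[OF vw]]) (use ZZ_B in \<open>auto intro: abs_le_D1\<close>)
    then show ?thesis using True by (simp add: PM.prob_space)
  next
    case False
    have i': "integrable \<mu> (\<lambda>a. f (gshift k a))" for k
      by (rule \<mu>.integrable_const_bound[of _ B]) (use B in auto)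
    then have i: "integrable \<mu> (\<lambda>a. f (gshift k a) - I)" for k by simp
    have "(\<integral>\<omega>. Z v \<omega> * Z w \<omega> \<partial>PM) = (\<integral>a. f (gshift (orbit_elt \<sigma> v) a) - I \<partial>\<mu>) * (\<integral>a. f (gshift (orbit_elt \<sigma> w) a) - I \<partial>\<mu>)"
      unfolding Z_def
      by (rule integral_two_components[OF free_vertex_cases(1)[OF vw(1)] free_vertex_cases(1)[OF vw(2)] False i i])
    also have "(\<integral>a. f (gshift (orbit_elt \<sigma> v) a) - I \<partial>\<mu>) = 0"
      by (simp add: Bochner_Integration.integral_diff[OF i'] integral_gshift[OF f] I_def[symmetric] \<mu>.prob_space)
    finally show ?thesis using False by simp
  qed
  define Y where "Y \<omega> = (\<Sum>v\<in>?R. Z v \<omega>)" for \<omega>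
  have Y_meas[measurable]: "Y \<in> borel_measurable PM" unfolding Y_def by (rule borel_measurable_sum) (rule Z_meas)
  have Y2: "(Y \<omega>)\<^sup>2 = (\<Sum>v\<in>?R. \<Sum>w\<in>?R. Z v \<omega> * Z w \<omega>)" for \<omega>
    unfolding Y_def power2_eq_square by (rule sum_product)
  have Y2_int: "integrable PM (\<lambda>\<omega>. (Y \<omega>)\<^sup>2)"
    unfolding Y2 by (intro Bochner_Integration.integrable_sum ZZ_int)
  have "(\<integral>\<omega>. (Y \<omega>)\<^sup>2 \<partial>PM) = (\<Sum>v\<in>?R. \<Sum>w\<in>?R. \<integral>\<omega>. Z v \<omega> * Z w \<omega> \<partial>PM)"
    unfolding Y2 by (simp add: Bochner_Integration.integral_sum ZZ_int)
  also have "\<dots> \<le> (\<Sum>v\<in>?R. \<Sum>w\<in>?R. if orbit_rep \<sigma> v = orbit_rep \<sigma> w then 4 * B\<^sup>2 else 0)"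
    by (intro sum_mono ZZ)
  also have "\<dots> \<le> (\<Sum>v\<in>?R. 4 * B\<^sup>2 * card (UNIV :: 'g set))"
  proof (rule sum_mono)
    fix v assume v: "v \<in> ?R"
    \<comment> \<open>Equal representatives mean the same orbit, and an orbit has at most as many
      points as the group.\<close>
    have "{w \<in> ?R. orbit_rep \<sigma> v = orbit_rep \<sigma> w} \<subseteq> range (\<lambda>g. \<sigma> g (orbit_rep \<sigma> v))"
    proof
      fix w assume "w \<in> {w \<in> ?R. orbit_rep \<sigma> v = orbit_rep \<sigma> w}"
      then have "w = \<sigma> (orbit_elt \<sigma> w) (orbit_rep \<sigma> v)" using free_vertex_cases(2)[of w] by simp
      then show "w \<in> range (\<lambda>g. \<sigma> g (orbit_rep \<sigma> v))" by (rule range_eqI)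
    qed
    then have "card {w \<in> ?R. orbit_rep \<sigma> v = orbit_rep \<sigma> w} \<le> card (range (\<lambda>g. \<sigma> g (orbit_rep \<sigma> v)))"
      by (rule card_mono[OF finite_imageI[OF finG]])
    also have "\<dots> \<le> card (UNIV :: 'g set)" by (rule card_image_le[OF finG])
    finally have "card {w \<in> ?R. orbit_rep \<sigma> v = orbit_rep \<sigma> w} \<le> card (UNIV :: 'g set)" .
    then have "4 * B\<^sup>2 * real (card {w \<in> ?R. orbit_rep \<sigma> v = orbit_rep \<sigma> w}) \<le> 4 * B\<^sup>2 * real (card (UNIV :: 'g set))"
      by (intro mult_left_mono) auto
    then show "(\<Sum>w\<in>?R. if orbit_rep \<sigma> v = orbit_rep \<sigma> w then 4 * B\<^sup>2 else 0) \<le> 4 * B\<^sup>2 * card (UNIV :: 'g set)"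
      by (simp add: sum.inter_filter[OF finR, symmetric] mult.commute)
  qed
  also have "\<dots> \<le> card V * (4 * B\<^sup>2 * card (UNIV :: 'g set))"
    using card_mono[OF finV free_vertices_subset] by (simp add: mult_right_mono)
  finally have var: "(\<integral>\<omega>. (Y \<omega>)\<^sup>2 \<partial>PM) \<le> card V * (4 * B\<^sup>2 * card (UNIV :: 'g set))" .
  define a where "a = e / 2 * card V"
  have a0: "a > 0" using e cV by (simp add: a_def)
  let ?S = "{y \<in> space (free_model V \<sigma> \<mu>). \<bar>(\<Sum>v\<in>V. f (pullback_name \<sigma> v y)) / card V - I\<bar> < e}"
  have good: "\<bar>(\<Sum>v\<in>V. f (pullback_name \<sigma> v (free_labelling V \<sigma> \<omega>))) / card V - I\<bar> < e" if "(Y \<omega>)\<^sup>2 < a\<^sup>2" for \<omega>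
  proof -
    let ?y = "free_labelling V \<sigma> \<omega>"
    have Y_a: "\<bar>Y \<omega>\<bar> < a" using that a0 by (metis abs_of_pos abs_le_square_iff not_less)
    have "(\<Sum>v\<in>V. f (pullback_name \<sigma> v ?y)) - card V * I = (\<Sum>v\<in>V. f (pullback_name \<sigma> v ?y) - I)"
      by (simp add: sum_subtractf)
    also have "\<dots> = (\<Sum>v\<in>?R. f (pullback_name \<sigma> v ?y) - I) + (\<Sum>v\<in>V - ?R. f (pullback_name \<sigma> v ?y) - I)"
      using sum.subset_diff[OF free_vertices_subset finV] by (simp add: add.commute)
    also have "(\<Sum>v\<in>?R. f (pullback_name \<sigma> v ?y) - I) = Y \<omega>"
      unfolding Y_def Z_def by (intro sum.cong refl) (simp add: pullback_free_labelling)
    finally have eq: "(\<Sum>v\<in>V. f (pullback_name \<sigma> v ?y)) - card V * I = Y \<omega> + (\<Sum>v\<in>V - ?R. f (pullback_name \<sigma> v ?y) - I)" .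
    have "\<bar>\<Sum>v\<in>V - ?R. f (pullback_name \<sigma> v ?y) - I\<bar> \<le> (\<Sum>v\<in>V - ?R. 2 * B)"
    proof (rule order_trans[OF sum_abs sum_mono])
      show "\<bar>f (pullback_name \<sigma> v ?y) - I\<bar> \<le> 2 * B" for v using B[of "pullback_name \<sigma> v ?y"] I_B by linarith
    qed
    also have "\<dots> = 2 * B * (card V - card ?R)"
      using card_Diff_subset[OF finR free_vertices_subset] by simp
    also have "\<dots> < a" using few by (simp add: a_def)
    finally have "\<bar>(\<Sum>v\<in>V. f (pullback_name \<sigma> v ?y)) - card V * I\<bar> < e * card V"
      using Y_a unfolding eq a_def by linarith
    then have "\<bar>(\<Sum>v\<in>V. f (pullback_name \<sigma> v ?y)) - card V * I\<bar> / card V < e"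
      using cV by (simp add: divide_less_eq)
    moreover have "(\<Sum>v\<in>V. f (pullback_name \<sigma> v ?y)) / card V - I = ((\<Sum>v\<in>V. f (pullback_name \<sigma> v ?y)) - card V * I) / card V"
      using cV by (simp add: diff_divide_distrib)
    ultimately show ?thesis by simp
  qed
  have "measure PM {\<omega> \<in> space PM. a\<^sup>2 \<le> (Y \<omega>)\<^sup>2} \<le> (\<integral>\<omega>. (Y \<omega>)\<^sup>2 \<partial>PM) / a\<^sup>2"
    by (rule integral_Markov_inequality_measure[OF Y2_int, of "{}"]) (use a0 in auto)
  also have "\<dots> \<le> card V * (4 * B\<^sup>2 * card (UNIV :: 'g set)) / a\<^sup>2"
    by (rule divide_right_mono[OF var]) simp
  also have "\<dots> = 16 * B\<^sup>2 * card (UNIV :: 'g set) / (e\<^sup>2 * card V)"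
    using cV e by (simp add: a_def power2_eq_square field_simps)
  finally have cheb: "measure PM {\<omega> \<in> space PM. a\<^sup>2 \<le> (Y \<omega>)\<^sup>2} \<le> 16 * B\<^sup>2 * card (UNIV :: 'g set) / (e\<^sup>2 * card V)" .
  have "1 - measure PM {\<omega> \<in> space PM. a\<^sup>2 \<le> (Y \<omega>)\<^sup>2} = measure PM (space PM - {\<omega> \<in> space PM. a\<^sup>2 \<le> (Y \<omega>)\<^sup>2})"
    by (rule PM.prob_compl[symmetric]) measurable
  also have "\<dots> \<le> measure PM (free_labelling V \<sigma> -` ?S \<inter> space PM)"
  proof (rule PM.finite_measure_mono)
    have S: "?S \<in> sets (PiM V (\<lambda>_. borel))"
      using sets_prob_on_finite[OF finV free_model_prob_on] prob_onD[OF free_model_prob_on] by auto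
    show "free_labelling V \<sigma> -` ?S \<inter> space PM \<in> sets PM" by (rule measurable_sets[OF measurable_free_labelling S])
    show "space PM - {\<omega> \<in> space PM. a\<^sup>2 \<le> (Y \<omega>)\<^sup>2} \<subseteq> free_labelling V \<sigma> -` ?S \<inter> space PM"
      using good measurable_space[OF measurable_free_labelling]
      by (auto simp: prob_onD(3)[OF free_model_prob_on] space_PiM not_le)
  qed
  also have "\<dots> = measure (free_model V \<sigma> \<mu>) ?S"
    unfolding free_model_def
    by (rule measure_distr[symmetric, OF measurable_free_labelling])
      (use sets_prob_on_finite[OF finV free_model_prob_on] prob_onD[OF free_model_prob_on] in \<open>auto simp: free_model_def\<close>)
  finally show ?thesis using cheb by (simp add: I_def)
qed

text \<open>Windows at distinct representatives lie in distinct orbits and are independent with the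
  law of \<mu> on \<open>F\<close>, so their entropies add. Distinct orbits take the place of
  separation in the metric.\<close>

lemma free_model_entropy:
  assumes F: "finite F" and S: "S \<subseteq> transversal V \<sigma>"
  shows "shannon_entropy (marginal (sofic_image \<sigma> F S) (free_model V \<sigma> \<mu>)) = card S * shannon_entropy (marginal F \<mu>)"
proof -
  interpret PM: prob_space PM by (rule prob_space_PM)
  interpret \<mu>: prob_space \<mu> by (rule borel_probD[OF \<mu>_borel_prob])
  interpret FP: finite_product_prob_space "\<lambda>_. \<mu>" "transversal V \<sigma>" by (rule finite_product_prob_space_PM)
  have sp: "space \<mu> = UNIV" by (rule borel_probD(3)[OF \<mu>_borel_prob])
  define T where "T = sofic_image \<sigma> F S"
  have T: "T \<subseteq> V"
    using S transversal_free free_vertices_closed free_vertices_subset by (fastforce simp: T_def sofic_image_def)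
  have finT: "finite T" by (rule finite_subset[OF T finV])
  have finS: "finite S" by (rule finite_subset[OF S finite_transversal])
  have in_T: "\<sigma> g s \<in> T" if "g \<in> F" "s \<in> S" for g s using that by (auto simp: T_def sofic_image_def)
  let ?J = "\<lambda>\<omega>. restrict (free_labelling V \<sigma> \<omega>) T"
  have marg: "marginal T (free_model V \<sigma> \<mu>) \<in> prob_on T" by (rule marginal_prob_on[OF free_model_prob_on T])
  have J_meas: "?J \<in> PM \<rightarrow>\<^sub>M PiM T (\<lambda>_. borel)"
    by (rule measurable_compose[OF measurable_free_labelling measurable_restrict_subset[OF T]])
  have marg_eq: "marginal T (free_model V \<sigma> \<mu>) = distr PM (PiM T (\<lambda>_. borel)) ?J"
    unfolding marginal_def free_model_def
    by (subst distr_distr[OF measurable_restrict_subset[OF T] measurable_free_labelling]) (simp add: o_def)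
  define pat where "pat s x = restrict (pullback_name \<sigma> s x) F" for s and x :: "'v \<Rightarrow> 'a"
  have cyl_pat: "\<omega> s \<in> cylinder F (pat s x) \<longleftrightarrow> (\<forall>g\<in>F. \<omega> s g = x (\<sigma> g s))" for \<omega> s x
    by (simp add: cylinder_def pat_def pullback_name_def)
  have J_val: "?J \<omega> (\<sigma> g s) = \<omega> s g" if "g \<in> F" "s \<in> S" for \<omega> g s
    using in_T[OF that] free_labelling_transversal[of s \<omega> g] that S by auto
  have p: "measure (marginal T (free_model V \<sigma> \<mu>)) {x} = (\<Prod>s\<in>S. measure \<mu> (cylinder F (pat s x)))"
    if x: "x \<in> patterns T" for x
  proof -
    define X where "X s = (if s \<in> S then cylinder F (pat s x) else UNIV)" for s
    have Xm: "X s \<in> sets \<mu>" for s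
      unfolding X_def using cylinder_borel[OF F] borel_probD(2)[OF \<mu>_borel_prob] sets.top[of \<mu>] sp by auto
    \<comment> \<open>In terms of the samples, prescribing the labels on \<open>T\<close> is one
      cylinder condition for each \<open>s \<in> S\<close> and no condition on the other
      orbits.\<close>
    have "?J -` {x} \<inter> space PM = PiE (transversal V \<sigma>) X"
    proof (intro equalityI subsetI)
      fix \<omega> assume w: "\<omega> \<in> ?J -` {x} \<inter> space PM"
      then have "?J \<omega> = x" by auto
      then have "\<omega> s \<in> cylinder F (pat s x)" if "s \<in> S" for s
        unfolding cyl_pat using J_val that by metis
      then show "\<omega> \<in> PiE (transversal V \<sigma>) X" using w by (auto simp: X_def space_PiM PiE_iff)
    next
      fix \<omega> assume w: "\<omega> \<in> PiE (transversal V \<sigma>) X"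
      have "?J \<omega> t = x t" if "t \<in> T" for t
      proof -
        obtain g s where gs: "g \<in> F" "s \<in> S" "t = \<sigma> g s" using \<open>t \<in> T\<close> by (auto simp: T_def sofic_image_def)
        have "\<omega> s \<in> X s" using w gs(2) S by (auto simp: PiE_iff)
        then have "\<omega> s \<in> cylinder F (pat s x)" using gs(2) by (simp add: X_def)
        then have "\<omega> s g = x (\<sigma> g s)" using gs(1) unfolding cyl_pat by blast
        then show ?thesis using J_val[OF gs(1,2), of \<omega>] by (simp only: gs(3))
      qed
      then have "?J \<omega> = x" using x by (intro PiE_ext[of _ T "\<lambda>_. UNIV" x]) auto
      then show "\<omega> \<in> ?J -` {x} \<inter> space PM" using w by (auto simp: space_PiM sp PiE_iff)
    qed
    moreover have "{x} \<in> sets (PiM T (\<lambda>_. borel))"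
      using sets_prob_on_finite[OF finT marg] prob_onD(2)[OF marg] x by auto
    ultimately have "measure (marginal T (free_model V \<sigma> \<mu>)) {x} = measure PM (PiE (transversal V \<sigma>) X)"
      unfolding marg_eq by (simp add: measure_distr[OF J_meas])
    also have "\<dots> = (\<Prod>s\<in>transversal V \<sigma>. measure \<mu> (X s))" by (rule FP.prob_times) (rule Xm)
    also have "\<dots> = (\<Prod>s\<in>S. measure \<mu> (cylinder F (pat s x)))"
      using \<mu>.prob_space sp by (intro prod.mono_neutral_cong_right finite_transversal S) (auto simp: X_def)
    finally show ?thesis .
  qed
  define l where "l a = ln (measure \<mu> (cylinder F a))" for a
  have l_dep: "depends_on F l"
    unfolding depends_on_def l_def
    by (intro allI impI arg_cong[where f="\<lambda>C. ln (measure \<mu> C)"]) (auto simp: cylinder_def)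
  have "shannon_entropy (marginal T (free_model V \<sigma> \<mu>))
      = (\<Sum>x\<in>patterns T. measure (marginal T (free_model V \<sigma> \<mu>)) {x} * (\<Sum>s\<in>S. - l (pat s x)))"
    unfolding shannon_entropy_def prob_onD(3)[OF marg] sum_negf[symmetric]
  proof (rule sum.cong[OF refl])
    fix x :: "'v \<Rightarrow> 'a" assume x: "x \<in> patterns T"
    let ?p = "measure (marginal T (free_model V \<sigma> \<mu>)) {x}"
    show "- (?p * ln ?p) = ?p * (\<Sum>s\<in>S. - l (pat s x))"
    \<comment> \<open>A pattern of probability 0 contributes nothing. Otherwise all factors of the
      product are nonzero, and its logarithm splits into a sum.\<close>
    proof (cases "?p = 0")
      case False
      then have "measure \<mu> (cylinder F (pat s x)) \<noteq> 0" if "s \<in> S" for s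
        using that finS unfolding p[OF x] by auto
      then have "ln ?p = (\<Sum>s\<in>S. l (pat s x))" unfolding p[OF x] l_def by (intro ln_prod finS)
      then show ?thesis by (simp add: sum_negf)
    qed simp
  qed
  also have "\<dots> = (\<integral>x. (\<Sum>s\<in>S. - l (pat s x)) \<partial>marginal T (free_model V \<sigma> \<mu>))"
    by (rule integral_prob_on_finite[OF finT marg, symmetric])
  also have "\<dots> = (\<Sum>s\<in>S. \<integral>x. - l (pat s x) \<partial>marginal T (free_model V \<sigma> \<mu>))"
    by (rule Bochner_Integration.integral_sum) (rule integrable_prob_on_finite[OF finT marg])
  also have "\<dots> = (\<Sum>s\<in>S. shannon_entropy (marginal F \<mu>))"
  proof (rule sum.cong[OF refl])
    fix s assume s: "s \<in> S"
    have "(\<lambda>x. - l (pat s x)) \<in> borel_measurable (PiM T (\<lambda>_. borel))"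
      using measurable_prob_on_finite[OF finT marg, of "\<lambda>x. - l (pat s x)" borel]
      by (simp add: measurable_cong_sets[OF prob_onD(2)[OF marg] refl])
    then have "(\<integral>x. - l (pat s x) \<partial>marginal T (free_model V \<sigma> \<mu>)) = (\<integral>\<omega>. - l (pat s (?J \<omega>)) \<partial>PM)"
      unfolding marg_eq by (rule integral_distr[OF J_meas])
    also have "\<dots> = (\<integral>\<omega>. - l (\<omega> s) \<partial>PM)"
    proof -
      have "l (pat s (?J \<omega>)) = l (\<omega> s)" for \<omega>
      proof (rule depends_onD[OF l_dep])
        fix g assume "g \<in> F"
        then show "pat s (?J \<omega>) g = \<omega> s g"
          using J_val[of g s \<omega>] in_T[of g s] s by (simp add: pat_def pullback_name_def)
      qed
      then show ?thesis by simp
    qed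
    also have "\<dots> = (\<integral>a. - l a \<partial>\<mu>)"
      using S s borel_measurable_depends_on[OF F l_dep] by (intro integral_component) auto
    also have "\<dots> = (\<Sum>z\<in>patterns F. - l z * measure \<mu> (cylinder F z))"
      by (rule integral_depends_on[OF F depends_on_compose[OF l_dep] \<mu>_borel_prob])
    also have "\<dots> = shannon_entropy (marginal F \<mu>)"
      unfolding entropy_marginal_process[OF \<mu>_borel_prob F] by (simp add: l_def sum_negf mult.commute)
    finally show "(\<integral>x. - l (pat s x) \<partial>marginal T (free_model V \<sigma> \<mu>)) = shannon_entropy (marginal F \<mu>)" .
  qed
  finally show ?thesis by (simp add: T_def)
qed

end

end

section \<open>The independent models along a sofic approximation\<close>

context
  fixes V :: "nat \<Rightarrow> 'v set" and \<sigma> :: "nat \<Rightarrow> 'g::{group_add,countable} \<Rightarrow> 'v \<Rightarrow> 'v"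
    and \<mu> :: "('g \<Rightarrow> 'a::{finite,discrete_topology,second_countable_topology}) measure"
  assumes sofic: "sofic_approximation V \<sigma>" and finG: "finite (UNIV :: 'g set)" and proc: "process \<mu>"
begin

text \<open>For a finite group freeness amounts to finitely many conditions, each of which holds
  with density one.\<close>

lemma density_one_free_vertices: "density_one V (\<lambda>n v. v \<in> free_vertices (V n) (\<sigma> n))"
proof -
  note V = sofic_approximationD[OF sofic]
  have "density_one V (\<lambda>n v. \<forall>p\<in>(UNIV :: ('g \<times> 'g) set). \<sigma> n (fst p) (\<sigma> n (snd p) v) = \<sigma> n (fst p + snd p) v)"
    by (rule density_one_finite_ball[OF _ V(5) V(1,4)]) (simp add: finite_prod finG)
  moreover have "density_one V (\<lambda>n v. \<forall>g\<in>(UNIV - {0} :: 'g set). \<sigma> n g v \<noteq> v)"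
    by (rule density_one_finite_ball[OF _ V(6) V(1,4)]) (use finG in auto)
  ultimately have "density_one V (\<lambda>n v. (\<forall>p\<in>(UNIV :: ('g \<times> 'g) set). \<sigma> n (fst p) (\<sigma> n (snd p) v) = \<sigma> n (fst p + snd p) v)
      \<and> (\<forall>g\<in>(UNIV - {0} :: 'g set). \<sigma> n g v \<noteq> v))"
    by (rule density_one_conj[OF _ _ V(1,4)])
  then show ?thesis
    by (rule density_one_mono[OF _ V(1)]) (auto simp: free_vertices_def)
qed

lemma card_free_vertices_eventually:
  fixes \<theta> :: real
  assumes "\<theta> < 1"
  shows "\<forall>\<^sub>F n in sequentially. \<theta> * card (V n) \<le> card (free_vertices (V n) (\<sigma> n))"
proof -
  note V = sofic_approximationD[OF sofic]
  have "{v \<in> V n. v \<in> free_vertices (V n) (\<sigma> n)} = free_vertices (V n) (\<sigma> n)" for n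
    by (auto simp: free_vertices_def)
  then show ?thesis using density_one_eventually_ge[OF density_one_free_vertices V(4,1) assms] by simp
qed

lemma free_model_convergence: "local_empirical_convergence V \<sigma> (\<lambda>n. free_model (V n) (\<sigma> n) \<mu>) \<mu>"
proof (rule local_empirical_convergenceI[OF sofic])
  note V = sofic_approximationD[OF sofic]
  have \<mu>: "\<mu> \<in> borel_prob" using proc by (simp add: process_def)
  show prob: "free_model (V n) (\<sigma> n) \<mu> \<in> prob_on (V n)" for n
    by (rule free_model_prob_on[OF V(1,3) finG proc])
  fix f :: "('g \<Rightarrow> 'a) \<Rightarrow> real" and e :: real
  assume f: "continuous_on UNIV f" "bounded (range f)" and e: "e > 0"
  have fm: "f \<in> borel_measurable borel" using f(1) by (rule borel_measurable_continuous_onI)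
  show "density_one V (\<lambda>n v. \<bar>(\<integral>y. f (pullback_name (\<sigma> n) v y) \<partial>free_model (V n) (\<sigma> n) \<mu>) - (\<integral>x. f x \<partial>\<mu>)\<bar> < e)"
    by (rule density_one_mono[OF density_one_free_vertices V(1)])
      (simp add: free_model_local[OF V(1,3) finG proc _ fm] e)
  obtain B where B: "\<And>a. \<bar>f a\<bar> \<le> B" using f(2) unfolding bounded_iff by auto
  have B0: "B \<ge> 0" using B[of undefined] by linarith
  let ?c = "16 * B\<^sup>2 * card (UNIV :: 'g set) / e\<^sup>2"
  have "filterlim (\<lambda>n. real (card (V n))) at_top sequentially"
    by (rule filterlim_compose[OF filterlim_real_sequentially V(2)])
  then have "(\<lambda>n. 1 - ?c / card (V n)) \<longlonglongrightarrow> 1 - 0"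
    by (intro tendsto_diff tendsto_const tendsto_divide_0[OF tendsto_const]
        filterlim_at_top_imp_at_infinity)
  then have lim: "(\<lambda>n. 1 - ?c / card (V n)) \<longlonglongrightarrow> 1" by simp
  \<comment> \<open>The vertices that are not free then contribute at most \<open>e / 4\<close>,
    which is within the half of \<open>e\<close> reserved for them; \<open>B + 1\<close> avoids a
    division by 0.\<close>
  have "1 - e / (8 * (B + 1)) < 1" using e B0 by simp
  from card_free_vertices_eventually[OF this]
  have ev: "\<forall>\<^sub>F n in sequentially. 1 - ?c / card (V n) \<le> measure (free_model (V n) (\<sigma> n) \<mu>)
      {y \<in> space (free_model (V n) (\<sigma> n) \<mu>).
        \<bar>(\<Sum>v\<in>V n. f (pullback_name (\<sigma> n) v y)) / card (V n) - (\<integral>x. f x \<partial>\<mu>)\<bar> < e}"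
    using V(4)
  proof eventually_elim
    case (elim n)
    then have cV: "card (V n) > 0" using V(1) by (simp add: card_gt_0_iff)
    have "card (free_vertices (V n) (\<sigma> n)) \<le> card (V n)"
      by (rule card_mono[OF V(1)]) (auto simp: free_vertices_def)
    then have "2 * B * (card (V n) - card (free_vertices (V n) (\<sigma> n)))
        = 2 * B * (real (card (V n)) - real (card (free_vertices (V n) (\<sigma> n))))" by simp
    also have "\<dots> \<le> 2 * B * (e / (8 * (B + 1)) * card (V n))"
      using elim(1) B0 by (intro mult_left_mono) (auto simp: algebra_simps)
    also have "\<dots> = (B / (B + 1)) * (e / 4 * card (V n))" using B0 by (simp add: divide_simps)
    also have "\<dots> \<le> 1 * (e / 4 * card (V n))" using B0 e by (intro mult_right_mono) auto
    also have "\<dots> < e / 2 * card (V n)" using e cV by simp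
    finally show ?case
      using free_model_empirical[OF V(1,3) finG proc fm B elim(2) e] by simp
  qed
  show "(\<lambda>n. measure (free_model (V n) (\<sigma> n) \<mu>) {y \<in> space (free_model (V n) (\<sigma> n) \<mu>).
        \<bar>(\<Sum>v\<in>V n. f (pullback_name (\<sigma> n) v y)) / card (V n) - (\<integral>x. f x \<partial>\<mu>)\<bar> < e}) \<longlonglongrightarrow> 1"
    by (rule tendsto_1_mono[OF lim ev prob_space.prob_le_1[OF prob_onD(1)[OF prob]]])
qed

lemma free_model_mixing: "separated_mixing V \<sigma> (\<lambda>n. free_model (V n) (\<sigma> n) \<mu>) \<mu>"
  unfolding separated_mixing_def
proof (intro allI impI, elim conjE)
  fix F :: "'g set" and e :: real
  assume F: "finite F" and e: "e > 0"
  let ?H = "shannon_entropy (marginal F \<mu>)"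
  let ?HS = "\<lambda>n S. shannon_entropy (marginal (sofic_image (\<sigma> n) F S) (free_model (V n) (\<sigma> n) \<mu>))"
  note V = sofic_approximationD[OF sofic]
  define N where "N = real (card (UNIV :: 'g set))"
  have N: "N > 0" using finG by (simp add: N_def card_gt_0_iff)
  show "\<exists>c>0. \<forall>U. density_one V U \<longrightarrow>
      (\<forall>\<^sub>F n in sequentially. \<exists>S\<subseteq>{v\<in>V n. U n v}. c * real (card (V n)) \<le> real (card S) \<and>
        card S * (?H - e) \<le> ?HS n S)"
  \<comment> \<open>At least half of the vertices are free, so there are at least
    \<open>card (V n) / (2 * N)\<close> representatives, and at most half that number of vertices
    lie outside \<open>U\<close>.\<close>
  proof (intro exI[of _ "1 / (4 * N)"] conjI allI impI)
    show "1 / (4 * N) > 0" using N by simp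
    fix U assume U: "density_one V U"
    have lt: "1 - 1 / (4 * N) < 1" using N by simp
    have half: "1/2 < (1::real)" by simp
    show "\<forall>\<^sub>F n in sequentially. \<exists>S\<subseteq>{v\<in>V n. U n v}. 1 / (4 * N) * real (card (V n)) \<le> real (card S) \<and>
        card S * (?H - e)
          \<le> ?HS n S"
      using density_one_eventually_ge[OF U V(4,1) lt] card_free_vertices_eventually[OF half]
    proof eventually_elim
      case (elim n)
      let ?O = "transversal (V n) (\<sigma> n)"
      define S where "S = {t \<in> ?O. U n t}"
      have O: "?O \<subseteq> V n" "finite ?O"
      proof -
        have "?O \<subseteq> free_vertices (V n) (\<sigma> n)" by (rule transversal_free[OF V(1,3) finG])
        then show "?O \<subseteq> V n" by (auto simp: free_vertices_def)
        then show "finite ?O" by (rule finite_subset[OF _ V(1)])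
      qed
      have "card ?O = card S + card {t \<in> ?O. \<not> U n t}"
        unfolding S_def by (subst card_Un_disjoint[symmetric]) (auto simp: O intro!: arg_cong[where f=card])
      moreover have "card (V n) = card {v \<in> V n. U n v} + card {v \<in> V n. \<not> U n v}"
        by (subst card_Un_disjoint[symmetric]) (auto simp: V(1) intro!: arg_cong[where f=card])
      moreover have "card {t \<in> ?O. \<not> U n t} \<le> card {v \<in> V n. \<not> U n v}"
        using O(1) V(1) by (intro card_mono) auto
      moreover have "1/2 * card (V n) \<le> N * card ?O"
      proof -
        have "real (card (free_vertices (V n) (\<sigma> n))) \<le> real (card (UNIV :: 'g set) * card ?O)"
          unfolding of_nat_le_iff by (rule card_free_vertices_le[OF V(1,3) finG])
        then show ?thesis using elim(2) by (simp add: N_def)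
      qed
      then have "1 / (2 * N) * card (V n) \<le> card ?O" using N by (simp add: field_simps)
      moreover have "1 / (2 * N) * card (V n) - 1 / (4 * N) * card (V n) = 1 / (4 * N) * card (V n)"
        by (simp add: algebra_simps)
      moreover have "card (V n) - 1 / (4 * N) * card (V n) \<le> card {v \<in> V n. U n v}"
        using elim(1) by (simp add: algebra_simps)
      ultimately have "1 / (4 * N) * real (card (V n)) \<le> real (card S)" by linarith
      moreover have "?HS n S = card S * ?H"
        by (rule free_model_entropy[OF V(1,3) finG proc F]) (auto simp: S_def)
      moreover have "S \<subseteq> {v \<in> V n. U n v}" using O(1) by (auto simp: S_def)
      ultimately show ?case using e by (intro exI[of _ S]) (auto intro: mult_left_mono)
    qed
  qed
qed

end

theorem theorem1p2:
  fixes \<mu> :: "('g::{group_add, countable} \<Rightarrow> 'a::{finite, discrete_topology, second_countable_topology}) measure"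
    and V :: "nat \<Rightarrow> 'v set"
    and \<sigma> :: "nat \<Rightarrow> 'g \<Rightarrow> 'v \<Rightarrow> 'v"
    and \<rho> :: "'g \<Rightarrow> 'g \<Rightarrow> real"
    and M :: "nat \<Rightarrow> real"
    and \<mu>s :: "nat \<Rightarrow> ('v \<Rightarrow> 'a) measure"
  assumes "process \<mu>"
    and "sofic_approximation V \<sigma>"
    and "proper_right_invariant_metric \<rho>"
    and "\<And>n. exceeds_component_distances (M n) (V n) \<rho> (\<sigma> n)"
    and "\<And>n. \<mu>s n \<in> prob_on (V n)"
    and "uniformly_model_mixing V \<sigma> (\<lambda>n. sofic_dist (M n) (V n) \<rho> (\<sigma> n)) \<mu>s \<mu>"
    and "local_empirical_convergence V \<sigma> \<mu>s \<mu>"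
  shows "completely_positive_entropy_for TYPE('y::{metric_space, second_countable_topology}) V \<sigma> \<mu>"
  unfolding completely_positive_entropy_for_def
proof (intro impI ballI)
  fix \<psi> :: "('g \<Rightarrow> 'a) \<Rightarrow> 'y"
  assume cpt: "compact (UNIV :: 'y set)" and \<psi>: "\<psi> \<in> borel \<rightarrow>\<^sub>M borel"
    and nontriv: "\<nexists>y. distr \<mu> borel (equivariant_map \<psi>) = return borel y"
  show "0 < lower_model_measure_entropy V \<sigma> (distr \<mu> borel (equivariant_map \<psi>))"
  proof (cases "finite (UNIV :: 'g set)")
    case True
    \<comment> \<open>The entropy of the factor is a supremum over all model sequences converging to
      it, so models coded from a sequence other than the given one are admissible.\<close>
    show ?thesis
      by (rule positive_entropy_if_mixing[OF assms(1,2) _ free_model_convergence[OF assms(2) True assms(1)]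
            free_model_mixing[OF assms(2) True assms(1)] \<psi> cpt nontriv])
        (use sofic_approximationD[OF assms(2)] in \<open>auto intro!: free_model_prob_on True assms\<close>)
  next
    case False
    show ?thesis
      by (rule positive_entropy_if_mixing[OF assms(1,2,5,7) mixing_infinite_group[OF assms(3) False assms(2,4,6)] \<psi> cpt nontriv])
  qed
qed

end
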